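(* Let $(L,A,\delta_0)$ be a differential graded Loday pair over a field of characteristic zero, and let $d:=\sum_{i\ge0}t^i\delta_i$ be a deformation of $\delta_0$. For each $k\ge1$ define a coderivation on $(LA,\mathrm{reg}(\Delta))$ by $\partial_k:=N_k\delta_{k-1}$. Then $\partial:=\sum_{k\ge1}\partial_k$ is a structure of strong homotopy (sh) Loday pair, i.e. a codifferential on $(LA,\mathrm{reg}(\Delta))$. The multilinear map $N_k\delta_{k-1}$ corresponds (via $N_k\delta_{k-1}=s^{-1}\circ n_k\circ(s\otimes\cdots\otimes s)$) to the higher bracket on the shifted pair $(sL,sA)$ $$n_k(sx_1,\dots,sx_i,sa_{i+1},\dots,sa_{i+j}):=(\pm)\,s[[\dots[[[\dots[\delta_{i+j-1}x_1,x_2],\dots],x_i],a_{i+1}],\dots],a_{i+j}],$$ where $k:=i+j\ge1$, $x_\bullet\in L$, $a_\bullet\in A$, and, writing $o_r\in\{x_r,a_r\}$ for the $r$-th argument, the sign $\pm$ is $(-1)^{|o_1|+|o_3|+\cdots}$ (sum over all odd indices $\le k$) if $i+j$ is even and $(-1)^{|o_2|+|o_4|+\cdots}$ (sum over all even indices $\le k$) if $i+j$ is odd. (For $i=0$ the innermost entry is $\delta_{j-1}a_1$.) Moreover the restrictions $(sL,n|_{sL})$ and $(sA,n|_{sA})$ are an sh Loday algebra and an sh associative algebra, respectively.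
   Context: All spaces are graded vector spaces; the Koszul sign convention $(f\otimes g)(v_1\otimes v_2)=(-1)^{|g||v_1|}f(v_1)\otimes g(v_2)$ is used; $s$ and $s^{-1}$ are degree shifts of degree $+1$ and $-1$. A $(p,q)$-unshuffle is a permutation $\sigma$ with $\sigma(1)<\cdots<\sigma(p)$ and $\sigma(p+1)<\cdots<\sigma(p+q)$; $\epsilon(\sigma)$ denotes the Koszul sign of permuting the graded variables. Loday pair: a Loday algebra $L$ (bracket satisfying $[x,[y,z]]=[[x,y],z]+(-1)^{|x||y|}[y,[x,z]]$), an associative algebra $A$ with product written $[a,b]$, and a map $[\,,]:L\otimes A\to A$ with $$[x,[y,a]]=[[x,y],a]+(-1)^{|x||y|}[y,[x,a]],\qquad [x,[a,b]]=[[x,a],b]+(-1)^{|x||a|}[a,[x,b]]$$ for $x,y\in L$, $a,b\in A$. The multiplications have degree zero (or, more generally, even degree, in which case degree requirements are read modulo 2). A derivation of $(L,A)$ is a pair $D=(D_L,D_A)$ of derivations of $L$ and $A$, of equal parity, with $D[o_1,o_2]=[Do_1,o_2]+(-1)^{|D||o_1|}[o_1,Do_2]$ for all $o_1,o_2\in(L,A)$ for which the product is defined. A dg Loday pair is a Loday pair with a square-zero derivation $\delta_0$ of degree $+1$. A deformation of $\delta_0$ is $d=\sum_{i\ge0}t^i\delta_i$ with each $\delta_i$ a derivation of $(L,A)$ of degree $+1$ and $dd=0$, i.e. $\sum_{i+j=n}\delta_i\delta_j=0$ for all $n\ge 0$. For a derivation $D$, $k\ge1$ and $i+j=k$, set $$N_kD(x_1,\dots,x_i,a_{i+1},\dots,a_{i+j}):=[[\dots[[[\dots[Dx_1,x_2],\dots],x_i],a_{i+1}],\dots],a_{i+j}];$$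 for $i=0$ this is $[[\dots[Da_1,a_2],\dots],a_j]$. Thus $N_kD$ has components in $\mathrm{Hom}(L^{\otimes k},L)$ and $\mathrm{Hom}(L^{\otimes i}\otimes A^{\otimes j},A)$ ($i+j=k$, $j\ge1$). The regularized coalgebra: $LA:=\bigoplus_{n\ge1}\bigoplus_{i+j=n}L^{\otimes i}\otimes A^{\otimes j}$. For a word $(x_1,\dots,x_m,a_1,\dots,a_n)$ with $n\ge1$, $$\mathrm{reg}(\Delta)(x_1,\dots,x_m,a_1,\dots,a_n)=\sum_{i,k}\sum_\sigma(\pm)(x_{\sigma(1)},\dots,x_{\sigma(i)},a_1,\dots,a_k)\otimes(x_{\sigma(i+1)},\dots,x_{\sigma(m)},a_{k+1},\dots,a_n),$$ over $0\le i\le m$, $0\le k\le n-1$, $i+k\ge1$, $\sigma$ an $(i,m-i)$-unshuffle, with the Koszul sign of the rearrangement. For $n=0$, $\mathrm{reg}(\Delta)(x_1,\dots,x_m)=\Delta_L(x_1,\dots,x_m)=\sum_{i=1}^{m-1}\sum_\sigma\epsilon(\sigma)(x_{\sigma(1)},\dots,x_{\sigma(i)})\otimes(x_{\sigma(i+1)},\dots,x_{\sigma(m-1)},x_m)$, $\sigma$ an $(i,m-1-i)$-unshuffle. Multilinear maps are identified with coderivations of $(LA,\mathrm{reg}(\Delta))$ as follows. $f\in\mathrm{Hom}(L^{\otimes i},L)$ gives $$(x_1,\dots,x_m,a_1,\dots,a_n)\mapsto\sum_{k=i}^m\sum_\sigma\epsilon(\sigma)(-1)^{|f|(|x_{\sigma(1)}|+\cdots+|x_{\sigma(k-i)}|)}(x_{\sigma(1)},\dots,x_{\sigma(k-i)},f(x_{\sigma(k+1-i)},\dots,x_{\sigma(k-1)},x_k),x_{k+1},\dots,x_m,a_1,\dots,a_n),$$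 $\sigma$ a $(k-i,i-1)$-unshuffle. $f\in\mathrm{Hom}(L^{\otimes i}\otimes A^{\otimes j},A)$, $j\ge1$, gives $$(x_1,\dots,x_m,a_1,\dots,a_n)\mapsto\sum_{k=0}^{n-j}\sum_\sigma(\pm)(x_{\sigma(1)},\dots,x_{\sigma(m-i)},a_1,\dots,a_k,f(x_{\sigma(m-i+1)},\dots,x_{\sigma(m)},a_{k+1},\dots,a_{k+j}),a_{k+j+1},\dots,a_n),$$ $\sigma$ an $(m-i,i)$-unshuffle, $\pm$ being the Koszul sign of the rearrangement of variables times $(-1)^{|f|(\text{total degree of the entries to the left of }f)}$. (Both are zero when there are too few variables.) A codifferential is a coderivation of degree $+1$ with square zero. An sh Loday pair is a pair $(sL,sA)$ equipped with a codifferential on $(LA,\mathrm{reg}(\Delta))$. An sh Loday algebra $(sL,l_1,l_2,\dots)$ is given by maps $l_i:(sL)^{\otimes i}\to sL$ of degree $2-i$ such that the sum of the coderivations of $(\bar TL,\Delta_L)$, $\bar TL=\bigoplus_{n\ge1}L^{\otimes n}$, associated (by the first formula above with $n=0$) to the maps $s^{-1}\circ l_i\circ(s\otimes\cdots\otimes s)$ is square zero. An sh associative ($A_\infty$-) algebra $(sA,m_1,m_2,\dots)$ is given by maps $m_i:(sA)^{\otimes i}\to sA$ of degree $2-i$ such that the sum of the coderivations of the deconcatenation coalgebra $\bar TA=\bigoplus_{n\ge1}A^{\otimes n}$ associated (by the second formula above with $m=0$, $i=0$) to the maps $s^{-1}\circ m_j\circ(s\otimes\cdots\otimes s)$ is square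 zero. Here $n|_{sL}$ and $n|_{sA}$ denote the families of the $n_k$ restricted to $(sL)^{\otimes k}$ and to $(sA)^{\otimes k}$. *)

theory Defs
  imports Complex_Main "HOL-Library.Poly_Mapping" "HOL-Combinatorics.Permutations"
begin

section \<open>Graded vector spaces\<close>

text \<open>A graded vector space lives on a whole type; \<open>scl\<close> is the scalar multiplication and
  \<open>gr d\<close> the homogeneous component of degree \<open>d\<close>.\<close>

record ('k, 'v) gspace =
  scl :: "'k \<Rightarrow> 'v \<Rightarrow> 'v"
  gr :: "int \<Rightarrow> 'v set"

text \<open>The integer \<open>M\<close> is the modulus to which degrees are read: for \<open>M = 0\<close> this is a
  \<open>\<int>\<close>-graded space (recall \<open>d mod 0 = d\<close>), for \<open>M = 2\<close> components of congruent degree coincide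
  and the space is the direct sum of an even and an odd part. A product of even degree on a
  \<open>\<int>\<close>-graded space is a product of degree zero for the latter grading.\<close>

definition graded_space :: "int \<Rightarrow> ('k::field, 'v::ab_group_add) gspace \<Rightarrow> bool" where
  "graded_space M V \<longleftrightarrow>
     vector_space (scl V) \<and>
     (\<forall>d. module.subspace (scl V) (gr V d)) \<and>
     (\<forall>d e. d mod M = e mod M \<longrightarrow> gr V d = gr V e) \<and>
     module.span (scl V) (\<Union>d. gr V d) = UNIV \<and>
     (\<forall>D v. finite D \<and> inj_on (\<lambda>d. d mod M) D \<and> (\<forall>d\<in>D. v d \<in> gr V d) \<and> (\<Sum>d\<in>D. v d) = 0
        \<longrightarrow> (\<forall>d\<in>D. v d = 0))"

definition homs :: "('k, 'v) gspace \<Rightarrow> 'v set" where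
  "homs V = (\<Union>d. gr V d)"

text \<open>The degree of a homogeneous element. The value at \<open>0\<close> is arbitrary; this is harmless, as it
  only enters signs in front of expressions that vanish when one of their arguments does.\<close>

definition hdeg :: "('k, 'v) gspace \<Rightarrow> 'v \<Rightarrow> int" where
  "hdeg V x = (SOME d. x \<in> gr V d)"

definition of_degs :: "('k, 'v) gspace \<Rightarrow> 'v list \<Rightarrow> int list \<Rightarrow> bool" where
  "of_degs V xs ds \<longleftrightarrow> list_all2 (\<lambda>x d. x \<in> gr V d) xs ds"

text \<open>\<open>psign n v\<close> is $(-1)^n v$.\<close>

definition psign :: "int \<Rightarrow> 'v::ab_group_add \<Rightarrow> 'v" where
  "psign n v = (if even n then v else - v)"

definition linear_deg ::
    "('k::field, 'v::ab_group_add) gspace \<Rightarrow> int \<Rightarrow> ('v \<Rightarrow> 'v) \<Rightarrow> bool" where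
  "linear_deg V p f \<longleftrightarrow>
     Vector_Spaces.linear (scl V) (scl V) f \<and> (\<forall>d. \<forall>x\<in>gr V d. f x \<in> gr V (d + p))"

definition bilinear_deg0 ::
    "('k::field, 'u::ab_group_add) gspace \<Rightarrow> ('k, 'v::ab_group_add) gspace \<Rightarrow>
     ('k, 'w::ab_group_add) gspace \<Rightarrow> ('u \<Rightarrow> 'v \<Rightarrow> 'w) \<Rightarrow> bool" where
  "bilinear_deg0 U V W b \<longleftrightarrow>
     (\<forall>x. Vector_Spaces.linear (scl V) (scl W) (b x)) \<and>
     (\<forall>y. Vector_Spaces.linear (scl U) (scl W) (\<lambda>x. b x y)) \<and>
     (\<forall>p q. \<forall>x\<in>gr U p. \<forall>y\<in>gr V q. b x y \<in> gr W (p + q))"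

text \<open>Elements of $\mathrm{Hom}(V^{\otimes n},V)$ of degree \<open>p\<close>, as functions of \<open>n\<close> homogeneous
  arguments that are linear in each argument on each homogeneous component.\<close>

definition multilinear_deg ::
    "('k, 'v::ab_group_add) gspace \<Rightarrow> nat \<Rightarrow> int \<Rightarrow> ('v list \<Rightarrow> 'v) \<Rightarrow> bool" where
  "multilinear_deg V n p f \<longleftrightarrow>
     (\<forall>us vs d a b. \<forall>x\<in>gr V d. \<forall>y\<in>gr V d.
        set us \<subseteq> homs V \<and> set vs \<subseteq> homs V \<and> length us + length vs + 1 = n \<longrightarrow>
        f (us @ [scl V a x + scl V b y] @ vs)
          = scl V a (f (us @ [x] @ vs)) + scl V b (f (us @ [y] @ vs))) \<and>
     (\<forall>xs ds. of_degs V xs ds \<and> length xs = n \<longrightarrow> f xs \<in> gr V (sum_list ds + p))"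

subsection \<open>Suspension\<close>

text \<open>The suspension is a copy of the space with degrees raised by one; \<open>Susp\<close> is the map $s$.\<close>

datatype 'v susp = Susp (unsusp: 'v)

instantiation susp :: (ab_group_add) ab_group_add
begin

definition "0 = Susp 0"
definition "x + y = Susp (unsusp x + unsusp y)"
definition "x - y = Susp (unsusp x - unsusp y)"
definition "- x = Susp (- unsusp x)"

instance
  by standard
    (auto simp: zero_susp_def plus_susp_def minus_susp_def uminus_susp_def susp.expand algebra_simps)

end

definition suspension :: "('k, 'v) gspace \<Rightarrow> ('k, 'v susp) gspace" where
  "suspension V = \<lparr>scl = (\<lambda>c y. Susp (scl V c (unsusp y))), gr = (\<lambda>d. Susp ` gr V (d - 1))\<rparr>"

text \<open>$(s\otimes\dots\otimes s)(v_1,\dots,v_k)$ is the sign with the following exponent times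
  $(sv_1,\dots,sv_k)$, where the argument lists the degrees of the $v_i$: the $k-i$ last copies of
  $s$ move past $v_i$.\<close>

fun susp_exp :: "int list \<Rightarrow> int" where
  "susp_exp [] = 0"
| "susp_exp (d # ds) = int (length ds) * d + susp_exp ds"

text \<open>$s^{-1}\circ f\circ(s\otimes\dots\otimes s)$ for \<open>f\<close> with arguments from one space, and for
  \<open>f\<close> with arguments from two spaces.\<close>

definition desusp1 :: "('k, 'v::ab_group_add) gspace \<Rightarrow> ('v susp list \<Rightarrow> 'v susp) \<Rightarrow> 'v list \<Rightarrow> 'v"
  where
  "desusp1 V f xs = psign (susp_exp (map (hdeg V) xs)) (unsusp (f (map Susp xs)))"

definition desusp2 ::
    "('k, 'l) gspace \<Rightarrow> ('k, 'a::ab_group_add) gspace \<Rightarrow>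
     ('l susp list \<Rightarrow> 'a susp list \<Rightarrow> 'a susp) \<Rightarrow> 'l list \<Rightarrow> 'a list \<Rightarrow> 'a" where
  "desusp2 L A f xs as =
     psign (susp_exp (map (hdeg L) xs @ map (hdeg A) as)) (unsusp (f (map Susp xs) (map Susp as)))"

section \<open>Loday pairs, derivations and deformations\<close>

definition loday_pair ::
    "int \<Rightarrow> ('k::field, 'l::ab_group_add) gspace \<Rightarrow> ('k, 'a::ab_group_add) gspace \<Rightarrow>
     ('l \<Rightarrow> 'l \<Rightarrow> 'l) \<Rightarrow> ('l \<Rightarrow> 'a \<Rightarrow> 'a) \<Rightarrow> ('a \<Rightarrow> 'a \<Rightarrow> 'a) \<Rightarrow> bool" where
  "loday_pair M L A bLL bLA bAA \<longleftrightarrow>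
     graded_space M L \<and> graded_space M A \<and>
     bilinear_deg0 L L L bLL \<and> bilinear_deg0 L A A bLA \<and> bilinear_deg0 A A A bAA \<and>
     (\<forall>p q. \<forall>x\<in>gr L p. \<forall>y\<in>gr L q. \<forall>z.
        bLL x (bLL y z) = bLL (bLL x y) z + psign (p * q) (bLL y (bLL x z))) \<and>
     (\<forall>a b c. bAA (bAA a b) c = bAA a (bAA b c)) \<and>
     (\<forall>p q. \<forall>x\<in>gr L p. \<forall>y\<in>gr L q. \<forall>a.
        bLA x (bLA y a) = bLA (bLL x y) a + psign (p * q) (bLA y (bLA x a))) \<and>
     (\<forall>p q. \<forall>x\<in>gr L p. \<forall>a\<in>gr A q. \<forall>b.
        bLA x (bAA a b) = bAA (bLA x a) b + psign (p * q) (bAA a (bLA x b)))"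

definition pair_derivation ::
    "('k::field, 'l::ab_group_add) gspace \<Rightarrow> ('k, 'a::ab_group_add) gspace \<Rightarrow>
     ('l \<Rightarrow> 'l \<Rightarrow> 'l) \<Rightarrow> ('l \<Rightarrow> 'a \<Rightarrow> 'a) \<Rightarrow> ('a \<Rightarrow> 'a \<Rightarrow> 'a) \<Rightarrow>
     int \<Rightarrow> ('l \<Rightarrow> 'l) \<Rightarrow> ('a \<Rightarrow> 'a) \<Rightarrow> bool" where
  "pair_derivation L A bLL bLA bAA p DL DA \<longleftrightarrow>
     linear_deg L p DL \<and> linear_deg A p DA \<and>
     (\<forall>q. \<forall>x\<in>gr L q. \<forall>y. DL (bLL x y) = bLL (DL x) y + psign (p * q) (bLL x (DL y))) \<and>
     (\<forall>q. \<forall>x\<in>gr L q. \<forall>a. DA (bLA x a) = bLA (DL x) a + psign (p * q) (bLA x (DA a))) \<and>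
     (\<forall>q. \<forall>a\<in>gr A q. \<forall>b. DA (bAA a b) = bAA (DA a) b + psign (p * q) (bAA a (DA b)))"

definition dg_loday_pair ::
    "int \<Rightarrow> ('k::field, 'l::ab_group_add) gspace \<Rightarrow> ('k, 'a::ab_group_add) gspace \<Rightarrow>
     ('l \<Rightarrow> 'l \<Rightarrow> 'l) \<Rightarrow> ('l \<Rightarrow> 'a \<Rightarrow> 'a) \<Rightarrow> ('a \<Rightarrow> 'a \<Rightarrow> 'a) \<Rightarrow> ('l \<Rightarrow> 'l) \<Rightarrow> ('a \<Rightarrow> 'a) \<Rightarrow> bool" where
  "dg_loday_pair M L A bLL bLA bAA DL DA \<longleftrightarrow>
     loday_pair M L A bLL bLA bAA \<and> pair_derivation L A bLL bLA bAA 1 DL DA \<and>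
     (\<forall>x. DL (DL x) = 0) \<and> (\<forall>a. DA (DA a) = 0)"

text \<open>\<open>\<delta>L i\<close> and \<open>\<delta>A i\<close> are the two components of the coefficient of $t^i$; the deformed
  differential is \<open>(\<delta>L 0, \<delta>A 0)\<close>.\<close>

definition deformation ::
    "('k::field, 'l::ab_group_add) gspace \<Rightarrow> ('k, 'a::ab_group_add) gspace \<Rightarrow>
     ('l \<Rightarrow> 'l \<Rightarrow> 'l) \<Rightarrow> ('l \<Rightarrow> 'a \<Rightarrow> 'a) \<Rightarrow> ('a \<Rightarrow> 'a \<Rightarrow> 'a) \<Rightarrow>
     (nat \<Rightarrow> 'l \<Rightarrow> 'l) \<Rightarrow> (nat \<Rightarrow> 'a \<Rightarrow> 'a) \<Rightarrow> bool" where
  "deformation L A bLL bLA bAA \<delta>L \<delta>A \<longleftrightarrow>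
     (\<forall>i. pair_derivation L A bLL bLA bAA 1 (\<delta>L i) (\<delta>A i)) \<and>
     (\<forall>n x. (\<Sum>i\<le>n. \<delta>L i (\<delta>L (n - i) x)) = 0) \<and>
     (\<forall>n a. (\<Sum>i\<le>n. \<delta>A i (\<delta>A (n - i) a)) = 0)"

text \<open>The components of $N_kD$ with values in \<open>L\<close> and in \<open>A\<close>; $k$ is the number of arguments.
  \<open>N_A\<close> is only meaningful if the second list is nonempty.\<close>

definition N_L :: "('l \<Rightarrow> 'l \<Rightarrow> 'l) \<Rightarrow> ('l \<Rightarrow> 'l) \<Rightarrow> 'l list \<Rightarrow> 'l" where
  "N_L bLL DL xs = foldl bLL (DL (hd xs)) (tl xs)"

definition N_A ::
    "('l \<Rightarrow> 'l \<Rightarrow> 'l) \<Rightarrow> ('l \<Rightarrow> 'a \<Rightarrow> 'a) \<Rightarrow> ('a \<Rightarrow> 'a \<Rightarrow> 'a) \<Rightarrow> ('l \<Rightarrow> 'l) \<Rightarrow> ('a \<Rightarrow> 'a) \<Rightarrow>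
     'l list \<Rightarrow> 'a list \<Rightarrow> 'a" where
  "N_A bLL bLA bAA DL DA xs as =
     foldl bAA (if xs = [] then DA (hd as) else bLA (N_L bLL DL xs) (hd as)) (tl as)"

text \<open>The higher brackets on the shifted pair, by the explicit formula. \<open>bracket_exp\<close> sums the
  degrees at odd places if the number of arguments is even, and at even places if it is odd
  (places are counted from 1).\<close>

definition bracket_exp :: "int list \<Rightarrow> int" where
  "bracket_exp ds =
     (\<Sum>r | r \<in> {1..length ds} \<and> (odd r \<longleftrightarrow> even (length ds)). ds ! (r - 1))"

definition n_L ::
    "('k, 'l::ab_group_add) gspace \<Rightarrow> ('l \<Rightarrow> 'l \<Rightarrow> 'l) \<Rightarrow> ('l \<Rightarrow> 'l) \<Rightarrow> 'l susp list \<Rightarrow> 'l susp" where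
  "n_L L bLL DL sxs =
     (let xs = map unsusp sxs
      in psign (bracket_exp (map (hdeg L) xs)) (Susp (N_L bLL DL xs)))"

definition n_A ::
    "('k, 'l) gspace \<Rightarrow> ('k, 'a::ab_group_add) gspace \<Rightarrow>
     ('l \<Rightarrow> 'l \<Rightarrow> 'l) \<Rightarrow> ('l \<Rightarrow> 'a \<Rightarrow> 'a) \<Rightarrow> ('a \<Rightarrow> 'a \<Rightarrow> 'a) \<Rightarrow> ('l \<Rightarrow> 'l) \<Rightarrow> ('a \<Rightarrow> 'a) \<Rightarrow>
     'l susp list \<Rightarrow> 'a susp list \<Rightarrow> 'a susp" where
  "n_A L A bLL bLA bAA DL DA sxs sas =
     (let xs = map unsusp sxs; as = map unsusp sas
      in psign (bracket_exp (map (hdeg L) xs @ map (hdeg A) as))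
           (Susp (N_A bLL bLA bAA DL DA xs as)))"

section \<open>Tensor spaces by generators and relations\<close>

text \<open>A direct sum of tensor products is presented as the free vector space on words of homogeneous
  letters modulo the subspace spanned by the multilinearity relations. Its vectors are represented
  by elements of the free space, two of them being equal iff they differ by a relation; its linear
  maps are represented by linear maps of the free space that preserve the relations.\<close>

definition fscl :: "'k::field \<Rightarrow> ('w \<Rightarrow>\<^sub>0 'k) \<Rightarrow> ('w \<Rightarrow>\<^sub>0 'k)" where
  "fscl c u = Poly_Mapping.map (\<lambda>y. c * y) u"

abbreviation fspan :: "('w \<Rightarrow>\<^sub>0 'k::field) set \<Rightarrow> ('w \<Rightarrow>\<^sub>0 'k) set" where
  "fspan \<equiv> module.span fscl"

abbreviation wd :: "'w \<Rightarrow> ('w \<Rightarrow>\<^sub>0 'k::field)" where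
  "wd w \<equiv> Poly_Mapping.single w 1"

text \<open>Linear extension of a function given on words.\<close>

definition lin_ext :: "('w \<Rightarrow> ('z \<Rightarrow>\<^sub>0 'k::field)) \<Rightarrow> ('w \<Rightarrow>\<^sub>0 'k) \<Rightarrow> ('z \<Rightarrow>\<^sub>0 'k)" where
  "lin_ext f u = (\<Sum>w\<in>Poly_Mapping.keys u. fscl (Poly_Mapping.lookup u w) (f w))"

definition ftensor :: "('w \<Rightarrow>\<^sub>0 'k::field) \<Rightarrow> ('z \<Rightarrow>\<^sub>0 'k) \<Rightarrow> ('w \<times> 'z \<Rightarrow>\<^sub>0 'k)" where
  "ftensor u v = lin_ext (\<lambda>w. lin_ext (\<lambda>z. wd (w, z)) v) u"

text \<open>The relations of linearity in one letter \<open>x\<close> of the word \<open>W x\<close>.\<close>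

definition slot_relations ::
    "('k::field, 'v::ab_group_add) gspace \<Rightarrow> ('v \<Rightarrow> 'w) \<Rightarrow> ('w \<Rightarrow>\<^sub>0 'k) set" where
  "slot_relations V W =
     {wd (W (scl V a x + scl V b y)) - fscl a (wd (W x)) - fscl b (wd (W y)) | a b x y d.
        x \<in> gr V d \<and> y \<in> gr V d}"

text \<open>An endomorphism of the space presented by the words \<open>W\<close> and the relations \<open>R\<close>.\<close>

definition endomorphism ::
    "'w set \<Rightarrow> ('w \<Rightarrow>\<^sub>0 'k::field) set \<Rightarrow> (('w \<Rightarrow>\<^sub>0 'k) \<Rightarrow> ('w \<Rightarrow>\<^sub>0 'k)) \<Rightarrow> bool" where
  "endomorphism W R F \<longleftrightarrow>
     Vector_Spaces.linear fscl fscl F \<and> F ` fspan (wd ` W) \<subseteq> fspan (wd ` W) \<and> F ` R \<subseteq> R"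

definition square_zero ::
    "'w set \<Rightarrow> ('w \<Rightarrow>\<^sub>0 'k::field) set \<Rightarrow> (('w \<Rightarrow>\<^sub>0 'k) \<Rightarrow> ('w \<Rightarrow>\<^sub>0 'k)) \<Rightarrow> bool" where
  "square_zero W R F \<longleftrightarrow> (\<forall>u\<in>fspan (wd ` W). F (F u) \<in> R)"

text \<open>$\bar TV=\bigoplus_{n\ge1}V^{\otimes n}$.\<close>

definition T_words :: "('k, 'v) gspace \<Rightarrow> 'v list set" where
  "T_words V = {xs. xs \<noteq> [] \<and> set xs \<subseteq> homs V}"

definition T_rel :: "('k::field, 'v::ab_group_add) gspace \<Rightarrow> ('v list \<Rightarrow>\<^sub>0 'k) set" where
  "T_rel V = fspan (\<Union>{slot_relations V (\<lambda>x. us @ [x] @ vs) | us vs.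
     set us \<subseteq> homs V \<and> set vs \<subseteq> homs V})"

text \<open>$LA=\bigoplus_{i+j\ge1}L^{\otimes i}\otimes A^{\otimes j}$.\<close>

definition LA_words :: "('k, 'l) gspace \<Rightarrow> ('k, 'a) gspace \<Rightarrow> ('l list \<times> 'a list) set" where
  "LA_words L A =
     {(xs, as). (xs \<noteq> [] \<or> as \<noteq> []) \<and> set xs \<subseteq> homs L \<and> set as \<subseteq> homs A}"

definition LA_rel ::
    "('k::field, 'l::ab_group_add) gspace \<Rightarrow> ('k, 'a::ab_group_add) gspace \<Rightarrow>
     ('l list \<times> 'a list \<Rightarrow>\<^sub>0 'k) set" where
  "LA_rel L A = fspan
     (\<Union>{slot_relations L (\<lambda>x. (us @ [x] @ vs, as)) | us vs as.
          set us \<subseteq> homs L \<and> set vs \<subseteq> homs L \<and> set as \<subseteq> homs A} \<union>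
      \<Union>{slot_relations A (\<lambda>a. (xs, bs @ [a] @ cs)) | xs bs cs.
          set xs \<subseteq> homs L \<and> set bs \<subseteq> homs A \<and> set cs \<subseteq> homs A})"

definition LA_comp ::
    "('k::field, 'l) gspace \<Rightarrow> ('k, 'a) gspace \<Rightarrow> int \<Rightarrow> ('l list \<times> 'a list \<Rightarrow>\<^sub>0 'k) set" where
  "LA_comp L A d = fspan {wd (xs, as) | xs as ds es. (xs \<noteq> [] \<or> as \<noteq> []) \<and>
     of_degs L xs ds \<and> of_degs A as es \<and> sum_list ds + sum_list es = d}"

definition LA_deg :: "('k, 'l) gspace \<Rightarrow> ('k, 'a) gspace \<Rightarrow> 'l list \<times> 'a list \<Rightarrow> int" where
  "LA_deg L A w = sum_list (map (hdeg L) (fst w)) + sum_list (map (hdeg A) (snd w))"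

text \<open>The relations of $LA\otimes LA$ on pairs of words.\<close>

definition LA2_rel ::
    "('k::field, 'l::ab_group_add) gspace \<Rightarrow> ('k, 'a::ab_group_add) gspace \<Rightarrow>
     (('l list \<times> 'a list) \<times> ('l list \<times> 'a list) \<Rightarrow>\<^sub>0 'k) set" where
  "LA2_rel L A = fspan
     ({ftensor r (wd w) | r w. r \<in> LA_rel L A \<and> w \<in> LA_words L A} \<union>
      {ftensor (wd w) r | r w. r \<in> LA_rel L A \<and> w \<in> LA_words L A})"

section \<open>The regularized coalgebra\<close>

text \<open>Places in lists are counted from 0; accordingly, a \<open>(p, q)\<close>-unshuffle permutes
  \<open>{..<p + q}\<close>.\<close>

definition unshuffles :: "nat \<Rightarrow> nat \<Rightarrow> (nat \<Rightarrow> nat) set" where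
  "unshuffles p q = {\<sigma>. \<sigma> permutes {..<p + q} \<and>
     strict_mono_on {..<p} \<sigma> \<and> strict_mono_on {p..<p + q} \<sigma>}"

text \<open>\<open>koszul ds n \<sigma>\<close> is the exponent of the Koszul sign $\epsilon(\sigma)$ of rearranging $n$
  variables of degrees \<open>ds\<close> into the order \<open>\<sigma> 0, \<dots>, \<sigma> (n - 1)\<close>.\<close>

definition koszul :: "int list \<Rightarrow> nat \<Rightarrow> (nat \<Rightarrow> nat) \<Rightarrow> int" where
  "koszul ds n \<sigma> = (\<Sum>(r, t) | r < t \<and> t < n \<and> \<sigma> t < \<sigma> r. ds ! \<sigma> r * ds ! \<sigma> t)"

text \<open>\<open>pick xs \<sigma> b e\<close> is the list $x_{\sigma(b)},\dots,x_{\sigma(e-1)}$.\<close>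

definition pick :: "'v list \<Rightarrow> (nat \<Rightarrow> nat) \<Rightarrow> nat \<Rightarrow> nat \<Rightarrow> 'v list" where
  "pick xs \<sigma> b e = map (\<lambda>r. xs ! \<sigma> r) [b..<e]"

abbreviation degsum :: "('k, 'v) gspace \<Rightarrow> 'v list \<Rightarrow> int" where
  "degsum V xs \<equiv> sum_list (map (hdeg V) xs)"

definition reg_Delta_word ::
    "('k::field, 'l) gspace \<Rightarrow> ('k, 'a) gspace \<Rightarrow> 'l list \<times> 'a list \<Rightarrow>
     (('l list \<times> 'a list) \<times> ('l list \<times> 'a list) \<Rightarrow>\<^sub>0 'k)" where
  "reg_Delta_word L A w = (case w of (xs, as) \<Rightarrow>
     let m = length xs; n = length as; ds = map (hdeg L) xs in
     if n = 0 then
       (\<Sum>i\<in>{1..m - 1}. \<Sum>\<sigma>\<in>unshuffles i (m - 1 - i).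
          psign (koszul ds (m - 1) \<sigma>)
            (wd ((pick xs \<sigma> 0 i, []), (pick xs \<sigma> i (m - 1) @ [last xs], []))))
     else
       (\<Sum>(i, k) | i \<le> m \<and> k \<le> n - 1 \<and> 1 \<le> i + k. \<Sum>\<sigma>\<in>unshuffles i (m - i).
          psign (koszul ds m \<sigma> + degsum L (pick xs \<sigma> i m) * degsum A (take k as))
            (wd ((pick xs \<sigma> 0 i, take k as), (pick xs \<sigma> i m, drop k as)))))"

definition reg_Delta ::
    "('k::field, 'l) gspace \<Rightarrow> ('k, 'a) gspace \<Rightarrow> ('l list \<times> 'a list \<Rightarrow>\<^sub>0 'k) \<Rightarrow>
     (('l list \<times> 'a list) \<times> ('l list \<times> 'a list) \<Rightarrow>\<^sub>0 'k)" where
  "reg_Delta L A = lin_ext (reg_Delta_word L A)"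

text \<open>$F\otimes1+1\otimes F$ for \<open>F\<close> of degree \<open>p\<close>.\<close>

definition LA2_extend ::
    "('k::field, 'l) gspace \<Rightarrow> ('k, 'a) gspace \<Rightarrow> int \<Rightarrow>
     (('l list \<times> 'a list \<Rightarrow>\<^sub>0 'k) \<Rightarrow> ('l list \<times> 'a list \<Rightarrow>\<^sub>0 'k)) \<Rightarrow>
     (('l list \<times> 'a list) \<times> ('l list \<times> 'a list) \<Rightarrow>\<^sub>0 'k) \<Rightarrow>
     (('l list \<times> 'a list) \<times> ('l list \<times> 'a list) \<Rightarrow>\<^sub>0 'k)" where
  "LA2_extend L A p F = lin_ext (\<lambda>(v, w).
     ftensor (F (wd v)) (wd w) + psign (p * LA_deg L A v) (ftensor (wd v) (F (wd w))))"

definition coderivation ::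
    "('k::field, 'l::ab_group_add) gspace \<Rightarrow> ('k, 'a::ab_group_add) gspace \<Rightarrow> int \<Rightarrow>
     (('l list \<times> 'a list \<Rightarrow>\<^sub>0 'k) \<Rightarrow> ('l list \<times> 'a list \<Rightarrow>\<^sub>0 'k)) \<Rightarrow> bool" where
  "coderivation L A p F \<longleftrightarrow>
     endomorphism (LA_words L A) (LA_rel L A) F \<and>
     (\<forall>d. \<forall>u\<in>LA_comp L A d. \<exists>v\<in>LA_comp L A (d + p). F u - v \<in> LA_rel L A) \<and>
     (\<forall>u\<in>fspan (wd ` LA_words L A).
        reg_Delta L A (F u) - LA2_extend L A p F (reg_Delta L A u) \<in> LA2_rel L A)"

definition codifferential ::
    "('k::field, 'l::ab_group_add) gspace \<Rightarrow> ('k, 'a::ab_group_add) gspace \<Rightarrow>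
     (('l list \<times> 'a list \<Rightarrow>\<^sub>0 'k) \<Rightarrow> ('l list \<times> 'a list \<Rightarrow>\<^sub>0 'k)) \<Rightarrow> bool" where
  "codifferential L A F \<longleftrightarrow>
     coderivation L A 1 F \<and> square_zero (LA_words L A) (LA_rel L A) F"

text \<open>\<open>F\<close> is an sh Loday pair structure on the shifted pair $(sL,sA)$.\<close>

definition sh_loday_pair ::
    "int \<Rightarrow> ('k::field, 'l::ab_group_add) gspace \<Rightarrow> ('k, 'a::ab_group_add) gspace \<Rightarrow>
     (('l list \<times> 'a list \<Rightarrow>\<^sub>0 'k) \<Rightarrow> ('l list \<times> 'a list \<Rightarrow>\<^sub>0 'k)) \<Rightarrow> bool" where
  "sh_loday_pair M L A F \<longleftrightarrow> graded_space M L \<and> graded_space M A \<and> codifferential L A F"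

section \<open>Multilinear maps as coderivations\<close>

text \<open>For \<open>f\<close> in $\mathrm{Hom}(L^{\otimes i},L)$ of degree \<open>p\<close>, $i\ge1$: the value on a word of the
  coderivation of $(\bar TL,\Delta_L)$, and of the coderivation of $(LA,\mathrm{reg}(\Delta))$, which
  leaves the letters from \<open>A\<close> in place.\<close>

definition coder_L_word ::
    "('k::field, 'l) gspace \<Rightarrow> int \<Rightarrow> nat \<Rightarrow> ('l list \<Rightarrow> 'l) \<Rightarrow> 'l list \<Rightarrow> ('l list \<Rightarrow>\<^sub>0 'k)" where
  "coder_L_word L p i f xs =
     (\<Sum>k\<in>{i..length xs}. \<Sum>\<sigma>\<in>unshuffles (k - i) (i - 1).
        psign (koszul (map (hdeg L) xs) (k - 1) \<sigma> + p * degsum L (pick xs \<sigma> 0 (k - i)))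
          (wd (pick xs \<sigma> 0 (k - i) @ [f (pick xs \<sigma> (k - i) (k - 1) @ [xs ! (k - 1)])] @ drop k xs)))"

definition coder_LA_L_word ::
    "('k::field, 'l) gspace \<Rightarrow> int \<Rightarrow> nat \<Rightarrow> ('l list \<Rightarrow> 'l) \<Rightarrow> 'l list \<times> 'a list \<Rightarrow>
     ('l list \<times> 'a list \<Rightarrow>\<^sub>0 'k)" where
  "coder_LA_L_word L p i f w =
     (case w of (xs, as) \<Rightarrow> lin_ext (\<lambda>ys. wd (ys, as)) (coder_L_word L p i f xs))"

text \<open>For \<open>f\<close> in $\mathrm{Hom}(L^{\otimes i}\otimes A^{\otimes j},A)$ of degree \<open>p\<close>, $j\ge1$. The
  product of degrees in the exponent comes from moving $a_1,\dots,a_k$ to the left of those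
  letters from \<open>L\<close> that become arguments of \<open>f\<close>.\<close>

definition coder_LA_A_word ::
    "('k::field, 'l) gspace \<Rightarrow> ('k, 'a) gspace \<Rightarrow> int \<Rightarrow> nat \<Rightarrow> nat \<Rightarrow> ('l list \<Rightarrow> 'a list \<Rightarrow> 'a) \<Rightarrow>
     'l list \<times> 'a list \<Rightarrow> ('l list \<times> 'a list \<Rightarrow>\<^sub>0 'k)" where
  "coder_LA_A_word L A p i j f w = (case w of (xs, as) \<Rightarrow>
     let m = length xs; n = length as in
     if i \<le> m \<and> j \<le> n then
       (\<Sum>k\<in>{0..n - j}. \<Sum>\<sigma>\<in>unshuffles (m - i) i.
          psign (koszul (map (hdeg L) xs) m \<sigma>
                 + degsum L (pick xs \<sigma> (m - i) m) * degsum A (take k as)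
                 + p * (degsum L (pick xs \<sigma> 0 (m - i)) + degsum A (take k as)))
            (wd (pick xs \<sigma> 0 (m - i),
                 take k as @ [f (pick xs \<sigma> (m - i) m) (take j (drop k as))] @ drop (k + j) as)))
     else 0)"

text \<open>For \<open>f\<close> in $\mathrm{Hom}(A^{\otimes j},A)$ of degree \<open>p\<close>, $j\ge1$: the coderivation of the
  deconcatenation coalgebra $\bar TA$.\<close>

definition coder_A_word ::
    "('k::field, 'a) gspace \<Rightarrow> int \<Rightarrow> nat \<Rightarrow> ('a list \<Rightarrow> 'a) \<Rightarrow> 'a list \<Rightarrow> ('a list \<Rightarrow>\<^sub>0 'k)" where
  "coder_A_word A p j f as =
     (if j \<le> length as then
        (\<Sum>k\<in>{0..length as - j}.
           psign (p * degsum A (take k as))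
             (wd (take k as @ [f (take j (drop k as))] @ drop (k + j) as)))
      else 0)"

text \<open>$\partial_k=N_k\delta_{k-1}$ and $\partial=\sum_{k\ge1}\partial_k$. On a given vector only
  finitely many of the $\partial_k$ are nonzero, so that \<open>Sum_any\<close> is the sum over all \<open>k\<close>.\<close>

definition partial_k ::
    "('k::field, 'l) gspace \<Rightarrow> ('k, 'a) gspace \<Rightarrow>
     ('l \<Rightarrow> 'l \<Rightarrow> 'l) \<Rightarrow> ('l \<Rightarrow> 'a \<Rightarrow> 'a) \<Rightarrow> ('a \<Rightarrow> 'a \<Rightarrow> 'a) \<Rightarrow>
     (nat \<Rightarrow> 'l \<Rightarrow> 'l) \<Rightarrow> (nat \<Rightarrow> 'a \<Rightarrow> 'a) \<Rightarrow> nat \<Rightarrow>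
     ('l list \<times> 'a list \<Rightarrow>\<^sub>0 'k) \<Rightarrow> ('l list \<times> 'a list \<Rightarrow>\<^sub>0 'k)" where
  "partial_k L A bLL bLA bAA \<delta>L \<delta>A k = lin_ext (\<lambda>w.
     coder_LA_L_word L 1 k (N_L bLL (\<delta>L (k - 1))) w +
     (\<Sum>(i, j) | i + j = k \<and> 1 \<le> j.
        coder_LA_A_word L A 1 i j (N_A bLL bLA bAA (\<delta>L (k - 1)) (\<delta>A (k - 1))) w))"

definition partial ::
    "('k::field, 'l) gspace \<Rightarrow> ('k, 'a) gspace \<Rightarrow>
     ('l \<Rightarrow> 'l \<Rightarrow> 'l) \<Rightarrow> ('l \<Rightarrow> 'a \<Rightarrow> 'a) \<Rightarrow> ('a \<Rightarrow> 'a \<Rightarrow> 'a) \<Rightarrow>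
     (nat \<Rightarrow> 'l \<Rightarrow> 'l) \<Rightarrow> (nat \<Rightarrow> 'a \<Rightarrow> 'a) \<Rightarrow>
     ('l list \<times> 'a list \<Rightarrow>\<^sub>0 'k) \<Rightarrow> ('l list \<times> 'a list \<Rightarrow>\<^sub>0 'k)" where
  "partial L A bLL bLA bAA \<delta>L \<delta>A u =
     Sum_any (\<lambda>k. partial_k L A bLL bLA bAA \<delta>L \<delta>A (Suc k) u)"

section \<open>Sh Loday and sh associative algebras\<close>

text \<open>The structures are on $sL$ and $sA$; the unshifted spaces are the parameters. The maps
  $s^{-1}\circ l_i\circ(s\otimes\dots\otimes s)$ have degree $(2-i)+i-1=1$.\<close>

definition sh_loday_algebra ::
    "('k::field, 'l::ab_group_add) gspace \<Rightarrow> (nat \<Rightarrow> 'l susp list \<Rightarrow> 'l susp) \<Rightarrow> bool" where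
  "sh_loday_algebra L l \<longleftrightarrow>
     (\<forall>i\<ge>1. multilinear_deg (suspension L) i (2 - int i) (l i)) \<and>
     (let F = lin_ext (\<lambda>xs. Sum_any (\<lambda>i. coder_L_word L 1 (Suc i) (desusp1 L (l (Suc i))) xs))
      in endomorphism (T_words L) (T_rel L) F \<and> square_zero (T_words L) (T_rel L) F)"

definition sh_assoc_algebra ::
    "('k::field, 'a::ab_group_add) gspace \<Rightarrow> (nat \<Rightarrow> 'a susp list \<Rightarrow> 'a susp) \<Rightarrow> bool" where
  "sh_assoc_algebra A \<mu> \<longleftrightarrow>
     (\<forall>j\<ge>1. multilinear_deg (suspension A) j (2 - int j) (\<mu> j)) \<and>
     (let F = lin_ext (\<lambda>as. Sum_any (\<lambda>j. coder_A_word A 1 (Suc j) (desusp1 A (\<mu> (Suc j))) as))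
      in endomorphism (T_words A) (T_rel A) F \<and> square_zero (T_words A) (T_rel A) F)"

end

theory Submission
  imports Defs
begin

text \<open>Reading a word from the left, the coderivation of $N_{i+1}D$ either leaves the first letter
  $y$ in place or starts an iterated bracket with $Dy$, which then absorbs $i$ of the following
  letters. For $z\in L$ the operator ``let $z$ absorb $r+1$ letters'' is the coderivation of
  $N_{r+1}[z,-]$, and $[z,-]$ is a derivation by the Loday identity. With these inner derivations
  included, a single induction on the word proves
  $[N_{i+1}D,N_{j+1}D']=N_{i+j+1}[D,D']$, and a similar one proves compatibility with the
  coproduct. Hence $2\partial\partial=\sum_{i,j}[N_{i+1}\delta_i,N_{j+1}\delta_j]
  =2\sum_n N_{n+1}(\sum_{i+j=n}\delta_i\delta_j)=0$.

  All identities between vectors are proved dually: a vector of a free space lies in the span of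
  the relations iff every functional that vanishes on the relations vanishes on it, so it suffices
  to let the operators act on multilinear functions of words.\<close>

section \<open>Operators on functions of words\<close>

text \<open>The letters of L and A form one alphabet with one bracket \<open>br\<close>, so that the
  Loday identity, the action on A and its Leibniz rule become a single axiom. Vectors of different
  origin cannot be added in that alphabet; linear relations between letters are therefore carried by
  a predicate \<open>lc\<close> instead of an equation. A bracket begun by a letter of A is no inner
  derivation. There associativity takes over: such a product absorbs the letters next to it and
  passes none of them, and its commutator with a coderivation is computed directly. Neither DD' nor
  D'D is a derivation, so the commutator formula keeps the two composites apart; \<open>N\<close> is
  linear in an arbitrary map of letters, which is enough to sum them up afterwards. All operators of
  a deformation are odd, so graded commutators are anticommutators, and cancelling the factor 2 is
  where the characteristic enters. A separate obstacle are the degrees: a vector does not determine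
  its degree at 0, and with degrees modulo 2 it determines only the parity. Letters therefore carry
  an explicit degree, which the functionals forget.\<close>

definition sg :: "int \<Rightarrow> 'k::comm_ring_1" where
  "sg n = (if even n then 1 else - 1)"

lemma sg_add: "sg (a + b) = sg a * sg b"
  by (auto simp: sg_def)

lemma sg_sq: "sg a * sg a = 1"
  by (auto simp: sg_def)

lemma sg_sq_left: "sg a * (sg a * x) = x"
  by (auto simp: sg_def)

lemma sg_0 [simp]: "sg 0 = 1"
  by (simp add: sg_def)

lemmas sg_simps = sg_add sg_sq sg_sq_left distrib_left distrib_right

text \<open>Only degrees and origins of letters are tracked here, since signs and coproduct depend
  on nothing else. By \<open>isL_br\<close> a bracket falls into A as soon as one entry lies in A;
  from then on it can no longer move.\<close>

locale letters =
  fixes deg :: "'v \<Rightarrow> int"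
    and isL :: "'v \<Rightarrow> bool"
    and br :: "'v \<Rightarrow> 'v \<Rightarrow> 'v"
  assumes deg_br [simp]: "deg (br x y) = deg x + deg y"
    and isL_br [simp]: "isL (br x y) \<longleftrightarrow> isL x \<and> isL y"
begin

definition degs :: "'v list \<Rightarrow> int" where
  "degs w = sum_list (map deg w)"

lemma degs_simps [simp]:
  "degs [] = 0" "degs (y # w) = deg y + degs w" "degs (u @ w) = degs u + degs w"
  by (auto simp: degs_def)

text \<open>\<open>N i p D f w\<close> is the value of \<open>f\<close> on the image of the word \<open>w\<close> under the coderivation of
  $N_{i+1}D$, where \<open>p\<close> is the degree of \<open>D\<close>; in \<open>E i z f w\<close> the bracket has already been started
  with \<open>z\<close> and has \<open>i\<close> letters to absorb. It moves past the letters that it does not absorb until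
  it takes its values in \<open>A\<close>.\<close>

fun E :: "nat \<Rightarrow> 'v \<Rightarrow> ('v list \<Rightarrow> 'k::field) \<Rightarrow> 'v list \<Rightarrow> 'k" where
  "E 0 z f w = f (z # w)"
| "E (Suc r) z f [] = 0"
| "E (Suc r) z f (y # w) = E r (br z y) f w +
     (if isL z then sg (deg z * deg y) * E (Suc r) z (\<lambda>u. f (y # u)) w else 0)"

fun N :: "nat \<Rightarrow> int \<Rightarrow> ('v \<Rightarrow> 'v) \<Rightarrow> ('v list \<Rightarrow> 'k::field) \<Rightarrow> 'v list \<Rightarrow> 'k" where
  "N i p D f [] = 0"
| "N i p D f (y # w) = E i (D y) f w + sg (p * deg y) * N i p D (\<lambda>u. f (y # u)) w"

text \<open>Both recursions treat the first letter y alike: it is absorbed, giving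
  \<open>br z y\<close>, or passed with the sign of z against y. Statements about all
  \<open>N\<close> thereby apply to brackets already in progress.\<close>

lemma E_Suc_L: "isL z \<Longrightarrow> E (Suc r) z f w = N r (deg z) (br z) f w"
  by (induction w arbitrary: f) auto

lemma E_lin: "E r z (\<lambda>u. a * f u + b * g u) w = a * E r z f w + b * E r z g w"
proof (induction r z f w arbitrary: g rule: E.induct)
  case (3 r z f y w)
  show ?case
    by (simp add: "3.IH") (simp add: algebra_simps)
qed auto

lemma N_lin: "N i p D (\<lambda>u. a * f u + b * g u) w = a * N i p D f w + b * N i p D g w"
proof (induction w arbitrary: f g)
  case (Cons y w)
  show ?case
    by (simp add: Cons.IH E_lin) (simp add: algebra_simps)
qed auto

lemma N_add: "N i p D (\<lambda>u. f u + g u) w = N i p D f w + N i p D g w"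
  using N_lin[of i p D 1 f 1 g w] by simp

lemma E_scale: "E r z (\<lambda>u. a * f u) w = a * E r z f w"
  using E_lin[of r z a f 0 f w] by simp

lemma N_scale: "N i p D (\<lambda>u. a * f u) w = a * N i p D f w"
  using N_lin[of i p D a f 0 f w] by simp

lemma E_zero [simp]: "E r z (\<lambda>u. 0) w = 0"
  using E_scale[of r z 0 "\<lambda>u. 0" w] by simp

lemma N_zero [simp]: "N i p D (\<lambda>u. 0) w = 0"
  using N_scale[of i p D 0 "\<lambda>u. 0" w] by simp

lemma N_sum: "N i p D (\<lambda>u. \<Sum>s\<in>S. F s u) w = (\<Sum>s\<in>S. N i p D (F s) w)"
  by (induction S rule: infinite_finite_induct) (auto simp: N_add)

lemma E_eq_0: "length w < r \<Longrightarrow> E r z f w = 0"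
  by (induction r z f w rule: E.induct) auto

text \<open>A bracket of i + 1 entries needs i + 1 letters. This makes sums over all orders finite
  on each word.\<close>

lemma N_eq_0: "length w \<le> i \<Longrightarrow> N i p D f w = 0"
  by (induction w arbitrary: f) (auto simp: E_eq_0)

text \<open>The bracketed letter is always part of the result, so the value at the empty word is
  never read. This matters because \<open>Dl\<close> and the functionals of the reduced coproduct
  are exceptional there.\<close>

lemma E_cong_nonempty:
  "(\<And>u. u \<noteq> [] \<Longrightarrow> f u = g u) \<Longrightarrow> E r z f w = E r z g w"
proof (induction r z f w arbitrary: g rule: E.induct)
  case (3 r z f y w)
  show ?case
    using "3.IH"(1)[OF "3.prems"] "3.IH"(2)[of "\<lambda>u. g (y # u)"] "3.prems" by auto
qed auto

lemma N_cong_nonempty: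
  "(\<And>u. u \<noteq> [] \<Longrightarrow> f u = g u) \<Longrightarrow> N i p D f w = N i p D g w"
proof (induction w arbitrary: f g)
  case (Cons y w)
  show ?case
    using E_cong_nonempty[of f g i "D y" w] Cons.IH[of "\<lambda>u. f (y # u)" "\<lambda>u. g (y # u)"] Cons.prems
    by auto
qed auto

text \<open>The total degree of bracket and word is conserved, so a sign that depends on the total
  degree alone is a constant factor.\<close>

lemma E_sg: "E r z (\<lambda>u. sg (c * degs u) * f u) w = sg (c * (deg z + degs w)) * E r z f w"
proof (induction r z f w rule: E.induct)
  case (3 r z f y w)
  have "E (Suc r) z (\<lambda>u. sg (c * degs (y # u)) * f (y # u)) w
        = sg (c * deg y) * E (Suc r) z (\<lambda>u. sg (c * degs u) * f (y # u)) w"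
    by (subst E_scale[symmetric]) (simp add: sg_simps mult.assoc)
  then show ?case
    using 3 by (cases "isL z") (auto simp: sg_simps algebra_simps)
qed auto

lemma N_sg:
  assumes "\<And>y. y \<in> set w \<Longrightarrow> deg (D y) = deg y + p"
  shows "N i p D (\<lambda>u. sg (c * degs u) * f u) w = sg (c * (degs w + p)) * N i p D f w"
  using assms
proof (induction w arbitrary: f)
  case (Cons y w)
  have "N i p D (\<lambda>u. sg (c * degs (y # u)) * f (y # u)) w
        = sg (c * deg y) * N i p D (\<lambda>u. sg (c * degs u) * f (y # u)) w"
    by (subst N_scale[symmetric]) (simp add: sg_simps mult.assoc)
  moreover have "deg (D y) = deg y + p"
    using Cons.prems by simp
  ultimately show ?case
    using Cons by (simp add: E_sg) (simp add: sg_simps mult_ac)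
qed auto

text \<open>The value of \<open>f\<close> on the coproduct, including the summand $1\otimes w$ with empty left factor:
  only with it is the coproduct recursive in the word.\<close>

fun Dl :: "('v list \<Rightarrow> 'v list \<Rightarrow> 'k::field) \<Rightarrow> 'v list \<Rightarrow> 'k" where
  "Dl f [] = 0"
| "Dl f (y # w) =
     (if \<not> isL y then f [] (y # w) + Dl (\<lambda>u v. f (y # u) v) w
      else if w = [] then f [] [y]
      else Dl (\<lambda>u v. f (y # u) v + sg (deg y * degs u) * f u (y # v)) w)"

lemma Dl_lin: "Dl (\<lambda>u v. a * f u v + b * g u v) w = a * Dl f w + b * Dl g w"
proof (induction w arbitrary: f g)
  case (Cons y w)
  have "(\<lambda>u v. a * f (y # u) v + b * g (y # u) v + sg (deg y * degs u) * (a * f u (y # v) + b * g u (y # v)))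
     = (\<lambda>u v. a * (f (y # u) v + sg (deg y * degs u) * f u (y # v)) +
              b * (g (y # u) v + sg (deg y * degs u) * g u (y # v)))"
    by (simp add: algebra_simps)
  then show ?case
    by (simp add: Cons.IH) (simp add: algebra_simps)
qed auto

lemma Dl_add: "Dl (\<lambda>u v. f u v + g u v) w = Dl f w + Dl g w"
  using Dl_lin[of 1 f 1 g w] by simp

lemma Dl_scale: "Dl (\<lambda>u v. a * f u v) w = a * Dl f w"
  using Dl_lin[of a f 0 f w] by simp

lemma Dl_sum: "Dl (\<lambda>u v. \<Sum>s\<in>S. F s u v) w = (\<Sum>s\<in>S. Dl (F s) w)"
  by (induction S rule: infinite_finite_induct) (use Dl_scale[of 0 "\<lambda>u v. 0"] in \<open>auto simp: Dl_add\<close>)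

text \<open>The part of being a derivation on which compatibility with the coproduct rests. The set
  \<open>S\<close> confines it to the letters of the word at hand.\<close>

definition homog :: "int \<Rightarrow> ('v \<Rightarrow> 'v) \<Rightarrow> 'v set \<Rightarrow> bool" where
  "homog p D S \<longleftrightarrow> (\<forall>y\<in>S. deg (D y) = deg y + p \<and> (isL (D y) \<longleftrightarrow> isL y))"

definition shape :: "'v list \<Rightarrow> bool" where
  "shape w \<longleftrightarrow> sorted_wrt (\<lambda>x y. isL y \<longrightarrow> isL x) w"

lemma shape_simps [simp]:
  "shape []" "shape (y # w) \<longleftrightarrow> shape w \<and> (isL y \<or> (\<forall>x\<in>set w. \<not> isL x))"
  by (auto simp: shape_def)

text \<open>Only splittings of \<open>w\<close> are compared, so facts that are known just for the
  letters of \<open>w\<close>, such as the degree of \<open>D\<close>, can be used in both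
  factors.\<close>

lemma Dl_cong:
  assumes "shape w"
    and "\<And>u v. set u \<union> set v = set w \<Longrightarrow> length u + length v = length w \<Longrightarrow> shape u \<Longrightarrow> shape v \<Longrightarrow> f u v = g u v"
  shows "Dl f w = Dl g w"
  using assms
proof (induction w arbitrary: f g)
  case (Cons y w)
  show ?case
  proof (cases "isL y")
    case True
    have "Dl (\<lambda>u v. f (y # u) v + sg (deg y * degs u) * f u (y # v)) w =
          Dl (\<lambda>u v. g (y # u) v + sg (deg y * degs u) * g u (y # v)) w"
    proof (rule Cons.IH)
      fix u v assume h: "set u \<union> set v = set w" "length u + length v = length w" "shape u" "shape v"
      have "f (y # u) v = g (y # u) v" "f u (y # v) = g u (y # v)"
        using h True by (auto intro!: Cons.prems)
      then show "f (y # u) v + sg (deg y * degs u) * f u (y # v)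
          = g (y # u) v + sg (deg y * degs u) * g u (y # v)" by simp
    qed (use Cons.prems in auto)
    then show ?thesis using True Cons.prems(2)[of "[]" "[y]"] by auto
  next
    case False
    have "Dl (\<lambda>u v. f (y # u) v) w = Dl (\<lambda>u v. g (y # u) v) w"
    proof (rule Cons.IH)
      fix u v assume h: "set u \<union> set v = set w" "length u + length v = length w" "shape u" "shape v"
      show "f (y # u) v = g (y # u) v"
        using h False Cons.prems(1) by (intro Cons.prems) auto
    qed (use Cons.prems in auto)
    then show ?thesis using False Cons.prems(1) Cons.prems(2)[of "[]" "y # w"] by auto
  qed
qed auto

text \<open>A product started in A absorbs the letters next to it and stays in front. Cutting the
  word before it leaves an empty left factor, which is the first summand; every other cut leaves it
  at the head of the left factor.\<close>

lemma Dl_E_A: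
  assumes "\<not> isL b" "\<forall>y\<in>set w. \<not> isL y"
  shows "E s b (Dl f) w = E s b (f []) w + Dl (\<lambda>u v. E s b (\<lambda>u'. f u' v) u) w"
  using assms
proof (induction w arbitrary: s b f)
  case Nil
  then show ?case by (cases s) auto
next
  case (Cons c w)
  then show ?case by (cases s) auto
qed

text \<open>Both \<open>E (Suc r) z\<close> for \<open>z\<close> in \<open>L\<close> and \<open>N i p D\<close> are coderivations; the former is the
  instance \<open>D = br z\<close> of the latter, which drives the induction.\<close>

lemma Dl_N:
  fixes f :: "'v list \<Rightarrow> 'v list \<Rightarrow> 'k::field"
  assumes "homog p D (set w)" "shape w"
  shows "N i p D (Dl f) w =
    Dl (\<lambda>u v. N i p D (\<lambda>u'. f u' v) u + sg (p * degs u) * N i p D (f u) v) w"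
  using assms
proof (induction w arbitrary: i p D f)
  case (Cons y w)
  note IH = Cons.IH
  have w: "homog p D (set w)" "shape w" and y: "deg (D y) = deg y + p" "isL (D y) \<longleftrightarrow> isL y"
    using Cons.prems by (auto simp: homog_def)
  have IHD: "N i p D (Dl f) w =
    Dl (\<lambda>u v. N i p D (\<lambda>u'. f u' v) u + sg (p * degs u) * N i p D (f u) v) w" for f :: "'v list \<Rightarrow> 'v list \<Rightarrow> 'k"
    using IH w by blast
  show ?case
  proof (cases "isL y")
    case True
    show ?thesis
    proof (cases "w = []")
      case True
      then show ?thesis using \<open>isL y\<close> y by (cases i) auto
    next
      case False
      have homz: "homog (deg z) (br z) (set w)" if "isL z" for z
        using that by (simp add: homog_def)
      \<comment> \<open>A bracket in progress is the coderivation of \<open>br z\<close>, so the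
        claim for the shorter word \<open>w\<close> applies to it. For i = 0 the formula is the
        recursion of \<open>Dl\<close>.\<close>
      have BE: "E i z (Dl f) w = Dl (\<lambda>u v. E i z (\<lambda>u'. f u' v) u + sg (deg z * degs u) * E i z (f u) v) w"
        if "isL z" for z :: 'v
      proof (cases i)
        case 0
        then show ?thesis using that False by simp
      next
        case (Suc r)
        show ?thesis unfolding Suc E_Suc_L[OF that]
          by (rule IH[OF homz[OF that] w(2)])
      qed
      \<comment> \<open>\<open>Dl\<close> at \<open>y # u\<close> has a special value for empty
        \<open>u\<close>; \<open>N\<close> never produces that \<open>u\<close>.\<close>
      have nonempty: "N i p D (\<lambda>u. Dl f (y # u)) w =
         N i p D (\<lambda>u. Dl (\<lambda>u v. f (y # u) v + sg (deg y * degs u) * f u (y # v)) u) w"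
        using \<open>isL y\<close> by (intro N_cong_nonempty) simp
      \<comment> \<open>If y goes to the right factor, its sign involves the degree of the left
        factor, which \<open>D\<close> has raised by p.\<close>
      have shift: "N i p D (\<lambda>u'. sg (deg y * degs u') * h u') u
          = sg (deg y * (degs u + p)) * N i p D h u" if "set u \<subseteq> set w" for h :: "'v list \<Rightarrow> 'k" and u
        using w(1) that by (intro N_sg) (auto simp: homog_def)
      have "N i p D (Dl f) (y # w) = Dl (\<lambda>u v. E i (D y) (\<lambda>u'. f u' v) u
          + sg (deg (D y) * degs u) * E i (D y) (f u) v) w
         + sg (p * deg y) * Dl (\<lambda>u v.
            N i p D (\<lambda>u'. f (y # u') v + sg (deg y * degs u') * f u' (y # v)) u +
            sg (p * degs u) * N i p D (\<lambda>v'. f (y # u) v' + sg (deg y * degs u) * f u (y # v')) v) w"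
        unfolding N.simps nonempty using BE[of "D y"] True y by (simp add: IHD)
      also have "\<dots> = Dl (\<lambda>u v. (E i (D y) (\<lambda>u'. f u' v) u
          + sg (deg (D y) * degs u) * E i (D y) (f u) v) + sg (p * deg y) * (
            N i p D (\<lambda>u'. f (y # u') v + sg (deg y * degs u') * f u' (y # v)) u +
            sg (p * degs u) * N i p D (\<lambda>v'. f (y # u) v' + sg (deg y * degs u) * f u (y # v')) v)) w"
        by (subst (2) Dl_add) (simp add: Dl_scale)
      also have "\<dots> = Dl (\<lambda>u v. N i p D (\<lambda>u'. f u' v) (y # u) + sg (p * degs (y # u)) * N i p D (f (y # u)) v
         + sg (deg y * degs u) * (N i p D (\<lambda>u'. f u' (y # v)) u + sg (p * degs u) * N i p D (f u) (y # v))) w"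
      proof (rule Dl_cong)
        fix u v assume "set u \<union> set v = set w"
        then have "set u \<subseteq> set w" by auto
        show "(E i (D y) (\<lambda>u'. f u' v) u
          + sg (deg (D y) * degs u) * E i (D y) (f u) v) + sg (p * deg y) * (
            N i p D (\<lambda>u'. f (y # u') v + sg (deg y * degs u') * f u' (y # v)) u +
            sg (p * degs u) * N i p D (\<lambda>v'. f (y # u) v' + sg (deg y * degs u) * f u (y # v')) v)
          = N i p D (\<lambda>u'. f u' v) (y # u) + sg (p * degs (y # u)) * N i p D (f (y # u)) v
         + sg (deg y * degs u) * (N i p D (\<lambda>u'. f u' (y # v)) u + sg (p * degs u) * N i p D (f u) (y # v))"
          by (simp add: y N_add N_scale shift[OF \<open>set u \<subseteq> set w\<close>])
            (simp add: sg_simps mult_ac add_ac)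
      qed fact
      also have "\<dots> = Dl (\<lambda>u v. N i p D (\<lambda>u'. f u' v) u + sg (p * degs u) * N i p D (f u) v) (y # w)"
        using True False by simp
      finally show ?thesis .
    qed
  next
    case False
    \<comment> \<open>Behind a letter of A the coproduct is mere deconcatenation.\<close>
    then have wA: "\<forall>x\<in>set w. \<not> isL x" using Cons.prems by auto
    have "N i p D (Dl f) (y # w) = E i (D y) (f []) w + Dl (\<lambda>u v. E i (D y) (\<lambda>u'. f u' v) u) w
       + sg (p * deg y) * (N i p D (\<lambda>u. f [] (y # u)) w +
         Dl (\<lambda>u v. N i p D (\<lambda>u'. f (y # u') v) u + sg (p * degs u) * N i p D (f (y # u)) v) w)"
      using False y wA by (simp add: Dl_E_A N_add IHD)
    also have "\<dots> = N i p D (f []) (y # w) +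
       Dl (\<lambda>u v. E i (D y) (\<lambda>u'. f u' v) u + sg (p * deg y) * (N i p D (\<lambda>u'. f (y # u') v) u + sg (p * degs u) * N i p D (f (y # u)) v)) w"
      by (simp add: Dl_add Dl_scale algebra_simps)
    also have "\<dots> = Dl (\<lambda>u v. N i p D (\<lambda>u'. f u' v) u + sg (p * degs u) * N i p D (f u) v) (y # w)"
      using False by (simp add: sg_simps mult.assoc add_ac)
    finally show ?thesis .
  qed
qed auto

end

section \<open>The commutator of two coderivations\<close>

context letters
begin

text \<open>\<open>I = {k - 1}\<close> gives the k-th summand of the codifferential and
  \<open>I = UNIV\<close> the whole of it. The bound by the length keeps the sum finite and loses
  nothing, by \<open>N_eq_0\<close>.\<close>

definition total :: "nat set \<Rightarrow> (nat \<Rightarrow> 'v \<Rightarrow> 'v) \<Rightarrow> ('v list \<Rightarrow> 'k::field) \<Rightarrow> 'v list \<Rightarrow> 'k" where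
  "total I D f w = (\<Sum>r\<in>I \<inter> {..<length w}. N r 1 (D r) f w)"

lemma total_eq: "length w \<le> n \<Longrightarrow> total I D f w = (\<Sum>r\<in>I \<inter> {..<n}. N r 1 (D r) f w)"
  unfolding total_def
  by (rule sum.mono_neutral_left) (auto intro!: N_eq_0)

end

text \<open>\<open>lc a x b y z\<close> expresses $z=ax+by$ for letters of one degree, all from \<open>L\<close> or all from \<open>A\<close>.\<close>

locale loday_letters = letters deg isL br
  for deg :: "'v \<Rightarrow> int" and isL br +
  fixes ok :: "'v set" and lc :: "'k::field \<Rightarrow> 'v \<Rightarrow> 'k \<Rightarrow> 'v \<Rightarrow> 'v \<Rightarrow> bool"
  assumes lcD: "lc a x b y z \<Longrightarrow> x \<in> ok \<and> y \<in> ok \<and> z \<in> ok \<and> deg x = deg z \<and> deg y = deg z \<and>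
        (isL x \<longleftrightarrow> isL z) \<and> (isL y \<longleftrightarrow> isL z)"
    and br_ok: "x \<in> ok \<Longrightarrow> y \<in> ok \<Longrightarrow> isL x \<or> \<not> isL y \<Longrightarrow> br x y \<in> ok"
    and br_left: "lc a x b y z \<Longrightarrow> c \<in> ok \<Longrightarrow> isL z \<or> \<not> isL c \<Longrightarrow> lc a (br x c) b (br y c) (br z c)"
    and br_right: "lc a x b y z \<Longrightarrow> c \<in> ok \<Longrightarrow> isL c \<or> \<not> isL z \<Longrightarrow> lc a (br c x) b (br c y) (br c z)"
    and loday: "z \<in> ok \<Longrightarrow> x \<in> ok \<Longrightarrow> y \<in> ok \<Longrightarrow> isL z \<Longrightarrow> isL x \<or> \<not> isL y \<Longrightarrow>
        lc 1 (br z (br x y)) (- sg (deg z * deg x)) (br x (br z y)) (br (br z x) y)"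
    and assoc: "\<not> isL x \<Longrightarrow> \<not> isL y \<Longrightarrow> \<not> isL z \<Longrightarrow> br x (br y z) = br (br x y) z"
begin

text \<open>Words with letters out of order are included: the functions that arise from functionals
  factor through \<open>unlabel\<close>, which sorts the letters by origin.\<close>

definition mlin :: "('v list \<Rightarrow> 'k) \<Rightarrow> bool" where
  "mlin f \<longleftrightarrow> (\<forall>us vs a x b y z. set us \<subseteq> ok \<and> set vs \<subseteq> ok \<and> lc a x b y z \<longrightarrow>
     f (us @ z # vs) = a * f (us @ x # vs) + b * f (us @ y # vs))"

text \<open>The Leibniz rule is solved for the bracket of \<open>D x\<close> with y, the term met
  when a bracket started by \<open>D x\<close> absorbs y. The condition on \<open>isL\<close>
  excludes a letter of A bracketed with a letter of L on its right.\<close>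

definition der :: "int \<Rightarrow> ('v \<Rightarrow> 'v) \<Rightarrow> bool" where
  "der p D \<longleftrightarrow>
     (\<forall>y\<in>ok. D y \<in> ok \<and> deg (D y) = deg y + p \<and> (isL (D y) \<longleftrightarrow> isL y)) \<and>
     (\<forall>a x b y z. lc a x b y z \<longrightarrow> lc a (D x) b (D y) (D z)) \<and>
     (\<forall>x\<in>ok. \<forall>y\<in>ok. isL x \<or> \<not> isL y \<longrightarrow>
        lc 1 (D (br x y)) (- sg (p * deg x)) (br x (D y)) (br (D x) y))"

lemma derD:
  assumes "der p D"
  shows "y \<in> ok \<Longrightarrow> D y \<in> ok" "y \<in> ok \<Longrightarrow> deg (D y) = deg y + p"
    "y \<in> ok \<Longrightarrow> isL (D y) \<longleftrightarrow> isL y" "lc a x b y z \<Longrightarrow> lc a (D x) b (D y) (D z)"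
    "x \<in> ok \<Longrightarrow> y \<in> ok \<Longrightarrow> isL x \<or> \<not> isL y \<Longrightarrow>
       lc 1 (D (br x y)) (- sg (p * deg x)) (br x (D y)) (br (D x) y)"
  using assms by (auto simp: der_def)

lemma der_homog: "der p D \<Longrightarrow> S \<subseteq> ok \<Longrightarrow> homog p D S"
  by (auto simp: der_def homog_def)

text \<open>The one axiom \<open>loday\<close> covers three identities, according to the origin of x
  and y: the Loday identity of L, the compatibility of the action on A with brackets in L, and the
  action of L on A by derivations.\<close>

lemma der_br: "z \<in> ok \<Longrightarrow> isL z \<Longrightarrow> der (deg z) (br z)"
  by (auto simp: der_def br_ok intro: br_right loday)

lemma mlinD:
  "mlin f \<Longrightarrow> lc a x b y z \<Longrightarrow> set us \<subseteq> ok \<Longrightarrow> set vs \<subseteq> ok \<Longrightarrow>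
     f (us @ z # vs) = a * f (us @ x # vs) + b * f (us @ y # vs)"
  by (auto simp: mlin_def)

lemma mlin_Cons: "mlin f \<Longrightarrow> y \<in> ok \<Longrightarrow> mlin (\<lambda>u. f (y # u))"
  by (subst mlin_def) (use mlinD[of f _ _ _ _ _ "y # us" for us] in auto)

lemma E_lin_letter:
  assumes "mlin f" "set w \<subseteq> ok" "shape w" "lc a x b y z" "isL z \<or> (\<forall>v\<in>set w. \<not> isL v)"
  shows "E r z f w = a * E r x f w + b * E r y f w"
  using assms
proof (induction w arbitrary: r f x y z)
  case Nil
  then show ?case
    by (cases r) (auto simp: mlin_def dest: spec[of _ "[]"])
next
  case (Cons c w)
  show ?case
  proof (cases r)
    case 0
    then show ?thesis using Cons.prems(1-4) mlinD[of f a x b y z "[]" "c # w"] by simp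
  next
    case (Suc s)
    have c: "c \<in> ok" "set w \<subseteq> ok" using Cons.prems by auto
    have "E s (br z c) f w = a * E s (br x c) f w + b * E s (br y c) f w"
      using Cons.prems(1-3,5) c br_left[OF Cons.prems(4) c(1)] by (intro Cons.IH) auto
    moreover have "E (Suc s) z (\<lambda>u. f (c # u)) w = a * E (Suc s) x (\<lambda>u. f (c # u)) w
        + b * E (Suc s) y (\<lambda>u. f (c # u)) w"
      using Cons.prems c by (intro Cons.IH mlin_Cons) auto
    ultimately show ?thesis
      using Suc lcD[OF Cons.prems(4)] by (simp add: algebra_simps)
  qed
qed

text \<open>The product started at b becomes an entry of the product started at a. Associativity
  turns this nested product into a single left-normed one that starts with
  \<open>br a b\<close>.\<close>

lemma E_A_A:
  assumes "\<not> isL a" "\<not> isL b" "\<forall>v\<in>set w. \<not> isL v"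
  shows "E s b (E (Suc r) a f) w = E (r + s) (br a b) f w"
  using assms
proof (induction w arbitrary: s b)
  case Nil
  then show ?case by (cases s) auto
next
  case (Cons c w)
  then show ?case by (cases s) (auto simp: assoc)
qed

lemma shapeA: "\<forall>v\<in>set w. \<not> isL v \<Longrightarrow> shape w"
  by (induction w) auto

text \<open>For z in A there is no inner derivation to appeal to. When c is absorbed, the Leibniz
  rule rewrites the bracket of \<open>D z\<close> with c by \<open>D (br z c)\<close> and
  \<open>br z (D c)\<close>; the latter is the case in which \<open>D\<close> starts at c and the
  outcome is absorbed by z, evaluated by \<open>E_A_A\<close>.\<close>

lemma E_N_commute_A:
  assumes "der p D" "mlin f" "z \<in> ok" "set w \<subseteq> ok" "\<not> isL z" "\<forall>v\<in>set w. \<not> isL v"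
  shows "E r z (N i p D f) w - sg (p * deg z) * N i p D (E r z f) w = E (r + i) (D z) f w"
  using assms
proof (induction w arbitrary: r z)
  case Nil
  then show ?case by (cases r; cases i) auto
next
  case (Cons c w)
  note D = derD[OF \<open>der p D\<close>]
  show ?case
  proof (cases r)
    case 0
    have "E 0 z f = (\<lambda>u. f (z # u))" by auto
    then show ?thesis using 0 by simp
  next
    case (Suc s)
    have c: "c \<in> ok" "set w \<subseteq> ok" "\<not> isL c" "\<forall>v\<in>set w. \<not> isL v" using Cons.prems by auto
    have IH: "E s (br z c) (N i p D f) w - sg (p * deg (br z c)) * N i p D (E s (br z c) f) w
        = E (s + i) (D (br z c)) f w"
      using Cons.prems c by (intro Cons.IH br_ok) auto
    have "E (s + i) (br (D z) c) f w = E (s + i) (D (br z c)) f w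
        - sg (p * deg z) * E (s + i) (br z (D c)) f w"
      using E_lin_letter[OF \<open>mlin f\<close> c(2) shapeA[OF c(4)] D(5)[OF \<open>z \<in> ok\<close> c(1)], of "s + i"] Cons.prems c by simp
    moreover have "E i (D c) (E (Suc s) z f) w = E (s + i) (br z (D c)) f w"
      using Cons.prems c D by (intro E_A_A) auto
    moreover have "\<not> isL (D z)" using D Cons.prems by auto
    ultimately show ?thesis
      using IH Suc Cons.prems(5) by (simp add: sg_simps algebra_simps)
  qed
qed

text \<open>Stated for arbitrary maps of letters, because it is applied to composites of derivations
  and to partial sums of such composites, which need not be derivations.\<close>

lemma N_lin_map:
  assumes "mlin f" "set w \<subseteq> ok" "shape w"
    and "\<And>y. y \<in> ok \<Longrightarrow> lc a (D1 y) b (D2 y) (D3 y)" "\<And>y. y \<in> ok \<Longrightarrow> isL (D3 y) \<longleftrightarrow> isL y"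
  shows "N i p D3 f w = a * N i p D1 f w + b * N i p D2 f w"
  using assms(1-3)
proof (induction w arbitrary: f)
  case (Cons y w)
  then have "E i (D3 y) f w = a * E i (D1 y) f w + b * E i (D2 y) f w"
    using assms(4,5) by (intro E_lin_letter) auto
  then show ?case
    using Cons by (simp add: mlin_Cons algebra_simps)
qed auto

text \<open>Operators on functions compose in reverse: \<open>N j q D' (N i p D f)\<close> applies
  the coderivation of \<open>D'\<close> to the word first. Both composites stay on the right because
  only their graded difference is a derivation.\<close>

lemma N_commutator:
  assumes "der p D" "der q D'" "mlin f" "set w \<subseteq> ok" "shape w"
  shows "N j q D' (N i p D f) w - sg (p * q) * N i p D (N j q D' f) w
    = N (j + i) (p + q) (D \<circ> D') f w - sg (p * q) * N (j + i) (p + q) (D' \<circ> D) f w"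
  using assms
proof (induction w arbitrary: i j p q D D' f)
  case Nil
  then show ?case by simp
next
  case (Cons y w)
  have w: "set w \<subseteq> ok" "shape w" and y: "y \<in> ok" using Cons.prems by auto
  have yw: "isL y \<or> (\<forall>v\<in>set w. \<not> isL v)" using Cons.prems by simp
  \<comment> \<open>A coderivation commutes with a bracket in progress up to the bracket restarted
    by \<open>D z\<close>. For z in L this is the induction hypothesis on the shorter word
    \<open>w\<close>, for \<open>D\<close> and the inner derivation of z.\<close>
  have B: "E r z (N i p D f) w - sg (p * deg z) * N i p D (E r z f) w = E (r + i) (D z) f w"
    if "der p D" "z \<in> ok" "isL z \<or> (\<forall>v\<in>set w. \<not> isL v)" for i p D r z
  proof (cases "isL z")
    case False
    then show ?thesis using that w Cons.prems by (intro E_N_commute_A) auto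
  next
    case True
    note D = derD[OF \<open>der p D\<close>]
    show ?thesis
    proof (cases r)
      case 0
      have "E 0 z f = (\<lambda>u. f (z # u))" by auto
      then show ?thesis using 0 by simp
    next
      case (Suc s)
      have E_Suc_fun: "E (Suc s) z g = N s (deg z) (br z) g" for g
        using True by (auto simp: E_Suc_L)
      have "N s (deg z) (br z) (N i p D f) w - sg (p * deg z) * N i p D (N s (deg z) (br z) f) w
          = N (s + i) (p + deg z) (D \<circ> br z) f w - sg (p * deg z) * N (s + i) (p + deg z) (br z \<circ> D) f w"
        using that True w Cons.prems by (intro Cons.IH der_br) auto
      \<comment> \<open>The Leibniz rule says that the graded commutator of \<open>D\<close> with
        bracketing by z is bracketing by \<open>D z\<close>.\<close>
      also have "\<dots> = N (s + i) (p + deg z) (br (D z)) f w"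
        using N_lin_map[OF Cons.prems(3) w, of 1 "D \<circ> br z" "- sg (p * deg z)" "br z \<circ> D" "br (D z)"]
          D that True by simp
      also have "\<dots> = E (Suc s + i) (D z) f w"
        using True that by (simp add: E_Suc_L D add.commute)
      finally show ?thesis
        by (simp add: Suc E_Suc_fun)
    qed
  qed
  note D = derD[OF Cons.prems(1)] and D' = derD[OF Cons.prems(2)]
  \<comment> \<open>Of the two operators, one starts at y and leaves a bracket in progress on
    \<open>w\<close>, the other still has to act on the result; this is the situation of
    \<open>B\<close>.\<close>
  have B1: "E j (D' y) (N i p D f) w - sg (p * (deg y + q)) * N i p D (E j (D' y) f) w
      = E (j + i) (D (D' y)) f w"
    using B[OF Cons.prems(1), of "D' y"] D' y yw by auto
  have B2: "E i (D y) (N j q D' f) w - sg (q * (deg y + p)) * N j q D' (E i (D y) f) w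
      = E (j + i) (D' (D y)) f w"
    using B[OF Cons.prems(2), of "D y" i j] D y yw by (auto simp: add.commute)
  have IH: "N j q D' (N i p D (\<lambda>u. f (y # u))) w
      - sg (p * q) * N i p D (N j q D' (\<lambda>u. f (y # u))) w
      = N (j + i) (p + q) (D \<circ> D') (\<lambda>u. f (y # u)) w
        - sg (p * q) * N (j + i) (p + q) (D' \<circ> D) (\<lambda>u. f (y # u)) w"
    using Cons.prems w y by (intro Cons.IH mlin_Cons) auto
  have "N j q D' (N i p D f) (y # w) - sg (p * q) * N i p D (N j q D' f) (y # w)
     = E j (D' y) (N i p D f) w - sg (p * (deg y + q)) * N i p D (E j (D' y) f) w
     - sg (p * q) * (E i (D y) (N j q D' f) w - sg (q * (deg y + p)) * N j q D' (E i (D y) f) w)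
     + sg ((p + q) * deg y) * (N j q D' (N i p D (\<lambda>u. f (y # u))) w
      - sg (p * q) * N i p D (N j q D' (\<lambda>u. f (y # u))) w)"
    by (simp add: N_add N_scale) (simp add: sg_simps algebra_simps)
  then show ?case
    unfolding B1 B2 IH by (simp add: o_def algebra_simps)
qed

text \<open>The words at which an operator evaluates its argument; \<open>allA\<close> says that it has no
  letters from \<open>L\<close>.\<close>

definition reaches :: "nat \<Rightarrow> int \<Rightarrow> bool \<Rightarrow> 'v list \<Rightarrow> bool" where
  "reaches n d allA u \<longleftrightarrow> u \<noteq> [] \<and> set u \<subseteq> ok \<and> shape u \<and> length u \<le> n \<and> degs u = d \<and>
     (allA \<longrightarrow> (\<forall>v\<in>set u. \<not> isL v))"

section \<open>Locality of the operators and their multilinearity in the word\<close>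

lemma reaches_mono:
  "reaches n d q u \<Longrightarrow> n \<le> m \<Longrightarrow> d = e \<Longrightarrow> (q' \<longrightarrow> q) \<Longrightarrow> reaches m e q' u"
  by (auto simp: reaches_def)

lemma reaches_Cons:
  "reaches n d q u \<Longrightarrow> y \<in> ok \<Longrightarrow> isL y \<or> q \<Longrightarrow> Suc n \<le> m \<Longrightarrow> deg y + d = e \<Longrightarrow>
     (q' \<longrightarrow> q \<and> \<not> isL y) \<Longrightarrow> reaches m e q' (y # u)"
  by (auto simp: reaches_def)

text \<open>If z in L absorbs at least one letter of a word over A, the result lies in A. This
  explains the condition \<open>r > 0\<close> and is why the words reached still have their letters
  of L in front.\<close>

lemma E_cong:
  assumes "z \<in> ok" "set w \<subseteq> ok" "shape w" "isL z \<or> (\<forall>v\<in>set w. \<not> isL v)"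
    and "\<And>u. reaches (Suc (length w)) (deg z + degs w)
          ((\<forall>v\<in>set w. \<not> isL v) \<and> (r > 0 \<or> \<not> isL z)) u \<Longrightarrow> f u = g u"
  shows "E r z f w = E r z g w"
  using assms
proof (induction w arbitrary: r z f g)
  case Nil
  show ?case
  proof (cases r)
    case 0
    have "f [z] = g [z]"
      by (rule Nil.prems(5)) (use Nil.prems(1,4) 0 in \<open>auto simp: reaches_def\<close>)
    then show ?thesis using 0 by simp
  qed simp
next
  case (Cons c w)
  have w: "c \<in> ok" "set w \<subseteq> ok" "shape w" "isL c \<or> (\<forall>v\<in>set w. \<not> isL v)"
    using Cons.prems(2,3) by auto
  show ?case
  proof (cases r)
    case 0
    have "f (z # c # w) = g (z # c # w)"
      by (rule Cons.prems(5)) (use Cons.prems(1-4) 0 in \<open>auto simp: reaches_def\<close>)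
    then show ?thesis using 0 by simp
  next
    case (Suc s)
    have "E s (br z c) f w = E s (br z c) g w"
    proof (rule Cons.IH)
      fix u
      assume "reaches (Suc (length w)) (deg (br z c) + degs w)
        ((\<forall>v\<in>set w. \<not> isL v) \<and> (s > 0 \<or> \<not> isL (br z c))) u"
      then show "f u = g u"
        by (intro Cons.prems(5), elim reaches_mono) auto
    qed (use Cons.prems(1-4) w in \<open>auto intro: br_ok\<close>)
    moreover have "E (Suc s) z (\<lambda>u. f (c # u)) w = E (Suc s) z (\<lambda>u. g (c # u)) w" if "isL z"
    proof (rule Cons.IH)
      fix u
      assume "reaches (Suc (length w)) (deg z + degs w)
        ((\<forall>v\<in>set w. \<not> isL v) \<and> (Suc s > 0 \<or> \<not> isL z)) u"
      then show "f (c # u) = g (c # u)"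
        by (intro Cons.prems(5), elim reaches_Cons) (use w that in auto)
    qed (use Cons.prems(1-4) w that in auto)
    ultimately show ?thesis using Suc by auto
  qed
qed

lemma N_cong:
  assumes "\<forall>y\<in>ok. D y \<in> ok \<and> deg (D y) = deg y + p \<and> (isL (D y) \<longleftrightarrow> isL y)" "set w \<subseteq> ok" "shape w"
    and "\<And>u. reaches (length w) (degs w + p) (\<forall>v\<in>set w. \<not> isL v) u \<Longrightarrow> f u = g u"
  shows "N i p D f w = N i p D g w"
  using assms(2-)
proof (induction w arbitrary: f g)
  case Nil
  show ?case by simp
next
  case (Cons y w)
  have w: "y \<in> ok" "set w \<subseteq> ok" "shape w" "isL y \<or> (\<forall>v\<in>set w. \<not> isL v)"
    using Cons.prems(1,2) by auto
  have "E i (D y) f w = E i (D y) g w"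
  proof (rule E_cong)
    fix u
    assume "reaches (Suc (length w)) (deg (D y) + degs w)
        ((\<forall>v\<in>set w. \<not> isL v) \<and> (i > 0 \<or> \<not> isL (D y))) u"
    then show "f u = g u"
      by (intro Cons.prems(3), elim reaches_mono) (use assms(1) w in auto)
  qed (use assms(1) w in auto)
  moreover have "N i p D (\<lambda>u. f (y # u)) w = N i p D (\<lambda>u. g (y # u)) w"
  proof (rule Cons.IH)
    fix u
    assume "reaches (length w) (degs w + p) (\<forall>v\<in>set w. \<not> isL v) u"
    then show "f (y # u) = g (y # u)"
      by (intro Cons.prems(3), elim reaches_Cons) (use w in auto)
  qed (use w in auto)
  ultimately show ?case by simp
qed

lemma E_lin_word:
  assumes "mlin f" "set us \<subseteq> ok" "set vs \<subseteq> ok" "shape (us @ z # vs)" "lc a x b y z" "c \<in> ok"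
    "isL c \<or> (\<forall>v\<in>set (us @ z # vs). \<not> isL v)"
  shows "E r c f (us @ z # vs) = a * E r c f (us @ x # vs) + b * E r c f (us @ y # vs)"
  using assms
proof (induction us arbitrary: r c f)
  case Nil
  note z = lcD[OF Nil.prems(5)]
  show ?case
  proof (cases r)
    case 0
    then show ?thesis using Nil.prems mlinD[of f a x b y z "[c]" vs] by simp
  next
    case (Suc s)
    have "E s (br c z) f vs = a * E s (br c x) f vs + b * E s (br c y) f vs"
      using Nil.prems by (intro E_lin_letter br_right) auto
    moreover have "E (Suc s) c (\<lambda>u. f (z # u)) vs = E (Suc s) c (\<lambda>u. a * f (x # u) + b * f (y # u)) vs"
      if "isL c"
    proof (rule E_cong)
      fix u assume "reaches (Suc (length vs)) (deg c + degs vs)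
        ((\<forall>v\<in>set vs. \<not> isL v) \<and> (Suc s > 0 \<or> \<not> isL c)) u"
      then have "set u \<subseteq> ok" by (simp add: reaches_def)
      then show "f (z # u) = a * f (x # u) + b * f (y # u)"
        using Nil.prems mlinD[of f a x b y z "[]" u] by simp
    qed (use Nil.prems that in auto)
    ultimately show ?thesis using Suc z
      by (simp add: E_lin) (simp add: algebra_simps)
  qed
next
  case (Cons v us)
  show ?case
  proof (cases r)
    case 0
    then show ?thesis using Cons.prems mlinD[of f a x b y z "c # v # us" vs] by simp
  next
    case (Suc s)
    have "E s (br c v) f (us @ z # vs) = a * E s (br c v) f (us @ x # vs) + b * E s (br c v) f (us @ y # vs)"
      using Cons.prems by (intro Cons.IH br_ok) auto
    moreover have "E (Suc s) c (\<lambda>u. f (v # u)) (us @ z # vs)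
        = a * E (Suc s) c (\<lambda>u. f (v # u)) (us @ x # vs) + b * E (Suc s) c (\<lambda>u. f (v # u)) (us @ y # vs)"
      using Cons.prems by (intro Cons.IH mlin_Cons) auto
    ultimately show ?thesis using Suc by (simp add: algebra_simps)
  qed
qed

text \<open>This is well-definedness on tensor products read dually: a coderivation sends
  multilinearity relations to relations.\<close>

lemma N_lin_word:
  assumes "der p D" "mlin f" "set us \<subseteq> ok" "set vs \<subseteq> ok" "shape (us @ z # vs)" "lc a x b y z"
  shows "N i p D f (us @ z # vs) = a * N i p D f (us @ x # vs) + b * N i p D f (us @ y # vs)"
  using assms
proof (induction us arbitrary: f)
  case Nil
  note z = lcD[OF Nil.prems(6)] and D = derD[OF Nil.prems(1)]
  have "E i (D z) f vs = a * E i (D x) f vs + b * E i (D y) f vs"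
    using Nil.prems D z by (intro E_lin_letter) auto
  moreover have "N i p D (\<lambda>u. f (z # u)) vs = N i p D (\<lambda>u. a * f (x # u) + b * f (y # u)) vs"
  proof (rule N_cong)
    fix u assume "reaches (length vs) (degs vs + p) (\<forall>v\<in>set vs. \<not> isL v) u"
    then have "set u \<subseteq> ok" by (simp add: reaches_def)
    then show "f (z # u) = a * f (x # u) + b * f (y # u)"
      using Nil.prems mlinD[of f a x b y z "[]" u] by simp
  qed (use Nil.prems D in auto)
  ultimately show ?case using z
    by (simp add: N_lin) (simp add: algebra_simps)
next
  case (Cons v us)
  note D = derD[OF Cons.prems(1)]
  have "E i (D v) f (us @ z # vs) = a * E i (D v) f (us @ x # vs) + b * E i (D v) f (us @ y # vs)"
    using Cons.prems D by (intro E_lin_word) auto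
  moreover have "N i p D (\<lambda>u. f (v # u)) (us @ z # vs)
        = a * N i p D (\<lambda>u. f (v # u)) (us @ x # vs) + b * N i p D (\<lambda>u. f (v # u)) (us @ y # vs)"
    using Cons.prems by (intro Cons.IH mlin_Cons) auto
  ultimately show ?case by (simp add: algebra_simps)
qed

lemma total_cong:
  assumes "\<And>r. der 1 (D r)" "set w \<subseteq> ok" "shape w"
    and "\<And>u. reaches (length w) (degs w + 1) (\<forall>v\<in>set w. \<not> isL v) u \<Longrightarrow> f u = g u"
  shows "total I D f w = total I D g w"
  unfolding total_def
  by (intro sum.cong N_cong) (use assms derD(1-3)[OF assms(1)] in auto)

lemma total_lin_word:
  assumes "\<And>r. der 1 (D r)" "mlin f" "set us \<subseteq> ok" "set vs \<subseteq> ok" "shape (us @ z # vs)" "lc a x b y z"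
  shows "total I D f (us @ z # vs) = a * total I D f (us @ x # vs) + b * total I D f (us @ y # vs)"
  unfolding total_def using assms
  by (simp add: N_lin_word[OF assms] sum.distrib sum_distrib_left)

text \<open>\<open>S m y\<close> plays the role of the partial sum $\sum_{i<m} D_i D_{n-i} y$.\<close>

lemma total_op_eq_0:
  assumes der: "\<And>r. der 1 (D r)" and f: "mlin f" and w: "set w \<subseteq> ok" "shape w" and "(2::'k) \<noteq> 0"
    and S: "\<And>n m y. y \<in> ok \<Longrightarrow> m \<le> n \<Longrightarrow> lc 1 (S n m y) 1 (D m (D (n - m) y)) (S n (Suc m) y)"
    and S0: "\<And>n y. y \<in> ok \<Longrightarrow> lc 0 (S n 0 y) 0 (S n 0 y) (S n 0 y)"
    and Sn: "\<And>n y. y \<in> ok \<Longrightarrow> lc 0 (S n (Suc n) y) 0 (S n (Suc n) y) (S n (Suc n) y)"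
  shows "total UNIV D (total UNIV D f) w = 0"
proof -
  define n where "n = length w"
  define F where "F i j = N j 1 (D j) (N i 1 (D i) f) w" for i j
  define G where "G i j = N (i + j) 2 (D i \<circ> D j) f w" for i j
  note D = derD[OF der]
  have "total UNIV D (total UNIV D f) w = (\<Sum>j<n. N j 1 (D j) (total UNIV D f) w)"
    by (simp add: total_def n_def)
  also have "\<dots> = (\<Sum>j<n. N j 1 (D j) (\<lambda>u. \<Sum>i<n. N i 1 (D i) f u) w)"
    by (intro sum.cong N_cong) (use D w in \<open>auto simp: reaches_def n_def total_eq\<close>)
  also have "\<dots> = (\<Sum>j<n. \<Sum>i<n. F i j)"
    by (simp add: N_sum F_def)
  finally have 1: "total UNIV D (total UNIV D f) w = (\<Sum>j<n. \<Sum>i<n. F i j)" .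
  \<comment> \<open>Both operators have degree 1, so the graded commutator is the
    anticommutator.\<close>
  have FG: "F i j + F j i = G i j + G j i" for i j
    using N_commutator[of 1 "D i" 1 "D j" f w j i, OF der der f w]
    by (simp add: F_def G_def sg_def add.commute)
  \<comment> \<open>\<open>S\<close> is known only through linear relations; that it preserves the
    origin of letters is inherited from \<open>D\<close> along them.\<close>
  have isL_S: "isL (S k m y) \<longleftrightarrow> isL y" if "y \<in> ok" "m \<le> Suc k" for k m y
    using that(2)
  proof (induction m)
    case 0
    then show ?case using lcD[OF S[OF that(1), of 0 k]] D that by auto
  next
    case (Suc m)
    then show ?case using lcD[OF S[OF that(1), of m k]] D that by auto
  qed
  \<comment> \<open>Telescoping: each composite is the difference of two consecutive values of
    \<open>S\<close>.\<close>
  have "(\<Sum>i<m. G i (k - i)) = N k 2 (S k m) f w - N k 2 (S k 0) f w" if "m \<le> Suc k" for k m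
    using that
  proof (induction m)
    case (Suc m)
    then show ?case
      using N_lin_map[OF f w, of 1 "S k m" 1 "D m \<circ> D (k - m)" "S k (Suc m)" k 2] S isL_S
      by (simp add: G_def)
  qed simp
  \<comment> \<open>\<open>lc 0 z 0 z z\<close> says that z is zero, so both ends of the telescope
    vanish; for a deformation the upper end is the coefficient equation of order k.\<close>
  moreover have "N k 2 (S k 0) f w = 0" "N k 2 (S k (Suc k)) f w = 0" for k
    using N_lin_map[OF f w, of 0 "S k 0" 0 "S k 0" "S k 0" k 2]
      N_lin_map[OF f w, of 0 "S k (Suc k)" 0 "S k (Suc k)" "S k (Suc k)" k 2] S0 Sn isL_S by auto
  ultimately have G0: "(\<Sum>i\<le>k. G i (k - i)) = 0" for k
    by (simp add: lessThan_Suc_atMost[symmetric] del: sum.lessThan_Suc)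
  \<comment> \<open>Beyond the antidiagonal the order i + j is too large for the word, which reduces
    the square of indices to a triangle.\<close>
  have G_large: "G i j = 0" if "n \<le> i + j" for i j
    using that by (simp add: G_def N_eq_0 n_def)
  have "(\<Sum>j<n. \<Sum>i<n. G i j) = (\<Sum>(i, j)\<in>{..<n} \<times> {..<n}. G i j)"
    by (subst sum.swap) (simp add: sum.cartesian_product)
  also have "\<dots> = (\<Sum>(i, j)\<in>{(i, j). i + j < n}. G i j)"
    by (rule sum.mono_neutral_right) (auto intro!: G_large)
  also have "\<dots> = (\<Sum>k<n. \<Sum>i\<le>k. G i (k - i))"
    by (rule sum.triangle_reindex)
  finally have G: "(\<Sum>j<n. \<Sum>i<n. G i j) = 0"
    using G0 by simp
  \<comment> \<open>The commutator formula evaluates \<open>F\<close> only after symmetrization in i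
    and j; hence the sum is doubled first and 2 is cancelled afterwards.\<close>
  have "2 * (\<Sum>j<n. \<Sum>i<n. F i j) = (\<Sum>j<n. \<Sum>i<n. F i j) + (\<Sum>j<n. \<Sum>i<n. F j i)"
    by (subst (3) sum.swap) simp
  also have "\<dots> = (\<Sum>j<n. \<Sum>i<n. G i j) + (\<Sum>j<n. \<Sum>i<n. G j i)"
    by (simp add: sum.distrib[symmetric] FG)
  also have "\<dots> = 0"
    by (subst (2) sum.swap) (simp add: G)
  finally show ?thesis using 1 \<open>(2::'k) \<noteq> 0\<close> by simp
qed

end

section \<open>Unshuffles\<close>

text \<open>The shuffle coproduct in functional form: letters are dealt one by one to two ordered
  lists. A letter sent to the right is overtaken by all later letters that end up on the left, which
  gives the sign.\<close>

fun deal :: "('v \<Rightarrow> int) \<Rightarrow> ('v list \<Rightarrow> 'v list \<Rightarrow> 'k::comm_ring_1) \<Rightarrow> 'v list \<Rightarrow> 'k" where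
  "deal d h [] = h [] []"
| "deal d h (x # xs) = deal d (\<lambda>u v. h (x # u) v) xs +
     deal d (\<lambda>u v. sg (d x * sum_list (map d u)) * h u (x # v)) xs"

lemma deal_cong:
  assumes "\<And>u v. set u \<union> set v = set xs \<Longrightarrow> length u + length v = length xs \<Longrightarrow> f u v = g u v"
  shows "deal d f xs = deal d g xs"
  using assms
proof (induction xs arbitrary: f g)
  case (Cons x xs)
  have "deal d (\<lambda>u v. f (x # u) v) xs = deal d (\<lambda>u v. g (x # u) v) xs"
    by (intro Cons.IH Cons.prems) auto
  moreover have "deal d (\<lambda>u v. sg (d x * sum_list (map d u)) * f u (x # v)) xs =
      deal d (\<lambda>u v. sg (d x * sum_list (map d u)) * g u (x # v)) xs"
    by (intro Cons.IH arg_cong2[of _ _ _ _ "(*)"] refl Cons.prems) auto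
  ultimately show ?case by simp
qed auto

lemma deal_lin: "deal d (\<lambda>u v. a * f u v + b * g u v) xs = a * deal d f xs + b * deal d g xs"
proof (induction xs arbitrary: f g)
  case (Cons x xs)
  have "(\<lambda>u v. sg (d x * sum_list (map d u)) * (a * f u (x # v) + b * g u (x # v)))
    = (\<lambda>u v. a * (sg (d x * sum_list (map d u)) * f u (x # v)) +
         b * (sg (d x * sum_list (map d u)) * g u (x # v)))"
    by (simp add: algebra_simps)
  then show ?case
    by (simp add: Cons.IH) (simp add: algebra_simps)
qed auto

lemma deal_add: "deal d (\<lambda>u v. f u v + g u v) xs = deal d f xs + deal d g xs"
  using deal_lin[of d 1 f 1 g xs] by simp

lemma deal_scale: "deal d (\<lambda>u v. a * f u v) xs = a * deal d f xs"
  using deal_lin[of d a f 0 f xs] by simp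

lemma deal_zero [simp]: "deal d (\<lambda>u v. 0) xs = 0"
  using deal_scale[of d 0 "\<lambda>u v. 0" xs] by simp

lemma deal_sum: "deal d (\<lambda>u v. \<Sum>s\<in>S. F s u v) xs = (\<Sum>s\<in>S. deal d (F s) xs)"
  by (induction S rule: infinite_finite_induct) (auto simp: deal_add)

lemma deal_map: "deal d h (map g xs) = deal (d \<circ> g) (\<lambda>u v. h (map g u) (map g v)) xs"
  by (induction xs arbitrary: h) (auto simp: comp_def)

text \<open>\<open>S\<close> is the set of places dealt to the left; a pair of places counts when
  dealing reverses its order.\<close>

definition inv_exp :: "('v \<Rightarrow> int) \<Rightarrow> 'v list \<Rightarrow> nat set \<Rightarrow> int" where
  "inv_exp d xs S = (\<Sum>(a, b) | a < b \<and> b < length xs \<and> a \<notin> S \<and> b \<in> S. d (xs ! a) * d (xs ! b))"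

definition elems :: "'v list \<Rightarrow> nat set \<Rightarrow> 'v list" where
  "elems xs S = map ((!) xs) (sorted_list_of_set S)"

lemma sorted_list_of_set_eqI:
  "sorted_wrt (<) l \<Longrightarrow> set l = S \<Longrightarrow> sorted_list_of_set S = (l :: nat list)"
  using sorted_list_of_set.idem_if_sorted_distinct[of l] by (auto simp: strict_sorted_iff)

lemma sorted_list_of_set_Suc_image:
  "finite S \<Longrightarrow> sorted_list_of_set (Suc ` S) = map Suc (sorted_list_of_set S)"
  by (rule sorted_list_of_set_eqI) (auto simp: sorted_wrt_map)

lemma sorted_list_of_set_insert_0:
  "finite S \<Longrightarrow> sorted_list_of_set (insert 0 (Suc ` S)) = 0 # map Suc (sorted_list_of_set S)"
  by (rule sorted_list_of_set_eqI) (auto simp: sorted_wrt_map)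

lemma elems_Suc [simp]: "finite S \<Longrightarrow> elems (x # xs) (Suc ` S) = elems xs S"
  by (simp add: elems_def sorted_list_of_set_Suc_image)

lemma elems_insert [simp]: "finite S \<Longrightarrow> elems (x # xs) (insert 0 (Suc ` S)) = x # elems xs S"
  unfolding elems_def sorted_list_of_set_insert_0 by simp

lemma length_elems [simp]: "length (elems xs S) = card S"
  by (simp add: elems_def)

lemma finite_pairs [simp]: "finite {(a, b). a < b \<and> b < (n::nat) \<and> P a b}"
  by (rule finite_subset[of _ "{..<n} \<times> {..<n}"]) auto

lemma inv_exp_0:
  assumes "S \<subseteq> {..<length xs}"
  shows "inv_exp d (x # xs) (insert 0 (Suc ` S)) = inv_exp d xs S"
  unfolding inv_exp_def
  by (rule sum.reindex_bij_witness[of _ "\<lambda>(a, b). (Suc a, Suc b)" "\<lambda>(a, b). (a - 1, b - 1)"])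
    (use assms in \<open>auto simp: nth_Cons image_iff split: nat.splits\<close>)

text \<open>The first letter goes right and is overtaken by the whole left list; this is the sign in
  the second clause of \<open>deal\<close>.\<close>

lemma inv_exp_Suc:
  assumes "S \<subseteq> {..<length xs}"
  shows "inv_exp d (x # xs) (Suc ` S) = d x * sum_list (map d (elems xs S)) + inv_exp d xs S"
proof -
  have fin: "finite S" using assms finite_subset by blast
  have "{(a, b). a < b \<and> b < length (x # xs) \<and> a \<notin> Suc ` S \<and> b \<in> Suc ` S} =
     (\<lambda>b. (0, Suc b)) ` S \<union>
     (\<lambda>(a, b). (Suc a, Suc b)) ` {(a, b). a < b \<and> b < length xs \<and> a \<notin> S \<and> b \<in> S}"
    (is "?P = ?Q \<union> ?R")
  proof (intro equalityI subsetI)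
    fix p assume "p \<in> ?P"
    then obtain a b where "p = (a, b)" "a < b" "b < length (x # xs)" "a \<notin> Suc ` S" "b \<in> Suc ` S"
      by auto
    then show "p \<in> ?Q \<union> ?R" by (cases a) (auto simp: image_iff)
  qed (use assms in auto)
  then have "inv_exp d (x # xs) (Suc ` S) =
    (\<Sum>(a, b)\<in>?Q. d ((x # xs) ! a) * d ((x # xs) ! b)) + (\<Sum>(a, b)\<in>?R. d ((x # xs) ! a) * d ((x # xs) ! b))"
    unfolding inv_exp_def by (simp only:) (subst sum.union_disjoint, auto simp: fin)
  also have "(\<Sum>(a, b)\<in>?R. d ((x # xs) ! a) * d ((x # xs) ! b)) = inv_exp d xs S"
    unfolding inv_exp_def by (subst sum.reindex) (auto simp: inj_on_def case_prod_unfold)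
  also have "(\<Sum>(a, b)\<in>?Q. d ((x # xs) ! a) * d ((x # xs) ! b)) = (\<Sum>b\<in>S. d x * d (xs ! b))"
    by (subst sum.reindex) (auto simp: inj_on_def)
  also have "\<dots> = d x * sum_list (map d (elems xs S))"
    using fin by (simp add: elems_def sum_distrib_left comp_def sum_list_distinct_conv_sum_set)
  finally show ?thesis .
qed

lemma deal_subsets:
  "deal d h xs = (\<Sum>S\<in>Pow {..<length xs}. sg (inv_exp d xs S) *
     h (elems xs S) (elems xs ({..<length xs} - S)))"
proof (induction xs arbitrary: h)
  case Nil
  then show ?case by (simp add: elems_def inv_exp_def)
next
  case (Cons x xs)
  let ?n = "length xs"
  have P: "Pow {..<length (x # xs)} = (\<lambda>S. insert 0 (Suc ` S)) ` Pow {..<?n} \<union> (\<lambda>S. Suc ` S) ` Pow {..<?n}"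
    by (simp add: lessThan_Suc_eq_insert_0 Pow_insert image_Pow_surj[symmetric] Un_commute image_image)
  have inj: "inj_on (\<lambda>S. Suc ` S) (Pow {..<?n})"
    by (simp add: inj_on_def inj_image_eq_iff)
  have inj0: "inj_on (\<lambda>S. insert 0 (Suc ` S)) (Pow {..<?n})"
    by (rule inj_onI) (metis insert_ident image_iff inj_image_eq_iff inj_Suc nat.distinct(1))
  have c0: "{..<length (x # xs)} - insert 0 (Suc ` S) = Suc ` ({..<?n} - S)" for S
    by (auto simp: lessThan_Suc_eq_insert_0)
  have c1: "{..<length (x # xs)} - Suc ` S = insert 0 (Suc ` ({..<?n} - S))" for S
    by (auto simp: lessThan_Suc_eq_insert_0)
  have fin: "S \<in> Pow {..<?n} \<Longrightarrow> finite S" for S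
    using finite_subset by blast
  have "(\<Sum>S\<in>Pow {..<length (x # xs)}. sg (inv_exp d (x # xs) S) *
     h (elems (x # xs) S) (elems (x # xs) ({..<length (x # xs)} - S)))
   = (\<Sum>S\<in>Pow {..<?n}. sg (inv_exp d (x # xs) (insert 0 (Suc ` S))) *
       h (elems (x # xs) (insert 0 (Suc ` S))) (elems (x # xs) (Suc ` ({..<?n} - S))))
   + (\<Sum>S\<in>Pow {..<?n}. sg (inv_exp d (x # xs) (Suc ` S)) *
       h (elems (x # xs) (Suc ` S)) (elems (x # xs) (insert 0 (Suc ` ({..<?n} - S)))))"
    unfolding P
    by (subst sum.union_disjoint)
      (auto simp: sum.reindex[OF inj] sum.reindex[OF inj0] c0[simplified] c1[simplified])
  also have "\<dots> = deal d h (x # xs)"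
    by (simp add: Cons.IH)
      (intro arg_cong2[of _ _ _ _ "(+)"] sum.cong refl,
        auto simp: inv_exp_0 inv_exp_Suc sg_add fin mult_ac)
  finally show ?case by simp
qed

lemma strict_mono_map_sorted:
  fixes \<sigma> :: "nat \<Rightarrow> nat"
  assumes "strict_mono_on {b..<e} \<sigma>"
  shows "map \<sigma> [b..<e] = sorted_list_of_set (\<sigma> ` {b..<e})"
  by (rule sorted_list_of_set_eqI[symmetric])
    (use assms in \<open>auto simp: sorted_wrt_iff_nth_less strict_mono_onD\<close>)

text \<open>An unshuffle increases on both blocks, so the set of its first p values determines it.
  Conversely, the sorted list of a set followed by the sorted list of its complement is the list of
  values of an unshuffle.\<close>

lemma unshuffles_bij:
  "bij_betw (\<lambda>\<sigma>. \<sigma> ` {..<p}) (unshuffles p q) {S. S \<subseteq> {..<p + q} \<and> card S = p}"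
proof (rule bij_betw_imageI)
  let ?n = "p + q"
  have compl: "\<sigma> ` {p..<?n} = {..<?n} - \<sigma> ` {..<p}" if "\<sigma> permutes {..<?n}" for \<sigma>
  proof -
    have "{p..<?n} = {..<?n} - {..<p}" by auto
    then have "\<sigma> ` {p..<?n} = \<sigma> ` {..<?n} - \<sigma> ` {..<p}"
      using that by (simp only: image_set_diff permutes_inj)
    then show ?thesis
      using that by (simp add: permutes_image)
  qed
  show "inj_on (\<lambda>\<sigma>. \<sigma> ` {..<p}) (unshuffles p q)"
  proof (rule inj_onI)
    fix \<sigma> \<tau> assume \<sigma>: "\<sigma> \<in> unshuffles p q" and \<tau>: "\<tau> \<in> unshuffles p q" and eq: "\<sigma> ` {..<p} = \<tau> ` {..<p}"
    have "map \<sigma> [0..<p] = map \<tau> [0..<p]"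
      using \<sigma> \<tau> eq strict_mono_map_sorted[of 0 p]
      by (simp add: unshuffles_def atLeast0LessThan del: map_eq_conv)
    moreover have "map \<sigma> [p..<?n] = map \<tau> [p..<?n]"
      using \<sigma> \<tau> eq compl[of \<sigma>] compl[of \<tau>] strict_mono_map_sorted[of p ?n]
      by (simp add: unshuffles_def del: map_eq_conv)
    ultimately have "\<sigma> r = \<tau> r" if "r < ?n" for r
      using that by (cases "r < p") auto
    moreover have "\<sigma> r = \<tau> r" if "\<not> r < ?n" for r
      using that \<sigma> \<tau> by (auto simp: unshuffles_def permutes_def)
    ultimately show "\<sigma> = \<tau>" by blast
  qed
  show "(\<lambda>\<sigma>. \<sigma> ` {..<p}) ` unshuffles p q = {S. S \<subseteq> {..<?n} \<and> card S = p}"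
  proof (intro equalityI subsetI)
    fix S assume "S \<in> (\<lambda>\<sigma>. \<sigma> ` {..<p}) ` unshuffles p q"
    then obtain \<sigma> where S: "S = \<sigma> ` {..<p}" and \<sigma>: "\<sigma> permutes {..<?n}"
      by (auto simp: unshuffles_def)
    have "S \<subseteq> \<sigma> ` {..<?n}" using S by auto
    moreover have "card S = p"
      using S \<sigma> by (simp add: card_image permutes_inj_on)
    ultimately show "S \<in> {S. S \<subseteq> {..<?n} \<and> card S = p}"
      using \<sigma> by (simp add: permutes_image)
  next
    fix S assume "S \<in> {S. S \<subseteq> {..<?n} \<and> card S = p}"
    then have S: "S \<subseteq> {..<?n}" "card S = p" "finite S" using finite_subset by auto
    define l where "l = sorted_list_of_set S @ sorted_list_of_set ({..<?n} - S)"
    define \<sigma> where "\<sigma> r = (if r < ?n then l ! r else r)" for r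
    have len: "length l = ?n" using S by (simp add: l_def card_Diff_subset)
    have "set l = S \<union> ({..<?n} - S)" using S(3) by (simp add: l_def)
    then have "set l = {..<?n}" using S(1) by blast
    moreover have "distinct l" using S(3) by (simp add: l_def)
    ultimately have "bij_betw ((!) l) {..<?n} {..<?n}"
      using len by (intro bij_betw_nth) simp_all
    moreover have "bij_betw \<sigma> {..<?n} {..<?n} = bij_betw ((!) l) {..<?n} {..<?n}"
      by (rule bij_betw_cong) (simp add: \<sigma>_def)
    ultimately have "bij_betw \<sigma> {..<?n} {..<?n}" by simp
    then have perm: "\<sigma> permutes {..<?n}" by (rule bij_imp_permutes) (simp add: \<sigma>_def)
    have lo: "\<sigma> r = sorted_list_of_set S ! r" if "r < p" for r
      using that S by (simp add: \<sigma>_def l_def nth_append)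
    have hi: "\<sigma> r = sorted_list_of_set ({..<?n} - S) ! (r - p)" if "p \<le> r" "r < ?n" for r
      using that S by (simp add: \<sigma>_def l_def nth_append)
    have less: "sorted_list_of_set T ! r < sorted_list_of_set T ! s" if "r < s" "s < card T"
      for T :: "nat set" and r s
      using that by (intro sorted_wrt_nth_less[of "(<)"]) simp_all
    have "card ({..<?n} - S) = q" using S by (simp add: card_Diff_subset)
    then have "strict_mono_on {p..<?n} \<sigma>"
      by (auto simp: strict_mono_on_def hi intro!: less)
    moreover have "strict_mono_on {..<p} \<sigma>"
      using S(2) by (auto simp: strict_mono_on_def lo intro!: less)
    ultimately have "\<sigma> \<in> unshuffles p q" using perm by (simp add: unshuffles_def)
    moreover have "\<sigma> ` {..<p} = S"
    proof -
      have "\<sigma> ` {..<p} = (!) (sorted_list_of_set S) ` {..<p}" using lo by auto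
      also have "\<dots> = set (sorted_list_of_set S)"
        using S by (simp add: set_conv_nth image_def lessThan_def) blast
      finally show ?thesis using S by simp
    qed
    ultimately show "S \<in> (\<lambda>\<sigma>. \<sigma> ` {..<p}) ` unshuffles p q" by blast
  qed
qed

lemma unshuffle_elems:
  assumes "\<sigma> \<in> unshuffles p q"
  shows "pick xs \<sigma> 0 p = elems xs (\<sigma> ` {..<p})"
    "pick xs \<sigma> p (p + q) = elems xs ({..<p + q} - \<sigma> ` {..<p})"
    "length xs = p + q \<Longrightarrow> koszul (map d xs) (p + q) \<sigma> = inv_exp d xs (\<sigma> ` {..<p})"
proof -
  let ?n = "p + q"
  have perm: "\<sigma> permutes {..<?n}" and mono: "strict_mono_on {..<p} \<sigma>" "strict_mono_on {p..<?n} \<sigma>"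
    using assms by (auto simp: unshuffles_def)
  have inj: "inj \<sigma>" using perm by (rule permutes_inj)
  have "{p..<?n} = {..<?n} - {..<p}" by auto
  then have "\<sigma> ` {p..<?n} = \<sigma> ` {..<?n} - \<sigma> ` {..<p}"
    using inj by (simp only: image_set_diff)
  then have compl: "\<sigma> ` {p..<?n} = {..<?n} - \<sigma> ` {..<p}"
    using perm by (simp add: permutes_image)
  have "pick xs \<sigma> b e = map ((!) xs) (map \<sigma> [b..<e])" for b e
    by (simp add: pick_def)
  then show "pick xs \<sigma> 0 p = elems xs (\<sigma> ` {..<p})"
    "pick xs \<sigma> p ?n = elems xs ({..<?n} - \<sigma> ` {..<p})"
    using mono strict_mono_map_sorted[of 0 p \<sigma>] strict_mono_map_sorted[of p ?n \<sigma>]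
    by (simp_all add: elems_def compl[symmetric] atLeast0LessThan del: map_map)
  assume len: "length xs = ?n"
  have lt: "\<sigma> r < ?n \<longleftrightarrow> r < ?n" for r
    using permutes_in_image[OF perm, of r] by simp
  have img: "\<sigma> r \<in> \<sigma> ` {..<p} \<longleftrightarrow> r < p" for r
    using inj by (simp add: inj_image_mem_iff)
  \<comment> \<open>Both blocks are increasing, so every inversion has r in the first and t in the
    second block.\<close>
  have *: "r < t \<and> t < ?n \<and> \<sigma> t < \<sigma> r \<longleftrightarrow> \<sigma> t < \<sigma> r \<and> \<sigma> r < ?n \<and> r < p \<and> \<not> t < p \<and> t < ?n" for r t
  proof -
    have "r < t \<Longrightarrow> t < p \<Longrightarrow> \<sigma> r < \<sigma> t" "p \<le> r \<Longrightarrow> r < t \<Longrightarrow> t < ?n \<Longrightarrow> \<sigma> r < \<sigma> t"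
      using mono by (auto simp: strict_mono_on_def)
    then show ?thesis
      using lt[of r] by (cases "r < t"; cases "t < p"; cases "r < p") auto
  qed
  have perm_inv: "\<sigma> (inv \<sigma> a) = a" for a
    using perm by (simp add: permutes_inverses)
  have inv_lt: "inv \<sigma> a < p" if "a \<in> \<sigma> ` {..<p}" for a
    using that inj by auto
  have inv_ge: "\<not> inv \<sigma> a < p" if "a \<notin> \<sigma> ` {..<p}" for a
    using that perm_inv[of a] by (metis image_eqI lessThan_iff)
  have inv_n: "inv \<sigma> a < ?n \<longleftrightarrow> a < ?n" for a
    using lt[of "inv \<sigma> a"] by (simp add: perm_inv)
  have less: "a < ?n" if "a < \<sigma> x" "x < p" for a x
    using that lt[of x] by simp
  \<comment> \<open>An inversion (r, t) names positions after the rearrangement;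
    \<open>(\<sigma> t, \<sigma> r)\<close> is the same pair of letters by its places before it, in
    increasing order.\<close>
  show "koszul (map d xs) ?n \<sigma> = inv_exp d xs (\<sigma> ` {..<p})"
    unfolding koszul_def inv_exp_def
    by (intro sum.reindex_bij_witness[of _ "\<lambda>(a, b). (inv \<sigma> b, inv \<sigma> a)" "\<lambda>(r, t). (\<sigma> t, \<sigma> r)"])
      (auto simp: len * lt img img[unfolded image_iff] inv_f_f[OF inj] inj_eq[OF inj] perm_inv inv_n less dest: inv_ge)
qed

lemma unshuffle_sum:
  assumes "length xs = p + q"
  shows "(\<Sum>\<sigma>\<in>unshuffles p q. sg (koszul (map d xs) (p + q) \<sigma>) *
      h (pick xs \<sigma> 0 p) (pick xs \<sigma> p (p + q))) =
    deal d (\<lambda>u v. if length u = p then h u v else 0) xs"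
proof -
  have "(\<Sum>\<sigma>\<in>unshuffles p q. sg (koszul (map d xs) (p + q) \<sigma>) *
      h (pick xs \<sigma> 0 p) (pick xs \<sigma> p (p + q))) =
    (\<Sum>\<sigma>\<in>unshuffles p q. sg (inv_exp d xs (\<sigma> ` {..<p})) *
      h (elems xs (\<sigma> ` {..<p})) (elems xs ({..<p + q} - \<sigma> ` {..<p})))"
    using assms by (intro sum.cong) (auto simp: unshuffle_elems)
  also have "\<dots> = (\<Sum>S | S \<subseteq> {..<p + q} \<and> card S = p. sg (inv_exp d xs S) *
      h (elems xs S) (elems xs ({..<p + q} - S)))"
    by (rule sum.reindex_bij_betw[OF unshuffles_bij, of "\<lambda>S. sg (inv_exp d xs S) *
      h (elems xs S) (elems xs ({..<p + q} - S))"])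
  also have "\<dots> = deal d (\<lambda>u v. if length u = p then h u v else 0) xs"
    unfolding deal_subsets assms by (rule sum.mono_neutral_cong_left) auto
  finally show ?thesis .
qed

section \<open>The operators as sums over unshuffles\<close>

context letters
begin

definition NL :: "('v \<Rightarrow> 'v) \<Rightarrow> 'v list \<Rightarrow> 'v" where
  "NL D v = foldl br (D (hd v)) (tl v)"

lemma deg_foldl [simp]: "deg (foldl br z v) = deg z + degs v"
  by (induction v arbitrary: z) auto

lemma isL_foldl [simp]: "isL (foldl br z v) \<longleftrightarrow> isL z \<and> (\<forall>y\<in>set v. isL y)"
  by (induction v arbitrary: z) auto

text \<open>A bracket in progress either ends at some letter \<open>xs ! k\<close>, after absorbing
  a choice of r earlier letters, or has absorbed at most r letters when it meets A. The last entry
  thus keeps its place, as in the coderivation of a map with values in L.\<close>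

lemma E_split:
  assumes "isL z" "\<forall>x\<in>set xs. isL x"
  shows "E (Suc r) z f (xs @ as) =
    (\<Sum>k<length xs. deal deg (\<lambda>u v. if length v = r
       then sg (deg z * degs u) * f (u @ foldl br z (v @ [xs ! k]) # drop (Suc k) xs @ as) else 0) (take k xs)) +
    deal deg (\<lambda>u v. if length v \<le> r
       then sg (deg z * degs u) * E (Suc r - length v) (foldl br z v) (\<lambda>t. f (u @ t)) as else 0) xs"
  using assms
proof (induction xs arbitrary: r z f)
  case (Cons y xs)
  let ?A = "\<lambda>r z f k u v. if length v = r
       then sg (deg z * degs u) * f (u @ foldl br z (v @ [xs ! k]) # drop (Suc k) xs @ as) else 0"
  let ?B = "\<lambda>r z f u v. if length v \<le> r
       then sg (deg z * degs u) * E (Suc r - length v) (foldl br z v) (\<lambda>t. f (u @ t)) as else 0"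
  let ?f = "\<lambda>u. f (y # u)"
  let ?X = "\<lambda>r z f xs k u v. if length v = r
       then sg (deg z * degs u) * f (u @ foldl br z (v @ [xs ! k]) # drop (Suc k) xs @ as) else 0"
  have 1: "?X r z f (y # xs) (Suc k) (y # u) v = sg (deg z * deg y) * ?A r z ?f k u v" for k u v
    by (simp add: sg_simps)
  have 2: "?B r z f (y # u) v = sg (deg z * deg y) * ?B r z ?f u v" for u v
    by (simp add: sg_simps)
  have left: "E (Suc r) z ?f (xs @ as) = (\<Sum>k<length xs. deal deg (?A r z ?f k) (take k xs)) + deal deg (?B r z ?f) xs"
    using Cons by auto
  have right: "E r (br z y) f (xs @ as) =
    deal deg (?X r z f (y # xs) 0) [] +
    (\<Sum>k<length xs. deal deg (\<lambda>u v. sg (deg y * degs u) * ?X r z f (y # xs) (Suc k) u (y # v)) (take k xs)) +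
    deal deg (\<lambda>u v. sg (deg y * degs u) * ?B r z f u (y # v)) xs"
  proof (cases r)
    case 0
    then show ?thesis by simp
  next
    case (Suc s)
    have "E (Suc s) (br z y) f (xs @ as) =
       (\<Sum>k<length xs. deal deg (?A s (br z y) f k) (take k xs)) + deal deg (?B s (br z y) f) xs"
      using Cons by auto
    moreover have "?A s (br z y) f k u v = sg (deg y * degs u) * ?X r z f (y # xs) (Suc k) u (y # v)" for k u v
      by (simp add: Suc sg_simps)
    moreover have "?B s (br z y) f u v = sg (deg y * degs u) * ?B r z f u (y # v)" for u v
      by (simp add: Suc sg_simps)
    ultimately show ?thesis by (simp add: Suc)
  qed
  have "E (Suc r) z f ((y # xs) @ as) = E r (br z y) f (xs @ as) + sg (deg z * deg y) * E (Suc r) z ?f (xs @ as)"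
    using Cons.prems by simp
  also have "\<dots> = deal deg (?X r z f (y # xs) 0) [] +
     (\<Sum>k<length xs. deal deg (?X r z f (y # xs) (Suc k)) (y # take k xs)) + deal deg (?B r z f) (y # xs)"
    unfolding left right deal.simps 1 2 deal_scale degs_def[symmetric]
    by (simp add: sum.distrib sum_distrib_left algebra_simps)
  finally show ?case
    by (simp only: length_Cons sum.lessThan_Suc_shift take_0 take_Suc_Cons)
qed simp

text \<open>The second branch of \<open>E\<close> is closed to a product in A, so it takes
  consecutive letters.\<close>

lemma E_letters_A:
  assumes "\<not> isL b"
  shows "E s b f as = (if s \<le> length as then f (foldl br b (take s as) # drop s as) else 0)"
  using assms
proof (induction as arbitrary: s b)
  case Nil
  then show ?case by (cases s) auto
next
  case (Cons c as)
  then show ?case by (cases s) auto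
qed

text \<open>z may pass letters of A, but the first one that it absorbs turns it into a letter of A;
  so the absorbed letters are consecutive.\<close>

lemma E_letters_L:
  assumes "isL z" "\<forall>y\<in>set as. \<not> isL y"
  shows "E (Suc s) z f as = (\<Sum>k<length as. if k + Suc s \<le> length as
    then sg (deg z * degs (take k as)) *
      f (take k as @ foldl br z (take (Suc s) (drop k as)) # drop (k + Suc s) as) else 0)"
  using assms
proof (induction as arbitrary: f)
  case (Cons y as)
  have "E (Suc s) z f (y # as) = (if s \<le> length as then f (foldl br (br z y) (take s as) # drop s as) else 0)
     + sg (deg z * deg y) * E (Suc s) z (\<lambda>u. f (y # u)) as"
    using Cons.prems by (simp add: E_letters_A)
  also have "\<dots> = (\<Sum>k<length (y # as). if k + Suc s \<le> length (y # as)
    then sg (deg z * degs (take k (y # as))) *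
      f (take k (y # as) @ foldl br z (take (Suc s) (drop k (y # as))) # drop (k + Suc s) (y # as)) else 0)"
    unfolding length_Cons sum.lessThan_Suc_shift using Cons
    by (auto simp: sum_distrib_left sg_simps mult.assoc intro!: sum.cong)
  finally show ?case .
qed simp

lemma N_letters_A:
  assumes "\<forall>y\<in>set as. \<not> isL y" "\<And>y. \<not> isL y \<Longrightarrow> \<not> isL (D y)"
  shows "N s p D f as = (\<Sum>k<length as. if k + Suc s \<le> length as
    then sg (p * degs (take k as)) *
      f (take k as @ NL D (take (Suc s) (drop k as)) # drop (k + Suc s) as) else 0)"
  using assms(1)
proof (induction as arbitrary: f)
  case (Cons y as)
  have "N s p D f (y # as) = (if s \<le> length as then f (foldl br (D y) (take s as) # drop s as) else 0)
     + sg (p * deg y) * N s p D (\<lambda>u. f (y # u)) as"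
    using Cons.prems assms(2) by (simp add: E_letters_A)
  also have "\<dots> = (\<Sum>k<length (y # as). if k + Suc s \<le> length (y # as)
    then sg (p * degs (take k (y # as))) *
      f (take k (y # as) @ NL D (take (Suc s) (drop k (y # as))) # drop (k + Suc s) (y # as)) else 0)"
    unfolding length_Cons sum.lessThan_Suc_shift using Cons
    by (auto simp: sum_distrib_left sg_simps mult.assoc NL_def intro!: sum.cong)
  finally show ?case .
qed simp

text \<open>If no letter of L is an entry of a bracket that reaches A, then \<open>D\<close> itself
  starts in A; otherwise the bracket enters A already in progress. This is the case distinction on
  \<open>v\<close>.\<close>

lemma N_split_aux:
  assumes "\<forall>x\<in>set xs. isL x" "\<And>y. isL (D y) \<longleftrightarrow> isL y" "\<And>y. deg (D y) = deg y + p"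
  shows "N r p D f (xs @ as) =
    (\<Sum>k<length xs. deal deg (\<lambda>u v. if length v = r
       then sg (p * degs u) * f (u @ NL D (v @ [xs ! k]) # drop (Suc k) xs @ as) else 0) (take k xs)) +
    deal deg (\<lambda>u v. if length v \<le> r
       then sg (p * degs u) * (if v = [] then N r p D (\<lambda>t. f (u @ t)) as
          else E (Suc r - length v) (NL D v) (\<lambda>t. f (u @ t)) as) else 0) xs"
  using assms(1)
proof (induction xs arbitrary: f)
  case (Cons y xs)
  let ?A = "\<lambda>f xs k u v. if length v = r
       then sg (p * degs u) * f (u @ NL D (v @ [xs ! k]) # drop (Suc k) xs @ as) else 0"
  let ?B = "\<lambda>f u v. if length v \<le> r
       then sg (p * degs u) * (if v = [] then N r p D (\<lambda>t. f (u @ t)) as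
          else E (Suc r - length v) (NL D v) (\<lambda>t. f (u @ t)) as) else 0"
  let ?f = "\<lambda>u. f (y # u)"
  have 1: "?A f (y # xs) (Suc k) (y # u) v = sg (p * deg y) * ?A ?f xs k u v" for k u v
    by (simp add: sg_simps)
  have 2: "?B f (y # u) v = sg (p * deg y) * ?B ?f u v" for u v
    by (simp add: sg_simps)
  have left: "N r p D ?f (xs @ as) = (\<Sum>k<length xs. deal deg (?A ?f xs k) (take k xs)) + deal deg (?B ?f) xs"
    using Cons by auto
  have right: "E r (D y) f (xs @ as) =
    deal deg (?A f (y # xs) 0) [] +
    (\<Sum>k<length xs. deal deg (\<lambda>u v. sg (deg y * degs u) * ?A f (y # xs) (Suc k) u (y # v)) (take k xs)) +
    deal deg (\<lambda>u v. sg (deg y * degs u) * ?B f u (y # v)) xs"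
  proof (cases r)
    case 0
    then show ?thesis by (simp add: NL_def)
  next
    case (Suc s)
    let ?A' = "\<lambda>k u v. if length v = s
       then sg (deg (D y) * degs u) * f (u @ foldl br (D y) (v @ [xs ! k]) # drop (Suc k) xs @ as) else 0"
    let ?B' = "\<lambda>u v. if length v \<le> s
       then sg (deg (D y) * degs u) * E (Suc s - length v) (foldl br (D y) v) (\<lambda>t. f (u @ t)) as else 0"
    have "?A' k u v = sg (deg y * degs u) * ?A f (y # xs) (Suc k) u (y # v)" for k u v
      by (simp add: Suc assms(3) NL_def) (simp add: sg_simps)
    moreover have "?B' u v = sg (deg y * degs u) * ?B f u (y # v)" for u v
      by (simp add: Suc assms(3) NL_def) (simp add: sg_simps)
    moreover have "E (Suc s) (D y) f (xs @ as) =
        (\<Sum>k<length xs. deal deg (?A' k) (take k xs)) + deal deg ?B' xs"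
      using Cons.prems assms(2) by (intro E_split) auto
    ultimately show ?thesis by (simp add: Suc)
  qed
  have "N r p D f ((y # xs) @ as) = E r (D y) f (xs @ as) + sg (p * deg y) * N r p D ?f (xs @ as)"
    by simp
  also have "\<dots> = deal deg (?A f (y # xs) 0) [] +
     (\<Sum>k<length xs. deal deg (?A f (y # xs) (Suc k)) (y # take k xs)) + deal deg (?B f) (y # xs)"
    unfolding left right deal.simps 1 2 deal_scale degs_def[symmetric]
    by (simp add: sum.distrib sum_distrib_left algebra_simps)
  finally show ?case
    by (simp only: length_Cons sum.lessThan_Suc_shift take_0 take_Suc_Cons)
qed simp

text \<open>In the second part i = \<open>length v\<close> entries come from L and j = r + 1 - i
  from A, so all splittings i + j = r + 1 with j at least 1 appear. The bracket on \<open>v\<close>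
  has degree \<open>degs v + p\<close> when it passes the first k letters of A, which accounts for
  the product of degrees in the exponent.\<close>

lemma N_split:
  assumes "\<forall>x\<in>set xs. isL x" "\<forall>a\<in>set as. \<not> isL a"
    and D: "\<And>y. isL (D y) \<longleftrightarrow> isL y" "\<And>y. deg (D y) = deg y + p"
  shows "N r p D f (xs @ as) =
    (\<Sum>k<length xs. deal deg (\<lambda>u v. if length v = r
       then sg (p * degs u) * f (u @ NL D (v @ [xs ! k]) # drop (Suc k) xs @ as) else 0) (take k xs)) +
    deal deg (\<lambda>u v. if length v \<le> r
       then \<Sum>k<length as. if k + (Suc r - length v) \<le> length as
         then sg (p * degs u + (degs v + p) * degs (take k as)) * f (u @ take k as @
           NL D (v @ take (Suc r - length v) (drop k as)) # drop (k + (Suc r - length v)) as) else 0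
       else 0) xs"
proof -
  have step: "sg (p * degs u) * (if v = [] then N r p D (\<lambda>t. f (u @ t)) as
          else E (Suc r - length v) (NL D v) (\<lambda>t. f (u @ t)) as) =
    (\<Sum>k<length as. if k + (Suc r - length v) \<le> length as
         then sg (p * degs u + (degs v + p) * degs (take k as)) * f (u @ take k as @
           NL D (v @ take (Suc r - length v) (drop k as)) # drop (k + (Suc r - length v)) as) else 0)"
    if "length v \<le> r" "set v \<subseteq> set xs" for u v
  proof (cases v)
    case Nil
    then show ?thesis
      using assms by (simp add: N_letters_A sum_distrib_left sg_add mult.assoc if_distrib cong: if_cong)
  next
    case (Cons y v')
    have "isL (NL D v)" "deg (NL D v) = degs v + p"
      using assms(1) D Cons that by (auto simp: NL_def)
    moreover have "Suc r - length v = Suc (r - length v)" using that by simp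
    moreover have "NL D (v @ t) = foldl br (NL D v) t" for t using Cons by (simp add: NL_def)
    ultimately show ?thesis
      using assms(2) Cons by (simp add: E_letters_L sum_distrib_left sg_add mult.assoc if_distrib cong: if_cong)
  qed
  show ?thesis
    unfolding N_split_aux[of xs D p, OF assms(1) D]
    by (intro arg_cong2[of _ _ _ _ "(+)"] refl deal_cong, rule if_cong[OF refl], rule step) auto
qed

lemma Dl_split:
  assumes "\<forall>x\<in>set xs. isL x" "\<forall>a\<in>set as. \<not> isL a" "as \<noteq> []"
  shows "Dl f (xs @ as) = deal deg (\<lambda>u v. \<Sum>k<length as.
    sg (degs v * degs (take k as)) * f (u @ take k as) (v @ drop k as)) xs"
  using assms(1)
proof (induction xs arbitrary: f)
  case Nil
  have "Dl f as = (\<Sum>k<length as. f (take k as) (drop k as))" for f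
    using assms(2)
  proof (induction as arbitrary: f)
    case (Cons a as)
    then show ?case
      unfolding length_Cons sum.lessThan_Suc_shift by simp
  qed simp
  then show ?case by simp
next
  case (Cons y xs)
  have "sg (degs v * degs (take k as)) * (f (y # u @ take k as) (v @ drop k as) +
      sg (deg y * degs (u @ take k as)) * f (u @ take k as) (y # v @ drop k as)) =
    sg (degs v * degs (take k as)) * f (y # u @ take k as) (v @ drop k as) +
    sg (deg y * degs u) * (sg (degs (y # v) * degs (take k as)) * f (u @ take k as) (y # v @ drop k as))" for u v k
    by (simp add: sg_simps algebra_simps)
  then show ?case
    using Cons assms(3) by (simp add: deal_add sum.distrib sum_distrib_left degs_def[symmetric])
qed

text \<open>At the last letter of a word over L, \<open>Dl\<close> admits only the empty left
  factor. This keeps \<open>x\<close> at the end of the right factor, as in the coproduct for Loday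
  algebras.\<close>

lemma Dl_split_last:
  assumes "\<forall>x\<in>set xs. isL x" "isL x"
  shows "Dl f (xs @ [x]) = deal deg (\<lambda>u v. f u (v @ [x])) xs"
  using assms(1)
  by (induction xs arbitrary: f) (auto simp: deal_add degs_def assms(2))

end

text \<open>In the coderivation of a map with values in L the unshuffle permutes only the letters in
  front of the last entry, a prefix of the word.\<close>

lemma unshuffle_sum_take:
  assumes "p + q \<le> length xs"
  shows "(\<Sum>\<sigma>\<in>unshuffles p q. sg (koszul (map d xs) (p + q) \<sigma>) *
      h (pick xs \<sigma> 0 p) (pick xs \<sigma> p (p + q))) =
    deal d (\<lambda>u v. if length u = p then h u v else 0) (take (p + q) xs)"
proof -
  have "koszul (map d (take (p + q) xs)) (p + q) \<sigma> = koszul (map d xs) (p + q) \<sigma>"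
    "pick (take (p + q) xs) \<sigma> 0 p = pick xs \<sigma> 0 p"
    "pick (take (p + q) xs) \<sigma> p (p + q) = pick xs \<sigma> p (p + q)" if "\<sigma> \<in> unshuffles p q" for \<sigma>
  proof -
    have "\<sigma> r < p + q" if "r < p + q" for r
      using \<open>\<sigma> \<in> unshuffles p q\<close> that permutes_in_image[of \<sigma> "{..<p + q}" r]
      by (simp add: unshuffles_def)
    moreover from this have "\<sigma> r < length xs" if "r < p + q" for r
      using assms that by (meson less_le_trans)
    ultimately show "koszul (map d (take (p + q) xs)) (p + q) \<sigma> = koszul (map d xs) (p + q) \<sigma>"
      "pick (take (p + q) xs) \<sigma> 0 p = pick xs \<sigma> 0 p"
      "pick (take (p + q) xs) \<sigma> p (p + q) = pick xs \<sigma> p (p + q)"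
      using assms by (auto simp: koszul_def pick_def intro!: sum.cong)
  qed
  then show ?thesis
    using unshuffle_sum[of "take (p + q) xs" p q d h] assms by simp
qed

section \<open>Functionals on free spaces\<close>

lemma lookup_fscl: "Poly_Mapping.lookup (fscl c u) w = c * Poly_Mapping.lookup u w"
  by (simp add: fscl_def map.rep_eq when_def)

global_interpretation free: vector_space fscl
  by standard (auto intro!: poly_mapping_eqI simp: lookup_fscl lookup_add algebra_simps)

lemma poly_mapping_eq_sum: "u = (\<Sum>w\<in>Poly_Mapping.keys u. fscl (Poly_Mapping.lookup u w) (wd w))"
  by (rule poly_mapping_eqI)
    (auto simp: lookup_sum lookup_fscl lookup_single when_def in_keys_iff sum.delta' if_distrib cong: if_cong)

abbreviation functional :: "(('w \<Rightarrow>\<^sub>0 'k::field) \<Rightarrow> 'k) \<Rightarrow> bool" where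
  "functional \<equiv> Vector_Spaces.linear fscl (*)"

abbreviation endo :: "(('w \<Rightarrow>\<^sub>0 'k::field) \<Rightarrow> ('z \<Rightarrow>\<^sub>0 'k)) \<Rightarrow> bool" where
  "endo \<equiv> Vector_Spaces.linear fscl fscl"

lemma functionalI:
  "(\<And>u v. \<phi> (u + v) = \<phi> u + \<phi> v) \<Longrightarrow> (\<And>c u. \<phi> (fscl c u) = c * \<phi> u) \<Longrightarrow> functional \<phi>"
  by unfold_locales (auto simp: algebra_simps)

lemma endoI:
  "(\<And>u v. F (u + v) = F u + F v) \<Longrightarrow> (\<And>c u. F (fscl c u) = fscl c (F u)) \<Longrightarrow> endo F"
  by unfold_locales auto

lemma functional_simps:
  assumes "functional \<phi>"
  shows "\<phi> (u + v) = \<phi> u + \<phi> v" "\<phi> (u - v) = \<phi> u - \<phi> v" "\<phi> (- u) = - \<phi> u" "\<phi> 0 = 0"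
    "\<phi> (fscl c u) = c * \<phi> u" "\<phi> (sum g S) = (\<Sum>s\<in>S. \<phi> (g s))" "\<phi> (psign n u) = sg n * \<phi> u"
proof -
  interpret Vector_Spaces.linear fscl "(*)" \<phi> by fact
  show "\<phi> (u + v) = \<phi> u + \<phi> v" "\<phi> (u - v) = \<phi> u - \<phi> v" "\<phi> (- u) = - \<phi> u" "\<phi> 0 = 0"
    "\<phi> (fscl c u) = c * \<phi> u" "\<phi> (sum g S) = (\<Sum>s\<in>S. \<phi> (g s))"
    by (rule add diff neg zero scale sum)+
  then show "\<phi> (psign n u) = sg n * \<phi> u" by (simp add: psign_def sg_def)
qed

lemma endo_simps:
  assumes "endo F"
  shows "F (u + v) = F u + F v" "F (u - v) = F u - F v" "F 0 = 0"
    "F (fscl c u) = fscl c (F u)" "F (sum g S) = (\<Sum>s\<in>S. F (g s))"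
proof -
  interpret Vector_Spaces.linear fscl fscl F by fact
  show "F (u + v) = F u + F v" "F (u - v) = F u - F v" "F 0 = 0"
    "F (fscl c u) = fscl c (F u)" "F (sum g S) = (\<Sum>s\<in>S. F (g s))"
    by (rule add diff zero scale sum)+
qed

lemma functional_comp: "functional \<phi> \<Longrightarrow> endo F \<Longrightarrow> functional (\<lambda>u. \<phi> (F u))"
  by (rule functionalI) (simp_all add: functional_simps endo_simps)

lemma lin_ext_superset:
  "finite S \<Longrightarrow> Poly_Mapping.keys u \<subseteq> S \<Longrightarrow> lin_ext f u = (\<Sum>w\<in>S. fscl (Poly_Mapping.lookup u w) (f w))"
  unfolding lin_ext_def by (rule sum.mono_neutral_left) (auto simp: in_keys_iff)

lemma endo_lin_ext:
  fixes f :: "'w \<Rightarrow> ('z \<Rightarrow>\<^sub>0 'k::field)"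
  shows "endo (lin_ext f)"
proof (rule endoI)
  fix u v :: "'w \<Rightarrow>\<^sub>0 'k" and c
  let ?S = "Poly_Mapping.keys u \<union> Poly_Mapping.keys v"
  show "lin_ext f (u + v) = lin_ext f u + lin_ext f v"
    using keys_add[of u v]
    by (simp add: lin_ext_superset[of ?S] lookup_add free.scale_left_distrib sum.distrib)
  have "Poly_Mapping.keys (fscl c u) \<subseteq> Poly_Mapping.keys u"
    by (auto simp: in_keys_iff lookup_fscl)
  then show "lin_ext f (fscl c u) = fscl c (lin_ext f u)"
    by (simp add: lin_ext_superset[of "Poly_Mapping.keys u"] lookup_fscl free.scale_sum_right)
qed

lemma lin_ext_wd [simp]: "lin_ext f (wd w) = f w"
  by (simp add: lin_ext_def)

lemma endo_lin_ext_eq: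
  assumes "endo F"
  shows "F u = lin_ext (\<lambda>w. F (wd w)) u"
  by (subst poly_mapping_eq_sum[of u]) (simp add: lin_ext_def endo_simps[OF assms])

lemma ftensor_wd [simp]: "ftensor (wd v) (wd w) = wd (v, w)"
  by (simp add: ftensor_def)

lemma endo_ftensor_left: "endo (\<lambda>u. ftensor u v)"
  unfolding ftensor_def by (rule endo_lin_ext)

lemma endo_ftensor_right: "endo (ftensor (wd v))"
  unfolding ftensor_def by (simp add: endo_lin_ext)

text \<open>Vectors of a quotient space are told apart by functionals.\<close>

lemma in_span_if_functionals:
  fixes u :: "'w \<Rightarrow>\<^sub>0 'k::field"
  assumes "\<And>\<phi>. functional \<phi> \<Longrightarrow> (\<And>s. s \<in> S \<Longrightarrow> \<phi> s = 0) \<Longrightarrow> \<phi> u = 0"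
  shows "u \<in> fspan S"
proof (rule ccontr)
  assume u: "u \<notin> fspan S"
  interpret P: vector_space_pair fscl "(*) :: 'k \<Rightarrow> 'k \<Rightarrow> 'k"
    by unfold_locales (auto simp: algebra_simps)
  obtain B where B: "B \<subseteq> fspan S" "free.independent B" "free.span B = fspan S"
    using free.basis_exists[of "fspan S"] free.span_subspace[OF _ _ free.subspace_span] by metis
  then have "free.independent (insert u B)" using u by (simp add: free.independent_insertI)
  \<comment> \<open>A vector outside the span extends a basis B of the span to an independent set,
    so a functional may be prescribed as 1 at u and 0 on B.\<close>
  then obtain \<phi> where \<phi>: "functional \<phi>" "\<forall>x\<in>insert u B. \<phi> x = (if x = u then 1 else 0)"
    using P.linear_independent_extend[of "insert u B" "\<lambda>x. if x = u then 1 else 0"] by auto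
  have "\<phi> s = 0" if "s \<in> S" for s
  proof -
    have "s \<in> free.span B" using B(3) that free.span_base by blast
    then show ?thesis
    proof (induction rule: free.span_induct_alt)
      case (step c x y)
      then have "x \<noteq> u" using B(1) u by auto
      then show ?case using step \<phi> by (auto simp: functional_simps)
    qed (simp add: functional_simps[OF \<phi>(1)])
  qed
  then have "\<phi> u = 0" using assms \<phi>(1) by blast
  then show False using \<phi>(2) by simp
qed

lemma functional_span_0:
  assumes "functional \<phi>" "\<And>s. s \<in> S \<Longrightarrow> \<phi> s = 0" "u \<in> fspan S"
  shows "\<phi> u = 0"
  using assms(3)
  by (induction rule: free.span_induct_alt) (auto simp: functional_simps[OF assms(1)] assms(2))

text \<open>\<open>enc\<close> labels the letters of a word with degrees and \<open>unl\<close> forgets the labels. As \<open>hdeg\<close> is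
  arbitrary at \<open>0\<close> and degrees may be read modulo 2, a labelled word agrees with
  the encoding of its underlying word only up to the parities of the labels, and only if no letter
  is \<open>0\<close>.\<close>

locale word_model = loday_letters deg isL br ok lc
  for deg :: "'v \<Rightarrow> int" and isL br ok and lc :: "'k::field \<Rightarrow> 'v \<Rightarrow> 'k \<Rightarrow> 'v \<Rightarrow> 'v \<Rightarrow> bool" +
  fixes W :: "'w set" and R0 :: "('w \<Rightarrow>\<^sub>0 'k) set"
    and enc :: "'w \<Rightarrow> 'v list" and unl :: "'v list \<Rightarrow> 'w" and rel :: "'v \<Rightarrow> 'v \<Rightarrow> bool"
  assumes unl_enc: "w \<in> W \<Longrightarrow> unl (enc w) = w"
    and enc: "w \<in> W \<Longrightarrow> set (enc w) \<subseteq> ok \<and> shape (enc w) \<and> enc w \<noteq> []"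
    and unl: "set v \<subseteq> ok \<Longrightarrow> shape v \<Longrightarrow> v \<noteq> [] \<Longrightarrow> unl v \<in> W"
    and R0E: "s \<in> R0 \<Longrightarrow> \<exists>us vs a x b y z. set us \<subseteq> ok \<and> set vs \<subseteq> ok \<and> shape (us @ z # vs) \<and> lc a x b y z \<and>
        s = wd (unl (us @ z # vs)) - fscl a (wd (unl (us @ x # vs))) - fscl b (wd (unl (us @ y # vs)))"
    and R0I: "set us \<subseteq> ok \<Longrightarrow> set vs \<subseteq> ok \<Longrightarrow> lc a x b y z \<Longrightarrow>
        wd (unl (us @ z # vs)) - fscl a (wd (unl (us @ x # vs))) - fscl b (wd (unl (us @ y # vs))) \<in> R0"
    and rel: "rel x y \<Longrightarrow> (even (deg x) \<longleftrightarrow> even (deg y)) \<and> (isL x \<longleftrightarrow> isL y)"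
    and rel_br: "rel x x' \<Longrightarrow> rel y y' \<Longrightarrow> rel (br x y) (br x' y')"
    and rel_unl: "list_all2 rel v v' \<Longrightarrow> unl v = unl v'"
    and rel_or_0: "set v \<subseteq> ok \<Longrightarrow> shape v \<Longrightarrow> v \<noteq> [] \<Longrightarrow> list_all2 rel v (enc (unl v)) \<or>
        (\<exists>z\<in>set v. lc 0 z 0 z z) \<and> (\<exists>z\<in>set (enc (unl v)). lc 0 z 0 z z)"
begin

lemma sg_rel: "rel x x' \<Longrightarrow> rel y y' \<Longrightarrow> sg (deg x * deg y) = (sg (deg x' * deg y') :: 'k)"
  by (auto simp: sg_def dest!: rel)

lemma E_rel:
  fixes f g :: "'v list \<Rightarrow> 'k"
  assumes "rel z z'" "list_all2 rel v v'" "\<And>u u'. list_all2 rel u u' \<Longrightarrow> f u = g u'"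
  shows "E r z f v = E r z' g v'"
  using assms(2,1,3)
proof (induction arbitrary: r z z' f g rule: list_all2_induct)
  case Nil
  then show ?case by (cases r) auto
next
  case (Cons y w y' w')
  show ?case
  proof (cases r)
    case 0
    then show ?thesis using Cons by auto
  next
    case (Suc s)
    have "E s (br z y) f w = E s (br z' y') g w'"
      using Cons by (intro Cons.IH rel_br) auto
    moreover have "E (Suc s) z (\<lambda>u. f (y # u)) w = E (Suc s) z' (\<lambda>u. g (y' # u)) w'"
      using Cons by (intro Cons.IH) auto
    ultimately show ?thesis
      using Suc rel[OF Cons.prems(1)] sg_rel[OF Cons.prems(1) Cons.hyps(1)] by simp
  qed
qed

lemma N_rel:
  fixes f g :: "'v list \<Rightarrow> 'k"
  assumes "list_all2 rel v v'" "\<And>u u'. list_all2 rel u u' \<Longrightarrow> f u = g u'"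
    and D: "\<And>x y. rel x y \<Longrightarrow> rel (D x) (D y)"
  shows "N r p D f v = N r p D g v'"
  using assms(1,2)
proof (induction arbitrary: f g rule: list_all2_induct)
  case (Cons y w y' w')
  have "sg (p * deg y) = (sg (p * deg y') :: 'k)"
    using rel[OF Cons.hyps(1)] by (simp add: sg_def)
  moreover have "E r (D y) f w = E r (D y') g w'"
    using Cons by (intro E_rel D) auto
  moreover have "N r p D (\<lambda>u. f (y # u)) w = N r p D (\<lambda>u. g (y' # u)) w'"
    using Cons by (intro Cons.IH) auto
  ultimately show ?case by simp
qed simp

lemma total_rel:
  fixes f g :: "'v list \<Rightarrow> 'k"
  assumes "list_all2 rel v v'" "\<And>u u'. list_all2 rel u u' \<Longrightarrow> f u = g u'"
    and "\<And>r x y. rel x y \<Longrightarrow> rel (D r x) (D r y)"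
  shows "total I D f v = total I D g v'"
  unfolding total_def list_all2_lengthD[OF assms(1)]
  by (intro sum.cong N_rel assms) auto

lemma Dl_rel:
  fixes f :: "'v list \<Rightarrow> 'v list \<Rightarrow> 'k"
  assumes "list_all2 rel v v'"
    and "\<And>u u' w w'. list_all2 rel u u' \<Longrightarrow> list_all2 rel w w' \<Longrightarrow> f u w = g u' w'"
  shows "Dl f v = Dl g v'"
  using assms
proof (induction arbitrary: f g rule: list_all2_induct)
  case (Cons y w y' w')
  have eq: "f (y # u) v + sg (deg y * degs u) * f u (y # v) = g (y' # u') v' + sg (deg y' * degs u') * g u' (y' # v')"
    if "list_all2 rel u u'" "list_all2 rel v v'" for u u' v v'
  proof -
    have "even (degs u) \<longleftrightarrow> even (degs u')"
      using that(1) by (induction rule: list_all2_induct) (auto dest: rel)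
    then have "sg (deg y * degs u) = (sg (deg y' * degs u') :: 'k)"
      using rel[OF Cons.hyps(1)] by (simp add: sg_def)
    moreover have "f (y # u) v = g (y' # u') v'" "f u (y # v) = g u' (y' # v')"
      using that Cons.hyps by (auto intro!: Cons.prems)
    ultimately show ?thesis by simp
  qed
  have "w = [] \<longleftrightarrow> w' = []" using Cons by auto
  moreover have "Dl (\<lambda>u v. f (y # u) v + sg (deg y * degs u) * f u (y # v)) w
      = Dl (\<lambda>u v. g (y' # u) v + sg (deg y' * degs u) * g u (y' # v)) w'"
    by (rule Cons.IH) (rule eq)
  moreover have "Dl (\<lambda>u v. f (y # u) v) w = Dl (\<lambda>u v. g (y' # u) v) w'"
    by (rule Cons.IH) (use Cons in auto)
  moreover have "f [] (y # w) = g [] (y' # w')" "f [] [y] = g [] [y']"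
    using Cons by auto
  ultimately show ?case using rel[OF Cons.hyps(1)] by auto
qed simp

text \<open>Functionals on the quotient by the relations are multilinear functions of labelled
  words; this is the bridge to the operators on functions.\<close>

lemma mlin_functional:
  assumes "functional \<phi>" "\<And>s. s \<in> R0 \<Longrightarrow> \<phi> s = 0"
  shows "mlin (\<lambda>v. \<phi> (wd (unl v)))"
  unfolding mlin_def
proof (intro allI impI, elim conjE)
  fix us vs a x b y z assume "set us \<subseteq> ok" "set vs \<subseteq> ok" "lc a x b y z"
  from assms(2)[OF R0I[OF this]]
  show "\<phi> (wd (unl (us @ z # vs))) = a * \<phi> (wd (unl (us @ x # vs))) + b * \<phi> (wd (unl (us @ y # vs)))"
    by (simp add: functional_simps[OF assms(1)] algebra_simps)
qed

context
  fixes I :: "nat set" and D :: "nat \<Rightarrow> 'v \<Rightarrow> 'v" and F :: "('w \<Rightarrow>\<^sub>0 'k) \<Rightarrow> ('w \<Rightarrow>\<^sub>0 'k)"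
  assumes der: "\<And>r. der 1 (D r)" and rel_D: "\<And>r x y. rel x y \<Longrightarrow> rel (D r x) (D r y)"
    and F: "endo F"
    and model: "\<And>\<phi> w. functional \<phi> \<Longrightarrow> w \<in> W \<Longrightarrow> \<phi> (F (wd w)) = total I D (\<lambda>v. \<phi> (wd (unl v))) (enc w)"
begin

text \<open>\<open>model\<close> speaks of encoded words, whereas the operators produce words with
  computed labels. If the labels have the same parities, both sides see the same signs; otherwise
  both words contain a zero letter and multilinearity makes both values vanish.\<close>

lemma model_word:
  assumes "functional \<phi>" "\<And>s. s \<in> R0 \<Longrightarrow> \<phi> s = 0" "set v \<subseteq> ok" "shape v" "v \<noteq> []"
  shows "\<phi> (F (wd (unl v))) = total I D (\<lambda>v. \<phi> (wd (unl v))) v"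
proof -
  let ?f = "\<lambda>v. \<phi> (wd (unl v))"
  have zero: "total I D ?f v = 0" if z: "z \<in> set v" "lc 0 z 0 z z" and v: "set v \<subseteq> ok" "shape v" for z v
  proof -
    obtain us vs where "v = us @ z # vs" using split_list[OF z(1)] by blast
    then show ?thesis
      using total_lin_word[OF der mlin_functional[OF assms(1,2)], of us vs z 0 z 0 z I] z v by simp
  qed
  have W: "unl v \<in> W" using assms(3-5) by (rule unl)
  have "total I D ?f (enc (unl v)) = total I D ?f v"
    using rel_or_0[OF assms(3-5)]
  proof
    assume "list_all2 rel v (enc (unl v))"
    then show ?thesis
      by (intro total_rel[symmetric] rel_D) (auto dest: rel_unl)
  next
    assume "(\<exists>z\<in>set v. lc 0 z 0 z z) \<and> (\<exists>z\<in>set (enc (unl v)). lc 0 z 0 z z)"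
    then obtain z z' where "z \<in> set v" "lc 0 z 0 z z" "z' \<in> set (enc (unl v))" "lc 0 z' 0 z' z'" by blast
    then have "total I D ?f v = 0" "total I D ?f (enc (unl v)) = 0"
      using zero[of z v] zero[of z' "enc (unl v)"] assms(3,4) enc[OF W] by simp_all
    then show ?thesis by simp
  qed
  then show ?thesis using model[OF assms(1) W] by simp
qed

lemma endomorphism: "endomorphism W (fspan R0) F"
proof -
  have "F u \<in> fspan (wd ` W)" if "u \<in> fspan (wd ` W)" for u :: "'w \<Rightarrow>\<^sub>0 'k"
  proof (rule in_span_if_functionals)
    fix \<phi> :: "('w \<Rightarrow>\<^sub>0 'k) \<Rightarrow> 'k" assume \<phi>: "functional \<phi>" "\<And>s. s \<in> wd ` W \<Longrightarrow> \<phi> s = 0"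
    have "\<phi> (F (wd w)) = 0" if "w \<in> W" for w
    proof -
      have "total I D (\<lambda>v. \<phi> (wd (unl v))) (enc w) = total I D (\<lambda>v. 0) (enc w)"
        using enc[OF that] by (intro total_cong der) (auto simp: reaches_def unl \<phi>(2))
      then show ?thesis using model[OF \<phi>(1) that] by (simp add: total_def)
    qed
    then show "\<phi> (F u) = 0"
      using functional_span_0[OF functional_comp[OF \<phi>(1) F] _ that] by auto
  qed
  moreover have "F u \<in> fspan R0" if "u \<in> fspan R0" for u :: "'w \<Rightarrow>\<^sub>0 'k"
  proof (rule in_span_if_functionals)
    fix \<phi> :: "('w \<Rightarrow>\<^sub>0 'k) \<Rightarrow> 'k" assume \<phi>: "functional \<phi>" "\<And>s. s \<in> R0 \<Longrightarrow> \<phi> s = 0"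
    have "\<phi> (F s) = 0" if sR: "s \<in> R0" for s
    proof -
      obtain us vs a x b y z where s: "set us \<subseteq> ok" "set vs \<subseteq> ok" "shape (us @ z # vs)" "lc a x b y z"
        "s = wd (unl (us @ z # vs)) - fscl a (wd (unl (us @ x # vs))) - fscl b (wd (unl (us @ y # vs)))"
        using R0E[OF sR] by blast
      have "isL x \<longleftrightarrow> isL z" "isL y \<longleftrightarrow> isL z" "x \<in> ok" "y \<in> ok" "z \<in> ok"
        using lcD[OF s(4)] by auto
      moreover from this have "shape (us @ x # vs)" "shape (us @ y # vs)"
        using s(3) by (auto simp: shape_def sorted_wrt_append)
      ultimately show ?thesis
        using total_lin_word[OF der mlin_functional[OF \<phi>] s(1-4), of I] s
        by (simp add: functional_simps[OF \<phi>(1)] endo_simps[OF F] model_word[OF \<phi>])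
    qed
    then show "\<phi> (F u) = 0"
      using functional_span_0[OF functional_comp[OF \<phi>(1) F] _ that] by auto
  qed
  ultimately show ?thesis using F by (auto simp: endomorphism_def)
qed

lemma square_zero:
  assumes "I = UNIV" and "(2::'k) \<noteq> 0"
    and "\<And>n m y. y \<in> ok \<Longrightarrow> m \<le> n \<Longrightarrow> lc 1 (S n m y) 1 (D m (D (n - m) y)) (S n (Suc m) y)"
    and "\<And>n y. y \<in> ok \<Longrightarrow> lc 0 (S n 0 y) 0 (S n 0 y) (S n 0 y)"
    and "\<And>n y. y \<in> ok \<Longrightarrow> lc 0 (S n (Suc n) y) 0 (S n (Suc n) y) (S n (Suc n) y)"
  shows "square_zero W (fspan R0) F"
  unfolding square_zero_def
proof (intro ballI in_span_if_functionals)
  fix u :: "'w \<Rightarrow>\<^sub>0 'k" and \<phi> :: "('w \<Rightarrow>\<^sub>0 'k) \<Rightarrow> 'k" assume u: "u \<in> fspan (wd ` W)" and \<phi>: "functional \<phi>" "\<And>s. s \<in> R0 \<Longrightarrow> \<phi> s = 0"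
  let ?f = "\<lambda>v. \<phi> (wd (unl v))"
  have "\<phi> (F (F (wd w))) = 0" if "w \<in> W" for w
  proof -
    have "\<phi> (F (F (wd w))) = total I D (\<lambda>v. \<phi> (F (wd (unl v)))) (enc w)"
      using model[OF functional_comp[OF \<phi>(1) F] that] .
    \<comment> \<open>The intermediate words carry the degrees computed by the operator and not the
      choice made by \<open>enc\<close>, hence \<open>model_word\<close>.\<close>
    also have "\<dots> = total I D (total I D ?f) (enc w)"
      using enc[OF that] by (intro total_cong der model_word[OF \<phi>]) (auto simp: reaches_def)
    also have "\<dots> = 0"
      unfolding \<open>I = UNIV\<close> using enc[OF that] assms(2-)
      by (intro total_op_eq_0[of D _ _ S] der mlin_functional[OF \<phi>]) auto
    finally show ?thesis .
  qed
  then show "\<phi> (F (F u)) = 0"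
    using functional_span_0[OF functional_comp[OF functional_comp[OF \<phi>(1) F] F] _ u] by auto
qed

end

end

section \<open>Words with labelled letters\<close>

text \<open>The brackets of a letter from \<open>A\<close> with a letter from \<open>L\<close> are junk; they do not occur, because in
  all words the letters from \<open>L\<close> come first.\<close>

definition letter_br ::
    "('l \<Rightarrow> 'l \<Rightarrow> 'l) \<Rightarrow> ('l \<Rightarrow> 'a \<Rightarrow> 'a) \<Rightarrow> ('a \<Rightarrow> 'a \<Rightarrow> 'a) \<Rightarrow>
     int \<times> ('l + 'a::zero) \<Rightarrow> int \<times> ('l + 'a) \<Rightarrow> int \<times> ('l + 'a)" where
  "letter_br bLL bLA bAA y z = (fst y + fst z,
     case (snd y, snd z) of
       (Inl x, Inl x') \<Rightarrow> Inl (bLL x x') | (Inl x, Inr a) \<Rightarrow> Inr (bLA x a)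
     | (Inr a, Inl x) \<Rightarrow> Inr 0 | (Inr a, Inr b) \<Rightarrow> Inr (bAA a b))"

definition letter_map :: "('l \<Rightarrow> 'l) \<Rightarrow> ('a \<Rightarrow> 'a) \<Rightarrow> int \<times> ('l + 'a) \<Rightarrow> int \<times> ('l + 'a)" where
  "letter_map DL DA y = (fst y + 1, map_sum DL DA (snd y))"

text \<open>Filtering makes this total and compatible with concatenation; on words whose letters of
  L come first it just splits the word.\<close>

definition unlabel :: "(int \<times> ('l + 'a)) list \<Rightarrow> 'l list \<times> 'a list" where
  "unlabel w = (map (projl \<circ> snd) (filter (isl \<circ> snd) w), map (projr \<circ> snd) (filter (Not \<circ> isl \<circ> snd) w))"

definition labelL :: "('k, 'l) gspace \<Rightarrow> 'l list \<Rightarrow> (int \<times> ('l + 'a)) list" where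
  "labelL L = map (\<lambda>x. (hdeg L x, Inl x))"

definition labelA :: "('k, 'a) gspace \<Rightarrow> 'a list \<Rightarrow> (int \<times> ('l + 'a)) list" where
  "labelA A = map (\<lambda>a. (hdeg A a, Inr a))"

definition label :: "('k, 'l) gspace \<Rightarrow> ('k, 'a) gspace \<Rightarrow> 'l list \<times> 'a list \<Rightarrow> (int \<times> ('l + 'a)) list" where
  "label L A w = labelL L (fst w) @ labelA A (snd w)"

lemma unlabel_append: "unlabel (u @ v) = (fst (unlabel u) @ fst (unlabel v), snd (unlabel u) @ snd (unlabel v))"
  by (simp add: unlabel_def)

lemma unlabel_Cons: "unlabel (y # v) = (case snd y of Inl x \<Rightarrow> (x # fst (unlabel v), snd (unlabel v))
    | Inr a \<Rightarrow> (fst (unlabel v), a # snd (unlabel v)))"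
  by (simp add: unlabel_def split: sum.splits)

lemma unlabel_Nil [simp]: "unlabel [] = ([], [])"
  by (simp add: unlabel_def)

lemma unlabel_labelL [simp]: "unlabel (labelL L xs) = (xs, [])"
  by (induction xs) (auto simp: labelL_def unlabel_Cons)

lemma unlabel_labelA [simp]: "unlabel (labelA A as) = ([], as)"
  by (induction as) (auto simp: labelA_def unlabel_Cons)

lemma unlabel_label [simp]: "unlabel (label L A w) = w"
  by (simp add: label_def unlabel_append)

lemma label_simps [simp]:
  "length (labelL L xs) = length xs" "length (labelA A as) = length as"
  "take k (labelL L xs) = labelL L (take k xs)" "drop k (labelL L xs) = labelL L (drop k xs)"
  "take k (labelA A as) = labelA A (take k as)" "drop k (labelA A as) = labelA A (drop k as)"
  "labelL L xs = [] \<longleftrightarrow> xs = []" "labelA A as = [] \<longleftrightarrow> as = []"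
  "labelL L (xs @ ys) = labelL L xs @ labelL L ys" "labelA A (as @ bs) = labelA A as @ labelA A bs"
  "labelL L [] = []" "labelA A [] = []"
  "labelL L [x] = [(hdeg L x, Inl x)]" "labelA A [a] = [(hdeg A a, Inr a)]"
  by (simp_all add: labelL_def labelA_def take_map drop_map)

lemma labelL_nth: "k < length xs \<Longrightarrow> labelL L xs ! k = (hdeg L (xs ! k), Inl (xs ! k))"
  by (simp add: labelL_def)

lemma isl_label: "y \<in> set (labelL L xs) \<Longrightarrow> isl (snd y)" "y \<in> set (labelA A as) \<Longrightarrow> \<not> isl (snd y)"
  by (auto simp: labelL_def labelA_def)

section \<open>Functionals applied to the coderivation formulas\<close>

lemma coder_L_word_functional:
  fixes \<phi> :: "('l list \<Rightarrow>\<^sub>0 'k::field) \<Rightarrow> 'k"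
  assumes \<phi>: "functional \<phi>"
  shows "\<phi> (coder_L_word L p (Suc r) f xs) =
    (\<Sum>k<length xs. deal (hdeg L) (\<lambda>u v. if length v = r
      then sg (p * degsum L u) * \<phi> (wd (u @ f (v @ [xs ! k]) # drop (Suc k) xs)) else 0) (take k xs))"
    (is "_ = (\<Sum>k<_. ?S k)")
proof -
  have "\<phi> (coder_L_word L p (Suc r) f xs) =
    (\<Sum>k\<in>{Suc r..length xs}. \<Sum>\<sigma>\<in>unshuffles (k - Suc r) r.
        sg (koszul (map (hdeg L) xs) (k - 1) \<sigma>) * (sg (p * degsum L (pick xs \<sigma> 0 (k - Suc r))) *
          \<phi> (wd (pick xs \<sigma> 0 (k - Suc r) @ f (pick xs \<sigma> (k - Suc r) (k - 1) @ [xs ! (k - 1)]) # drop k xs))))"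
    by (simp add: coder_L_word_def functional_simps[OF \<phi>] sg_add mult.assoc)
  \<comment> \<open>From here on k counts from 0 and is the place of the last entry; in the formula
    it counts from 1.\<close>
  also have "\<dots> = (\<Sum>k\<in>{r..<length xs}. \<Sum>\<sigma>\<in>unshuffles (k - r) r.
        sg (koszul (map (hdeg L) xs) k \<sigma>) * (sg (p * degsum L (pick xs \<sigma> 0 (k - r))) *
          \<phi> (wd (pick xs \<sigma> 0 (k - r) @ f (pick xs \<sigma> (k - r) k @ [xs ! k]) # drop (Suc k) xs))))"
    by (rule sum.reindex_bij_witness[of _ Suc "\<lambda>k. k - 1"]) auto
  also have "\<dots> = (\<Sum>k\<in>{r..<length xs}. ?S k)"
  proof (intro sum.cong refl)
    fix k assume k: "k \<in> {r..<length xs}"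
    let ?h = "\<lambda>u v. sg (p * degsum L u) * \<phi> (wd (u @ f (v @ [xs ! k]) # drop (Suc k) xs))"
    have "(\<Sum>\<sigma>\<in>unshuffles (k - r) r. sg (koszul (map (hdeg L) xs) k \<sigma>) * ?h (pick xs \<sigma> 0 (k - r)) (pick xs \<sigma> (k - r) k))
      = deal (hdeg L) (\<lambda>u v. if length u = k - r then ?h u v else 0) (take k xs)"
      using unshuffle_sum_take[of "k - r" r xs "hdeg L" ?h] k by simp
    also have "\<dots> = ?S k"
      using k by (intro deal_cong) auto
    finally show "(\<Sum>\<sigma>\<in>unshuffles (k - r) r. sg (koszul (map (hdeg L) xs) k \<sigma>) * ?h (pick xs \<sigma> 0 (k - r)) (pick xs \<sigma> (k - r) k))
      = ?S k" .
  qed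
  \<comment> \<open>With fewer than r letters in front of place k, no list \<open>v\<close> has
    length r, so the added terms vanish.\<close>
  also have "\<dots> = (\<Sum>k<length xs. ?S k)"
  proof (rule sum.mono_neutral_left)
    show "\<forall>k\<in>{..<length xs} - {r..<length xs}. ?S k = 0"
    proof
      fix k assume "k \<in> {..<length xs} - {r..<length xs}"
      then have "?S k = deal (hdeg L) (\<lambda>u v. 0) (take k xs)"
        by (intro deal_cong) auto
      then show "?S k = 0" by simp
    qed
  qed auto
  finally show ?thesis .
qed

text \<open>A condition on \<open>length v\<close> replaces the fixed block sizes of the unshuffle,
  so that the formulas for different i can be gathered in one \<open>deal\<close>.\<close>

lemma coder_LA_A_word_functional:
  fixes \<phi> :: "('l list \<times> 'a list \<Rightarrow>\<^sub>0 'k::field) \<Rightarrow> 'k"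
  assumes \<phi>: "functional \<phi>" and "1 \<le> j"
  shows "\<phi> (coder_LA_A_word L A p i j f (xs, as)) =
    deal (hdeg L) (\<lambda>u v. if length v = i then \<Sum>k<length as. if k + j \<le> length as
      then sg (p * degsum L u + (degsum L v + p) * degsum A (take k as)) *
        \<phi> (wd (u, take k as @ f v (take j (drop k as)) # drop (k + j) as)) else 0 else 0) xs"
    (is "_ = deal _ (\<lambda>u v. if _ then \<Sum>k<_. if _ then ?h k u v else 0 else 0) xs")
proof (cases "i \<le> length xs \<and> j \<le> length as")
  case True
  have "\<phi> (coder_LA_A_word L A p i j f (xs, as)) =
    (\<Sum>k\<in>{0..length as - j}. \<Sum>\<sigma>\<in>unshuffles (length xs - i) i.
      sg (koszul (map (hdeg L) xs) (length xs) \<sigma>) *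
      ?h k (pick xs \<sigma> 0 (length xs - i)) (pick xs \<sigma> (length xs - i) (length xs)))"
    using True by (simp add: coder_LA_A_word_def functional_simps[OF \<phi>] Let_def sg_add distrib_left
        distrib_right mult_ac)
  also have "\<dots> = (\<Sum>k\<in>{0..length as - j}. deal (hdeg L) (\<lambda>u v. if length u = length xs - i then ?h k u v else 0) xs)"
  proof (intro sum.cong refl)
    fix k
    show "(\<Sum>\<sigma>\<in>unshuffles (length xs - i) i. sg (koszul (map (hdeg L) xs) (length xs) \<sigma>) *
      ?h k (pick xs \<sigma> 0 (length xs - i)) (pick xs \<sigma> (length xs - i) (length xs)))
      = deal (hdeg L) (\<lambda>u v. if length u = length xs - i then ?h k u v else 0) xs"
      using True unshuffle_sum_take[of "length xs - i" i xs "hdeg L" "?h k"] by simp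
  qed
  also have "\<dots> = (\<Sum>k\<in>{0..length as - j}. deal (hdeg L) (\<lambda>u v. if length v = i then ?h k u v else 0) xs)"
    using True by (intro sum.cong refl deal_cong) auto
  also have "\<dots> = deal (hdeg L) (\<lambda>u v. \<Sum>k\<in>{0..length as - j}. if length v = i then ?h k u v else 0) xs"
    by (simp add: deal_sum)
  also have "\<dots> = deal (hdeg L) (\<lambda>u v. if length v = i then \<Sum>k<length as. if k + j \<le> length as then ?h k u v else 0 else 0) xs"
  proof (intro deal_cong)
    fix u v
    \<comment> \<open>As j is at least 1, \<open>k + j \<le> length as\<close> already forces
      \<open>k < length as\<close>.\<close>
    have "(\<Sum>k\<in>{0..length as - j}. ?h k u v) = (\<Sum>k<length as. if k + j \<le> length as then ?h k u v else 0)"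
      using True \<open>1 \<le> j\<close> by (intro sum.mono_neutral_cong_left) auto
    then show "(\<Sum>k\<in>{0..length as - j}. if length v = i then ?h k u v else 0)
      = (if length v = i then \<Sum>k<length as. if k + j \<le> length as then ?h k u v else 0 else 0)"
      by simp
  qed
  finally show ?thesis .
next
  case False
  then have "deal (hdeg L) (\<lambda>u v. if length v = i then \<Sum>k<length as. if k + j \<le> length as then ?h k u v else 0 else 0) xs
    = deal (hdeg L) (\<lambda>u v. 0) xs"
    by (intro deal_cong) auto
  then show ?thesis
    using False by (auto simp: coder_LA_A_word_def functional_simps[OF \<phi>])
qed

lemma coder_A_word_functional:
  fixes \<phi> :: "('a list \<Rightarrow>\<^sub>0 'k::field) \<Rightarrow> 'k"
  assumes \<phi>: "functional \<phi>" and "1 \<le> j"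
  shows "\<phi> (coder_A_word A p j f as) = (\<Sum>k<length as. if k + j \<le> length as
      then sg (p * degsum A (take k as)) * \<phi> (wd (take k as @ f (take j (drop k as)) # drop (k + j) as)) else 0)"
proof (cases "j \<le> length as")
  case True
  then show ?thesis
    using \<open>1 \<le> j\<close> unfolding coder_A_word_def
    by (simp add: functional_simps[OF \<phi>]) (intro sum.mono_neutral_cong_left, auto)
next
  case False
  then show ?thesis by (auto simp: coder_A_word_def functional_simps[OF \<phi>])
qed

text \<open>Comparing the given formulas with \<open>N\<close> and \<open>Dl\<close> is sign
  combinatorics; the Loday identities come in with \<open>deformed_pair\<close>.\<close>

locale labelled_pair =
  fixes L :: "('k::field, 'l::ab_group_add) gspace" and A :: "('k, 'a::ab_group_add) gspace"
    and bLL :: "'l \<Rightarrow> 'l \<Rightarrow> 'l" and bLA :: "'l \<Rightarrow> 'a \<Rightarrow> 'a" and bAA :: "'a \<Rightarrow> 'a \<Rightarrow> 'a"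
begin

sublocale letters fst "\<lambda>y. isl (snd y)" "letter_br bLL bLA bAA"
  by unfold_locales (auto simp: letter_br_def split: sum.splits)

lemma degs_label [simp]: "degs (labelL L xs) = degsum L xs" "degs (labelA A as) = degsum A as"
  by (auto simp: degs_def labelL_def labelA_def comp_def)

lemma snd_foldl_labelL: "snd z = Inl x \<Longrightarrow>
    snd (foldl (letter_br bLL bLA bAA) z (labelL L v)) = Inl (foldl bLL x v)"
  by (induction v arbitrary: z x) (auto simp: labelL_def letter_br_def)

lemma snd_foldl_labelA: "snd z = Inr a \<Longrightarrow>
    snd (foldl (letter_br bLL bLA bAA) z (labelA A v)) = Inr (foldl bAA a v)"
  by (induction v arbitrary: z a) (auto simp: labelA_def letter_br_def)

lemma snd_NL_labelL: "v \<noteq> [] \<Longrightarrow> snd (NL (letter_map DL DA) (labelL L v)) = Inl (N_L bLL DL v)"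
  unfolding NL_def N_L_def
  by (cases v) (auto simp: labelL_def letter_map_def intro!: snd_foldl_labelL[unfolded labelL_def])

lemma snd_NL_label:
  assumes "as \<noteq> []"
  shows "snd (NL (letter_map DL DA) (labelL L v @ labelA A as)) = Inr (N_A bLL bLA bAA DL DA v as)"
proof (cases v)
  case Nil
  then show ?thesis
    using assms unfolding NL_def N_A_def
    by (cases as) (auto simp: labelA_def letter_map_def intro!: snd_foldl_labelA[unfolded labelA_def])
next
  case (Cons x v')
  obtain a as' where as: "as = a # as'" using assms by (cases as) auto
  have "NL (letter_map DL DA) (labelL L v @ labelA A as)
     = foldl (letter_br bLL bLA bAA) (letter_br bLL bLA bAA (NL (letter_map DL DA) (labelL L v)) (hdeg A a, Inr a)) (labelA A as')"
    using Cons as by (simp add: NL_def labelL_def labelA_def)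
  moreover have "snd (letter_br bLL bLA bAA (NL (letter_map DL DA) (labelL L v)) (hdeg A a, Inr a)) = Inr (bLA (N_L bLL DL v) a)"
    using snd_NL_labelL[of v DL DA] Cons by (simp add: letter_br_def)
  ultimately show ?thesis
    using snd_foldl_labelA Cons as by (simp add: N_A_def)
qed

lemma deal_labelL: "deal fst h (labelL L xs) = deal (hdeg L) (\<lambda>u v. h (labelL L u) (labelL L v)) xs"
  using deal_map[of fst h "\<lambda>x. (hdeg L x, Inl x)" xs] by (simp add: labelL_def comp_def)

lemma N_label:
  fixes f :: "(int \<times> ('l + 'a)) list \<Rightarrow> 'k"
  shows "N r 1 (letter_map DL DA) f (label L A (xs, as)) =
    (\<Sum>k<length xs. deal (hdeg L) (\<lambda>u v. if length v = r
       then sg (degsum L u) * f (labelL L u @ NL (letter_map DL DA) (labelL L (v @ [xs ! k])) #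
         label L A (drop (Suc k) xs, as)) else 0) (take k xs)) +
    deal (hdeg L) (\<lambda>u v. if length v \<le> r
       then \<Sum>k<length as. if k + (Suc r - length v) \<le> length as
         then sg (degsum L u + (degsum L v + 1) * degsum A (take k as)) * f (labelL L u @ labelA A (take k as) @
           NL (letter_map DL DA) (labelL L v @ labelA A (take (Suc r - length v) (drop k as))) #
           labelA A (drop (k + (Suc r - length v)) as)) else 0
       else 0) xs"
proof -
  have "N r 1 (letter_map DL DA) f (labelL L xs @ labelA A as) =
    (\<Sum>k<length xs. deal (hdeg L) (\<lambda>u v. if length v = r
       then sg (degsum L u) * f (labelL L u @ NL (letter_map DL DA) (labelL L v @ [labelL L xs ! k]) #
         label L A (drop (Suc k) xs, as)) else 0) (take k xs)) +
    deal (hdeg L) (\<lambda>u v. if length v \<le> r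
       then \<Sum>k<length as. if k + (Suc r - length v) \<le> length as
         then sg (degsum L u + (degsum L v + 1) * degsum A (take k as)) * f (labelL L u @ labelA A (take k as) @
           NL (letter_map DL DA) (labelL L v @ labelA A (take (Suc r - length v) (drop k as))) #
           labelA A (drop (k + (Suc r - length v)) as)) else 0
       else 0) xs"
    by (subst N_split)
      (auto simp: deal_labelL label_def letter_map_def isl_map_sum dest: isl_label cong: if_cong)
  also have "(\<Sum>k<length xs. deal (hdeg L) (\<lambda>u v. if length v = r
       then sg (degsum L u) * f (labelL L u @ NL (letter_map DL DA) (labelL L v @ [labelL L xs ! k]) #
         label L A (drop (Suc k) xs, as)) else 0) (take k xs)) =
    (\<Sum>k<length xs. deal (hdeg L) (\<lambda>u v. if length v = r
       then sg (degsum L u) * f (labelL L u @ NL (letter_map DL DA) (labelL L (v @ [xs ! k])) #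
         label L A (drop (Suc k) xs, as)) else 0) (take k xs))"
    by (intro sum.cong refl) (simp add: labelL_nth cong: if_cong)
  finally show ?thesis by (simp add: label_def)
qed

text \<open>The two parts of \<open>N_label\<close> are the two parts of the coderivation: brackets
  that end in L, and brackets that end in A, where \<open>length v\<close> singles out the component
  with that many entries from L.\<close>

lemma partial_k_functional:
  assumes \<phi>: "functional \<phi>"
  shows "\<phi> (partial_k L A bLL bLA bAA \<delta>L \<delta>A (Suc r) (wd w)) =
    N r 1 (letter_map (\<delta>L r) (\<delta>A r)) (\<lambda>v. \<phi> (wd (unlabel v))) (label L A w)"
proof (cases w)
  case (Pair xs as)
  let ?D = "letter_map (\<delta>L r) (\<delta>A r)"
  have \<phi>L: "functional (\<lambda>u. \<phi> (lin_ext (\<lambda>ys. wd (ys, as)) u))"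
    by (rule functional_comp[OF \<phi> endo_lin_ext])
  have "\<phi> (coder_LA_L_word L 1 (Suc r) (N_L bLL (\<delta>L r)) w) =
    (\<Sum>k<length xs. deal (hdeg L) (\<lambda>u v. if length v = r
       then sg (degsum L u) * \<phi> (wd (unlabel (labelL L u @ NL ?D (labelL L (v @ [xs ! k])) #
         label L A (drop (Suc k) xs, as)))) else 0) (take k xs))"
    unfolding Pair coder_LA_L_word_def prod.case coder_L_word_functional[OF \<phi>L]
    by (intro sum.cong refl deal_cong)
      (simp add: unlabel_append unlabel_Cons snd_NL_labelL del: label_simps(9))
  moreover have "\<phi> (\<Sum>(i, j) | i + j = Suc r \<and> 1 \<le> j.
        coder_LA_A_word L A 1 i j (N_A bLL bLA bAA (\<delta>L r) (\<delta>A r)) w) =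
    deal (hdeg L) (\<lambda>u v. if length v \<le> r
       then \<Sum>k<length as. if k + (Suc r - length v) \<le> length as
         then sg (degsum L u + (degsum L v + 1) * degsum A (take k as)) *
           \<phi> (wd (unlabel (labelL L u @ labelA A (take k as) @
             NL ?D (labelL L v @ labelA A (take (Suc r - length v) (drop k as))) #
             labelA A (drop (k + (Suc r - length v)) as)))) else 0
       else 0) xs" (is "_ = deal _ (\<lambda>u v. if _ then ?h u v else 0) _")
  proof -
    let ?g = "\<lambda>i u v. \<Sum>k<length as. if k + (Suc r - i) \<le> length as
      then sg (1 * degsum L u + (degsum L v + 1) * degsum A (take k as)) *
        \<phi> (wd (u, take k as @ N_A bLL bLA bAA (\<delta>L r) (\<delta>A r) v (take (Suc r - i) (drop k as)) #
          drop (k + (Suc r - i)) as)) else 0"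
    have "\<phi> (\<Sum>(i, j) | i + j = Suc r \<and> 1 \<le> j.
        coder_LA_A_word L A 1 i j (N_A bLL bLA bAA (\<delta>L r) (\<delta>A r)) w) =
      (\<Sum>(i, j) | i + j = Suc r \<and> 1 \<le> j.
        \<phi> (coder_LA_A_word L A 1 i j (N_A bLL bLA bAA (\<delta>L r) (\<delta>A r)) (xs, as)))"
      by (simp add: functional_simps[OF \<phi>] case_prod_unfold Pair)
    also have "\<dots> = (\<Sum>i\<le>r. deal (hdeg L) (\<lambda>u v. if length v = i then ?g i u v else 0) xs)"
    proof -
      \<comment> \<open>Here j = r + 1 - i, and j at least 1 means i at most r.\<close>
      have "{(i, j). i + j = Suc r \<and> 1 \<le> j} = (\<lambda>i. (i, Suc r - i)) ` {..r}"
        by (auto simp: image_iff)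
      then show ?thesis
        by (simp add: sum.reindex inj_on_def coder_LA_A_word_functional[OF \<phi>])
    qed
    also have "\<dots> = deal (hdeg L) (\<lambda>u v. \<Sum>i\<le>r. if length v = i then ?g i u v else 0) xs"
      by (rule deal_sum[symmetric])
    also have "\<dots> = deal (hdeg L) (\<lambda>u v. if length v \<le> r then ?h u v else 0) xs"
    proof (intro deal_cong)
      fix u v
      have "?g (length v) u v = ?h u v" if "length v \<le> r"
        using that by (intro sum.cong refl)
          (auto simp: unlabel_append unlabel_Cons snd_NL_label simp del: label_simps(5,6) label_simps(9,10))
      then show "(\<Sum>i\<le>r. if length v = i then ?g i u v else 0) = (if length v \<le> r then ?h u v else 0)"
        by (simp add: sum.delta')
    qed
    finally show ?thesis .
  qed
  ultimately show ?thesis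
    unfolding partial_k_def lin_ext_wd N_label[of r _ _ _ xs as, folded Pair]
    by (simp add: functional_simps[OF \<phi>])
qed

lemma coder_L_functional:
  assumes \<phi>: "functional \<phi>"
  shows "\<phi> (coder_L_word L 1 (Suc r) (N_L bLL DL) xs) =
    N r 1 (letter_map DL DA) (\<lambda>v. \<phi> (wd (fst (unlabel v)))) (labelL L xs)"
proof -
  have "\<phi> (coder_L_word L 1 (Suc r) (N_L bLL DL) xs) =
    (\<Sum>k<length xs. deal (hdeg L) (\<lambda>u v. if length v = r
       then sg (degsum L u) * \<phi> (wd (fst (unlabel (labelL L u @ NL (letter_map DL DA) (labelL L (v @ [xs ! k])) #
         label L A (drop (Suc k) xs, []))))) else 0) (take k xs))"
    unfolding coder_L_word_functional[OF \<phi>]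
    by (intro sum.cong refl deal_cong)
      (simp add: unlabel_append unlabel_Cons snd_NL_labelL del: label_simps(9))
  then show ?thesis
    using N_label[of r DL DA "\<lambda>v. \<phi> (wd (fst (unlabel v)))" xs "[]"]
    by (simp add: label_def cong: if_cong)
qed

lemma coder_A_functional:
  assumes \<phi>: "functional \<phi>"
  shows "\<phi> (coder_A_word A 1 (Suc r) (N_A bLL bLA bAA DL DA []) as) =
    N r 1 (letter_map DL DA) (\<lambda>v. \<phi> (wd (snd (unlabel v)))) (labelA A as)"
proof -
  have "NL (letter_map DL DA) (labelA A bs) = NL (letter_map DL DA) (labelL L [] @ labelA A bs)" for bs
    by simp
  then have "snd (NL (letter_map DL DA) (labelA A bs)) = Inr (N_A bLL bLA bAA DL DA [] bs)" if "bs \<noteq> []" for bs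
    using snd_NL_label[of bs DL DA "[]"] that by simp
  then show ?thesis
    unfolding coder_A_word_functional[OF \<phi>, of "Suc r", simplified]
    using N_label[of r DL DA "\<lambda>v. \<phi> (wd (snd (unlabel v)))" "[]" as]
    by (auto simp: label_def unlabel_append unlabel_Cons intro!: sum.cong)
qed

end

section \<open>Labelled letters of a deformed Loday pair\<close>

fun is_comb :: "('k, 'l::plus) gspace \<Rightarrow> ('k, 'a::plus) gspace \<Rightarrow> 'k \<Rightarrow> 'l + 'a \<Rightarrow> 'k \<Rightarrow> 'l + 'a \<Rightarrow> 'l + 'a \<Rightarrow> bool" where
  "is_comb L A a (Inl x) b (Inl y) (Inl z) \<longleftrightarrow> z = scl L a x + scl L b y"
| "is_comb L A a (Inr x) b (Inr y) (Inr z) \<longleftrightarrow> z = scl A a x + scl A b y"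
| "is_comb L A a _ b _ _ \<longleftrightarrow> False"

text \<open>The parameter \<open>K\<close> selects the admissible letters: those from \<open>L\<close> if \<open>True \<in> K\<close>, and those
  from \<open>A\<close> if \<open>False \<in> K\<close>.\<close>

definition homog_letters :: "('k, 'l) gspace \<Rightarrow> ('k, 'a) gspace \<Rightarrow> bool set \<Rightarrow> (int \<times> ('l + 'a)) set" where
  "homog_letters L A K = {y. isl (snd y) \<in> K \<and> (case snd y of Inl x \<Rightarrow> x \<in> gr L (fst y) | Inr a \<Rightarrow> a \<in> gr A (fst y))}"

definition letter_comb :: "('k, 'l::plus) gspace \<Rightarrow> ('k, 'a::plus) gspace \<Rightarrow> bool set \<Rightarrow>
    'k \<Rightarrow> int \<times> ('l + 'a) \<Rightarrow> 'k \<Rightarrow> int \<times> ('l + 'a) \<Rightarrow> int \<times> ('l + 'a) \<Rightarrow> bool" where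
  "letter_comb L A K a x b y z \<longleftrightarrow> x \<in> homog_letters L A K \<and> y \<in> homog_letters L A K \<and> z \<in> homog_letters L A K \<and>
     fst x = fst z \<and> fst y = fst z \<and> is_comb L A a (snd x) b (snd y) (snd z)"

definition letter_rel :: "int \<times> ('l + 'a) \<Rightarrow> int \<times> ('l + 'a) \<Rightarrow> bool" where
  "letter_rel x y \<longleftrightarrow> (even (fst x) \<longleftrightarrow> even (fst y)) \<and> snd x = snd y"

definition relabel :: "('k, 'l) gspace \<Rightarrow> ('k, 'a) gspace \<Rightarrow> int \<times> ('l + 'a) \<Rightarrow> int \<times> ('l + 'a)" where
  "relabel L A y = ((case snd y of Inl x \<Rightarrow> hdeg L x | Inr a \<Rightarrow> hdeg A a), snd y)"

lemma homog_letters_simps [simp]: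
  "(d, Inl x) \<in> homog_letters L A K \<longleftrightarrow> True \<in> K \<and> x \<in> gr L d"
  "(d, Inr a) \<in> homog_letters L A K \<longleftrightarrow> False \<in> K \<and> a \<in> gr A d"
  by (auto simp: homog_letters_def)

lemma hdeg: "x \<in> homs V \<Longrightarrow> x \<in> gr V (hdeg V x)"
  by (auto simp: homs_def hdeg_def intro: someI)

lemma psign_scl:
  assumes "vector_space (scl V)"
  shows "psign n v = scl V (sg n) v"
proof -
  interpret vector_space "scl V" by fact
  show ?thesis by (simp add: psign_def sg_def)
qed

lemma graded_spaceD:
  assumes "graded_space M V"
  shows "vector_space (scl V)" "0 \<in> gr V d" "x \<in> gr V d \<Longrightarrow> y \<in> gr V d \<Longrightarrow> x + y \<in> gr V d"
    "x \<in> gr V d \<Longrightarrow> scl V c x \<in> gr V d"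
proof -
  interpret vector_space "scl V" using assms[unfolded graded_space_def] by (rule conjunct1)
  have "subspace (gr V d)" using assms[unfolded graded_space_def, THEN conjunct2, THEN conjunct1] by (rule spec)
  then show "0 \<in> gr V d" "x \<in> gr V d \<Longrightarrow> y \<in> gr V d \<Longrightarrow> x + y \<in> gr V d"
    "x \<in> gr V d \<Longrightarrow> scl V c x \<in> gr V d"
    by (auto simp: subspace_def)
  show "vector_space (scl V)" ..
qed

text \<open>If the two degrees were incongruent modulo \<open>M\<close>, then x in one and -x in the
  other would be a vanishing sum of components, contradicting directness. For both values of
  \<open>M\<close> congruent degrees have equal parity.\<close>

lemma even_hdeg:
  assumes V: "graded_space M V" and M: "M = 0 \<or> M = 2" and x: "x \<in> gr V d" "x \<noteq> 0"
  shows "even (hdeg V x) \<longleftrightarrow> even d"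
proof -
  let ?e = "hdeg V x"
  interpret vector_space "scl V" using graded_spaceD(1)[OF V] .
  have e: "x \<in> gr V ?e" using x by (auto intro!: hdeg simp: homs_def)
  have "d mod M = ?e mod M"
  proof (rule ccontr)
    assume ne: "d mod M \<noteq> ?e mod M"
    then have "d \<noteq> ?e" by auto
    let ?v = "\<lambda>c. if c = d then x else - x"
    have "- x \<in> gr V ?e" using graded_spaceD(4)[OF V e, of "- 1"] by simp
    then have "finite {d, ?e} \<and> inj_on (\<lambda>c. c mod M) {d, ?e} \<and> (\<forall>c\<in>{d, ?e}. ?v c \<in> gr V c) \<and>
        (\<Sum>c\<in>{d, ?e}. ?v c) = 0"
      using ne x(1) \<open>d \<noteq> ?e\<close> by (auto simp: inj_on_def)
    from V[unfolded graded_space_def, THEN conjunct2, THEN conjunct2, THEN conjunct2, THEN conjunct2,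
        rule_format, OF this, of d]
    have "x = 0" by simp
    then show False using x by simp
  qed
  then show ?thesis using M by (auto simp: even_iff_mod_2_eq_zero)
qed

lemma label_unlabel:
  assumes "sorted_wrt (\<lambda>x y. isl (snd y) \<longrightarrow> isl (snd x)) v"
  shows "label L A (unlabel v) = map (relabel L A) v"
  using assms
proof (induction v)
  case (Cons y v)
  have *: "fst (unlabel v) = []" if "\<not> isl (snd y)"
  proof -
    have "\<forall>x\<in>set v. \<not> isl (snd x)" using Cons.prems that by simp
    then show ?thesis by (simp add: unlabel_def)
  qed
  have IH: "label L A (unlabel v) = map (relabel L A) v" using Cons by simp
  show ?case
  proof (cases "snd y")
    case (Inl x)
    then show ?thesis using IH by (simp add: label_def unlabel_Cons labelL_def relabel_def)
  next
    case (Inr a)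
    then show ?thesis using IH * by (simp add: label_def unlabel_Cons labelA_def labelL_def relabel_def)
  qed
qed (simp add: label_def)

lemma relabel_label: "y \<in> set (label L A w) \<Longrightarrow> relabel L A y = y"
  by (auto simp: label_def labelL_def labelA_def relabel_def)

lemma linear_comb:
  assumes "Vector_Spaces.linear s1 s2 f"
  shows "f (s1 a x + s1 b y) = s2 a (f x) + s2 b (f y)"
proof -
  interpret Vector_Spaces.linear s1 s2 f by fact
  show ?thesis unfolding add scale ..
qed

locale deformed_pair = labelled_pair L A bLL bLA bAA
  for L :: "('k::field_char_0, 'l::ab_group_add) gspace" and A :: "('k, 'a::ab_group_add) gspace"
    and bLL :: "'l \<Rightarrow> 'l \<Rightarrow> 'l" and bLA :: "'l \<Rightarrow> 'a \<Rightarrow> 'a" and bAA :: "'a \<Rightarrow> 'a \<Rightarrow> 'a" +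
  fixes M :: int and \<delta>L :: "nat \<Rightarrow> 'l \<Rightarrow> 'l" and \<delta>A :: "nat \<Rightarrow> 'a \<Rightarrow> 'a"
  assumes M: "M = 0 \<or> M = 2"
    and pair: "loday_pair M L A bLL bLA bAA"
    and deformation: "deformation L A bLL bLA bAA \<delta>L \<delta>A"
begin

lemma graded: "graded_space M L" "graded_space M A"
  and bilinear_deg0: "bilinear_deg0 L L L bLL" "bilinear_deg0 L A A bLA" "bilinear_deg0 A A A bAA"
  using pair unfolding loday_pair_def by blast+

sublocale VL: vector_space "scl L"
  using graded_spaceD(1)[OF graded(1)] .

sublocale VA: vector_space "scl A"
  using graded_spaceD(1)[OF graded(2)] .

lemmas psign_scl_pair = psign_scl[OF graded_spaceD(1)[OF graded(1)]] psign_scl[OF graded_spaceD(1)[OF graded(2)]]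

lemma bilinear:
  "bLL (scl L a x + scl L b y) z = scl L a (bLL x z) + scl L b (bLL y z)"
  "bLL z (scl L a x + scl L b y) = scl L a (bLL z x) + scl L b (bLL z y)"
  "bLA (scl L a x + scl L b y) u = scl A a (bLA x u) + scl A b (bLA y u)"
  "bLA z (scl A a u + scl A b v) = scl A a (bLA z u) + scl A b (bLA z v)"
  "bAA (scl A a u + scl A b v) w = scl A a (bAA u w) + scl A b (bAA v w)"
  "bAA w (scl A a u + scl A b v) = scl A a (bAA w u) + scl A b (bAA w v)"
proof -
  note LL = bilinear_deg0(1)[unfolded bilinear_deg0_def] and LA = bilinear_deg0(2)[unfolded bilinear_deg0_def]
    and AA = bilinear_deg0(3)[unfolded bilinear_deg0_def]
  show "bLL (scl L a x + scl L b y) z = scl L a (bLL x z) + scl L b (bLL y z)"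
    by (rule linear_comb[OF LL[THEN conjunct2, THEN conjunct1, THEN spec, of z]])
  show "bLL z (scl L a x + scl L b y) = scl L a (bLL z x) + scl L b (bLL z y)"
    by (rule linear_comb[OF LL[THEN conjunct1, THEN spec, of z]])
  show "bLA (scl L a x + scl L b y) u = scl A a (bLA x u) + scl A b (bLA y u)"
    by (rule linear_comb[OF LA[THEN conjunct2, THEN conjunct1, THEN spec, of u]])
  show "bLA z (scl A a u + scl A b v) = scl A a (bLA z u) + scl A b (bLA z v)"
    by (rule linear_comb[OF LA[THEN conjunct1, THEN spec, of z]])
  show "bAA (scl A a u + scl A b v) w = scl A a (bAA u w) + scl A b (bAA v w)"
    by (rule linear_comb[OF AA[THEN conjunct2, THEN conjunct1, THEN spec, of w]])
  show "bAA w (scl A a u + scl A b v) = scl A a (bAA w u) + scl A b (bAA w v)"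
    by (rule linear_comb[OF AA[THEN conjunct1, THEN spec, of w]])
qed

lemma br_gr:
  "x \<in> gr L p \<Longrightarrow> y \<in> gr L q \<Longrightarrow> bLL x y \<in> gr L (p + q)"
  "x \<in> gr L p \<Longrightarrow> u \<in> gr A q \<Longrightarrow> bLA x u \<in> gr A (p + q)"
  "u \<in> gr A p \<Longrightarrow> v \<in> gr A q \<Longrightarrow> bAA u v \<in> gr A (p + q)"
  using bilinear_deg0 unfolding bilinear_deg0_def by blast+

lemma loday_identities:
  "x \<in> gr L p \<Longrightarrow> y \<in> gr L q \<Longrightarrow> bLL (bLL x y) z = bLL x (bLL y z) - scl L (sg (p * q)) (bLL y (bLL x z))"
  "x \<in> gr L p \<Longrightarrow> y \<in> gr L q \<Longrightarrow> bLA (bLL x y) u = bLA x (bLA y u) - scl A (sg (p * q)) (bLA y (bLA x u))"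
  "x \<in> gr L p \<Longrightarrow> u \<in> gr A q \<Longrightarrow> bAA (bLA x u) v = bLA x (bAA u v) - scl A (sg (p * q)) (bAA u (bLA x v))"
  "bAA (bAA u v) w = bAA u (bAA v w)"
proof -
  note p = pair[unfolded loday_pair_def, THEN conjunct2, THEN conjunct2, THEN conjunct2, THEN conjunct2, THEN conjunct2]
  note p1 = p[THEN conjunct1, rule_format] and p2 = p[THEN conjunct2, THEN conjunct1, rule_format]
    and p3 = p[THEN conjunct2, THEN conjunct2, THEN conjunct1, rule_format]
    and p4 = p[THEN conjunct2, THEN conjunct2, THEN conjunct2, rule_format]
  show "bAA (bAA u v) w = bAA u (bAA v w)" by (rule p2)
  show "bLL (bLL x y) z = bLL x (bLL y z) - scl L (sg (p * q)) (bLL y (bLL x z))"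
    if "x \<in> gr L p" "y \<in> gr L q"
    unfolding eq_diff_eq psign_scl_pair[symmetric] by (rule p1[OF that, symmetric])
  show "bLA (bLL x y) u = bLA x (bLA y u) - scl A (sg (p * q)) (bLA y (bLA x u))"
    if "x \<in> gr L p" "y \<in> gr L q"
    unfolding eq_diff_eq psign_scl_pair[symmetric] by (rule p3[OF that, symmetric])
  show "bAA (bLA x u) v = bLA x (bAA u v) - scl A (sg (p * q)) (bAA u (bLA x v))"
    if "x \<in> gr L p" "u \<in> gr A q"
    unfolding eq_diff_eq psign_scl_pair[symmetric] by (rule p4[OF that, symmetric])
qed

lemma derivation: "pair_derivation L A bLL bLA bAA 1 (\<delta>L i) (\<delta>A i)"
  using deformation unfolding deformation_def by blast

lemma der_linear:
  "\<delta>L i (scl L a x + scl L b y) = scl L a (\<delta>L i x) + scl L b (\<delta>L i y)"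
  "\<delta>A i (scl A a u + scl A b v) = scl A a (\<delta>A i u) + scl A b (\<delta>A i v)"
  using derivation[of i, unfolded pair_derivation_def linear_deg_def] by (blast intro: linear_comb)+

lemma der_gr:
  "x \<in> gr L q \<Longrightarrow> \<delta>L i x \<in> gr L (q + 1)" "u \<in> gr A q \<Longrightarrow> \<delta>A i u \<in> gr A (q + 1)"
  using derivation[of i] unfolding pair_derivation_def linear_deg_def by blast+

lemma der_leibniz:
  "x \<in> gr L q \<Longrightarrow> bLL (\<delta>L i x) y = \<delta>L i (bLL x y) - scl L (sg q) (bLL x (\<delta>L i y))"
  "x \<in> gr L q \<Longrightarrow> bLA (\<delta>L i x) u = \<delta>A i (bLA x u) - scl A (sg q) (bLA x (\<delta>A i u))"
  "u \<in> gr A q \<Longrightarrow> bAA (\<delta>A i u) v = \<delta>A i (bAA u v) - scl A (sg q) (bAA u (\<delta>A i v))"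
proof -
  note p = derivation[of i, unfolded pair_derivation_def mult_1, THEN conjunct2, THEN conjunct2]
  note p1 = p[THEN conjunct1, rule_format] and p2 = p[THEN conjunct2, THEN conjunct1, rule_format]
    and p3 = p[THEN conjunct2, THEN conjunct2, rule_format]
  show "bLL (\<delta>L i x) y = \<delta>L i (bLL x y) - scl L (sg q) (bLL x (\<delta>L i y))" if "x \<in> gr L q"
    unfolding eq_diff_eq psign_scl_pair[symmetric] by (rule p1[OF that, symmetric])
  show "bLA (\<delta>L i x) u = \<delta>A i (bLA x u) - scl A (sg q) (bLA x (\<delta>A i u))" if "x \<in> gr L q"
    unfolding eq_diff_eq psign_scl_pair[symmetric] by (rule p2[OF that, symmetric])
  show "bAA (\<delta>A i u) v = \<delta>A i (bAA u v) - scl A (sg q) (bAA u (\<delta>A i v))" if "u \<in> gr A q"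
    unfolding eq_diff_eq psign_scl_pair[symmetric] by (rule p3[OF that, symmetric])
qed

lemma der_square:
  "(\<Sum>i\<le>n. \<delta>L i (\<delta>L (n - i) x)) = 0" "(\<Sum>i\<le>n. \<delta>A i (\<delta>A (n - i) u)) = 0"
  using deformation unfolding deformation_def by blast+

abbreviation "D \<equiv> \<lambda>r. letter_map (\<delta>L r) (\<delta>A r)"

lemma comb_gr:
  "x \<in> gr L d \<Longrightarrow> y \<in> gr L d \<Longrightarrow> scl L a x + scl L b y \<in> gr L d"
  "u \<in> gr A d \<Longrightarrow> v \<in> gr A d \<Longrightarrow> scl A a u + scl A b v \<in> gr A d"
  using graded_spaceD[OF graded(1)] graded_spaceD[OF graded(2)] by auto

lemma br_homog:
  "x \<in> homog_letters L A K \<Longrightarrow> y \<in> homog_letters L A K \<Longrightarrow> isl (snd x) \<or> \<not> isl (snd y) \<Longrightarrow>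
    letter_br bLL bLA bAA x y \<in> homog_letters L A K"
  by (cases x; cases y; cases "snd x"; cases "snd y") (auto simp: letter_br_def br_gr)

lemma isl_br: "isl (snd (letter_br bLL bLA bAA x y)) \<longleftrightarrow> isl (snd x) \<and> isl (snd y)"
  by (rule isL_br)

text \<open>Uniform in \<open>K\<close>, so that one verification serves words over L and A
  together, over L alone and over A alone.\<close>

lemma loday_letters: "loday_letters fst (\<lambda>y. isl (snd y)) (letter_br bLL bLA bAA) (homog_letters L A K) (letter_comb L A K)"
proof unfold_locales
  fix a b :: 'k and x y z c :: "int \<times> ('l + 'a)"
  show "letter_comb L A K a x b y z \<Longrightarrow> x \<in> homog_letters L A K \<and> y \<in> homog_letters L A K \<and> z \<in> homog_letters L A K \<and>
      fst x = fst z \<and> fst y = fst z \<and> isl (snd x) = isl (snd z) \<and> isl (snd y) = isl (snd z)"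
    by (cases "snd x"; cases "snd y"; cases "snd z") (auto simp: letter_comb_def)
  show "x \<in> homog_letters L A K \<Longrightarrow> y \<in> homog_letters L A K \<Longrightarrow> isl (snd x) \<or> \<not> isl (snd y) \<Longrightarrow>
      letter_br bLL bLA bAA x y \<in> homog_letters L A K"
    by (rule br_homog)
  show "letter_comb L A K a x b y z \<Longrightarrow> c \<in> homog_letters L A K \<Longrightarrow> isl (snd z) \<or> \<not> isl (snd c) \<Longrightarrow>
      letter_comb L A K a (letter_br bLL bLA bAA x c) b (letter_br bLL bLA bAA y c) (letter_br bLL bLA bAA z c)"
    by (cases x; cases y; cases z; cases c; cases "snd x"; cases "snd y"; cases "snd z"; cases "snd c")
      (auto simp: letter_comb_def letter_br_def br_gr bilinear comb_gr)
  show "letter_comb L A K a x b y z \<Longrightarrow> c \<in> homog_letters L A K \<Longrightarrow> isl (snd c) \<or> \<not> isl (snd z) \<Longrightarrow>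
      letter_comb L A K a (letter_br bLL bLA bAA c x) b (letter_br bLL bLA bAA c y) (letter_br bLL bLA bAA c z)"
    by (cases x; cases y; cases z; cases c; cases "snd x"; cases "snd y"; cases "snd z"; cases "snd c")
      (auto simp: letter_comb_def letter_br_def br_gr bilinear comb_gr)
  show "letter_comb L A K 1 (letter_br bLL bLA bAA z (letter_br bLL bLA bAA x y)) (- sg (fst z * fst x))
        (letter_br bLL bLA bAA x (letter_br bLL bLA bAA z y)) (letter_br bLL bLA bAA (letter_br bLL bLA bAA z x) y)"
    if "z \<in> homog_letters L A K" "x \<in> homog_letters L A K" "y \<in> homog_letters L A K"
      "isl (snd z)" "isl (snd x) \<or> \<not> isl (snd y)"
  proof -
    have "is_comb L A 1 (snd (letter_br bLL bLA bAA z (letter_br bLL bLA bAA x y))) (- sg (fst z * fst x))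
        (snd (letter_br bLL bLA bAA x (letter_br bLL bLA bAA z y))) (snd (letter_br bLL bLA bAA (letter_br bLL bLA bAA z x) y))"
      using that by (cases x; cases y; cases z; cases "snd x"; cases "snd y"; cases "snd z")
        (auto simp: letter_br_def loday_identities)
    then show ?thesis
      using that by (auto simp: letter_comb_def isl_br intro!: br_homog)
  qed
  show "\<not> isl (snd x) \<Longrightarrow> \<not> isl (snd y) \<Longrightarrow> \<not> isl (snd z) \<Longrightarrow>
      letter_br bLL bLA bAA x (letter_br bLL bLA bAA y z) = letter_br bLL bLA bAA (letter_br bLL bLA bAA x y) z"
    by (cases "snd x"; cases "snd y"; cases "snd z") (auto simp: letter_br_def loday_identities)
qed

lemma D_homog: "y \<in> homog_letters L A K \<Longrightarrow> D r y \<in> homog_letters L A K"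
  by (cases y; cases "snd y") (auto simp: letter_map_def der_gr)

lemma D_simps [simp]: "fst (letter_map DL DA y) = fst y + 1" "isl (snd (letter_map DL DA y)) = isl (snd y)"
  by (simp_all add: letter_map_def isl_map_sum)

lemma der_letter_map:
  "loday_letters.der fst (\<lambda>y. isl (snd y)) (letter_br bLL bLA bAA) (homog_letters L A K) (letter_comb L A K) 1 (D r)"
proof -
  interpret loday_letters fst "\<lambda>y. isl (snd y)" "letter_br bLL bLA bAA" "homog_letters L A K" "letter_comb L A K"
    by (rule loday_letters)
  show ?thesis
    unfolding der_def
  proof (intro conjI ballI allI impI)
    fix a x b y z assume "letter_comb L A K a x b y z"
    then show "letter_comb L A K a (D r x) b (D r y) (D r z)"
      by (cases x; cases y; cases z; cases "snd x"; cases "snd y"; cases "snd z")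
        (auto simp: letter_comb_def letter_map_def der_gr der_linear comb_gr)
  next
    fix x y assume xy: "x \<in> homog_letters L A K" "y \<in> homog_letters L A K" "isl (snd x) \<or> \<not> isl (snd y)"
    then have "is_comb L A 1 (snd (D r (letter_br bLL bLA bAA x y))) (- sg (1 * fst x))
        (snd (letter_br bLL bLA bAA x (D r y))) (snd (letter_br bLL bLA bAA (D r x) y))"
      by (cases x; cases y; cases "snd x"; cases "snd y")
        (auto simp: letter_br_def letter_map_def der_leibniz)
    then show "letter_comb L A K 1 (D r (letter_br bLL bLA bAA x y)) (- sg (1 * fst x))
        (letter_br bLL bLA bAA x (D r y)) (letter_br bLL bLA bAA (D r x) y)"
      using xy by (auto simp: letter_comb_def isl_br intro!: br_homog D_homog)
  qed (simp_all add: D_homog)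
qed

definition S :: "nat \<Rightarrow> nat \<Rightarrow> int \<times> ('l + 'a) \<Rightarrow> int \<times> ('l + 'a)" where
  "S n m y = (fst y + 2, map_sum (\<lambda>x. \<Sum>i<m. \<delta>L i (\<delta>L (n - i) x)) (\<lambda>u. \<Sum>i<m. \<delta>A i (\<delta>A (n - i) u)) (snd y))"

lemma S_gr:
  "x \<in> gr L d \<Longrightarrow> (\<Sum>i<m. \<delta>L i (\<delta>L (n - i) x)) \<in> gr L (d + 2)"
  "u \<in> gr A d \<Longrightarrow> (\<Sum>i<m. \<delta>A i (\<delta>A (n - i) u)) \<in> gr A (d + 2)"
  using der_gr(1)[OF der_gr(1)[of x d]] der_gr(2)[OF der_gr(2)[of u d]]
    graded_spaceD[OF graded(1)] graded_spaceD[OF graded(2)]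
  by (induction m) (auto simp: add_ac)

lemma S_homog: "y \<in> homog_letters L A K \<Longrightarrow> S n m y \<in> homog_letters L A K"
  by (cases y; cases "snd y") (auto simp: S_def S_gr)

text \<open>\<open>S n\<close> runs through the partial sums of the coefficient of t^n in dd; it
  starts with the empty sum and ends with the full one, which vanishes by the deformation
  equation.\<close>

lemma S_comb:
  assumes "y \<in> homog_letters L A K"
  shows "letter_comb L A K 1 (S n m y) 1 (D m (D (n - m) y)) (S n (Suc m) y)"
    "letter_comb L A K 0 (S n 0 y) 0 (S n 0 y) (S n 0 y)"
    "letter_comb L A K 0 (S n (Suc n) y) 0 (S n (Suc n) y) (S n (Suc n) y)"
proof -
  have "is_comb L A 1 (snd (S n m y)) 1 (snd (D m (D (n - m) y))) (snd (S n (Suc m) y))"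
    by (cases "snd y") (auto simp: S_def letter_map_def)
  then show "letter_comb L A K 1 (S n m y) 1 (D m (D (n - m) y)) (S n (Suc m) y)"
    using S_homog[OF assms] D_homog[OF D_homog[OF assms]] by (auto simp: letter_comb_def) (auto simp: S_def)
  have "is_comb L A 0 (snd (S n 0 y)) 0 (snd (S n 0 y)) (snd (S n 0 y))"
    by (cases "snd y") (auto simp: S_def)
  then show "letter_comb L A K 0 (S n 0 y) 0 (S n 0 y) (S n 0 y)"
    using S_homog[OF assms] by (auto simp: letter_comb_def)
  have "is_comb L A 0 (snd (S n (Suc n) y)) 0 (snd (S n (Suc n) y)) (snd (S n (Suc n) y))"
    by (cases "snd y") (auto simp: S_def lessThan_Suc_atMost der_square simp del: sum.lessThan_Suc)
  then show "letter_comb L A K 0 (S n (Suc n) y) 0 (S n (Suc n) y) (S n (Suc n) y)"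
    using S_homog[OF assms] by (auto simp: letter_comb_def)
qed

end

section \<open>Presentations of LA, TL and TA by labelled words\<close>

lemma slot_relations_iff:
  "s \<in> slot_relations V W \<longleftrightarrow> (\<exists>a b x y d. x \<in> gr V d \<and> y \<in> gr V d \<and>
     s = wd (W (scl V a x + scl V b y)) - fscl a (wd (W x)) - fscl b (wd (W y)))"
  unfolding slot_relations_def by blast

context deformed_pair
begin

lemma homog_label:
  "set xs \<subseteq> homs L \<Longrightarrow> True \<in> K \<Longrightarrow> set (labelL L xs) \<subseteq> homog_letters L A K"
  "set as \<subseteq> homs A \<Longrightarrow> False \<in> K \<Longrightarrow> set (labelA A as) \<subseteq> homog_letters L A K"
  by (auto simp: labelL_def labelA_def hdeg)

lemma unlabel_homs:
  "set v \<subseteq> homog_letters L A K \<Longrightarrow> set (fst (unlabel v)) \<subseteq> homs L \<and> set (snd (unlabel v)) \<subseteq> homs A"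
  by (induction v) (auto simp: unlabel_Cons homog_letters_def homs_def split: sum.splits)

lemma shape_label: "shape (labelL L xs @ labelA A as)"
proof (induction xs)
  case Nil
  have "shape (labelA A as)" by (induction as) (auto simp: labelA_def)
  then show ?case by simp
qed (auto simp: labelL_def)

text \<open>Away from 0 the parity of a label is forced by directness of the grading. The vector 0
  is homogeneous of every degree, so it remains the zero letter after relabelling.\<close>

lemma relabel_or_0:
  assumes v: "set v \<subseteq> homog_letters L A K"
  shows "list_all2 letter_rel v (map (relabel L A) v) \<or>
    (\<exists>z\<in>set v. letter_comb L A K 0 z 0 z z) \<and> (\<exists>z\<in>set (map (relabel L A) v). letter_comb L A K 0 z 0 z z)"
proof (cases "\<exists>z\<in>set v. snd z = Inl 0 \<or> snd z = Inr 0")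
  case True
  then obtain z where z: "z \<in> set v" "snd z = Inl 0 \<or> snd z = Inr 0" by blast
  then have "z \<in> homog_letters L A K" using v by blast
  then have "letter_comb L A K 0 z 0 z z"
    "letter_comb L A K 0 (relabel L A z) 0 (relabel L A z) (relabel L A z)"
    using z(2) graded_spaceD(2)[OF graded(1)] graded_spaceD(2)[OF graded(2)]
    by (cases z; auto simp: letter_comb_def relabel_def)+
  then show ?thesis using z(1) by auto
next
  case False
  have "letter_rel y (relabel L A y)" if "y \<in> set v" for y
  proof -
    have "y \<in> homog_letters L A K" "snd y \<noteq> Inl 0" "snd y \<noteq> Inr 0" using that v False by blast+
    then show ?thesis
      using even_hdeg[OF graded(1) M] even_hdeg[OF graded(2) M]
      by (cases y; cases "snd y") (auto simp: letter_rel_def relabel_def)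
  qed
  then show ?thesis by (auto simp: list_all2_map2 list_all2_same)
qed

lemma letter_comb_cases:
  assumes "letter_comb L A K a x b y z"
  obtains (L) d u v where "True \<in> K" "u \<in> gr L d" "v \<in> gr L d" "x = (d, Inl u)" "y = (d, Inl v)"
      "z = (d, Inl (scl L a u + scl L b v))"
    | (A) d u v where "False \<in> K" "u \<in> gr A d" "v \<in> gr A d" "x = (d, Inr u)" "y = (d, Inr v)"
      "z = (d, Inr (scl A a u + scl A b v))"
proof (cases "snd z")
  case (Inl w)
  with assms obtain u v where "snd x = Inl u" "snd y = Inl v" "w = scl L a u + scl L b v"
    by (cases "snd x"; cases "snd y") (auto simp: letter_comb_def)
  with Inl assms show thesis
    by (intro L[of u "fst z" v]) (auto simp: letter_comb_def homog_letters_def prod_eq_iff)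
next
  case (Inr w)
  with assms obtain u v where "snd x = Inr u" "snd y = Inr v" "w = scl A a u + scl A b v"
    by (cases "snd x"; cases "snd y") (auto simp: letter_comb_def)
  with Inr assms show thesis
    by (intro A[of u "fst z" v]) (auto simp: letter_comb_def homog_letters_def prod_eq_iff)
qed

lemma letter_combI:
  "u \<in> gr L d \<Longrightarrow> v \<in> gr L d \<Longrightarrow> True \<in> K \<Longrightarrow>
    letter_comb L A K a (d, Inl u) b (d, Inl v) (d, Inl (scl L a u + scl L b v))"
  "u' \<in> gr A d \<Longrightarrow> v' \<in> gr A d \<Longrightarrow> False \<in> K \<Longrightarrow>
    letter_comb L A K a (d, Inr u') b (d, Inr v') (d, Inr (scl A a u' + scl A b v'))"
  by (auto simp: letter_comb_def comb_gr)

lemma letter_rel_facts: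
  "letter_rel x y \<Longrightarrow> (even (fst x) \<longleftrightarrow> even (fst y)) \<and> isl (snd x) = isl (snd y)"
  "letter_rel x x' \<Longrightarrow> letter_rel y y' \<Longrightarrow> letter_rel (letter_br bLL bLA bAA x y) (letter_br bLL bLA bAA x' y')"
  "letter_rel x y \<Longrightarrow> letter_rel (D r x) (D r y)"
  by (auto simp: letter_rel_def letter_br_def letter_map_def split: sum.splits)

lemma letter_rel_unlabel: "list_all2 letter_rel v v' \<Longrightarrow> unlabel v = unlabel v'"
  by (induction rule: list_all2_induct) (auto simp: unlabel_Cons letter_rel_def split: sum.splits)

definition LA_rel0 :: "('l list \<times> 'a list \<Rightarrow>\<^sub>0 'k) set" where
  "LA_rel0 = \<Union>{slot_relations L (\<lambda>x. (us @ [x] @ vs, as)) | us vs as.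
          set us \<subseteq> homs L \<and> set vs \<subseteq> homs L \<and> set as \<subseteq> homs A} \<union>
      \<Union>{slot_relations A (\<lambda>a. (xs, bs @ [a] @ cs)) | xs bs cs.
          set xs \<subseteq> homs L \<and> set bs \<subseteq> homs A \<and> set cs \<subseteq> homs A}"

definition T_rel0 :: "('k, 'v::ab_group_add) gspace \<Rightarrow> ('v list \<Rightarrow>\<^sub>0 'k) set" where
  "T_rel0 V = \<Union>{slot_relations V (\<lambda>x. us @ [x] @ vs) | us vs. set us \<subseteq> homs V \<and> set vs \<subseteq> homs V}"

lemma LA_rel0I:
  "s \<in> slot_relations L (\<lambda>x. (us @ [x] @ vs, as)) \<Longrightarrow>
    set us \<subseteq> homs L \<Longrightarrow> set vs \<subseteq> homs L \<Longrightarrow> set as \<subseteq> homs A \<Longrightarrow> s \<in> LA_rel0"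
  "s \<in> slot_relations A (\<lambda>a. (xs, bs @ [a] @ cs)) \<Longrightarrow>
    set xs \<subseteq> homs L \<Longrightarrow> set bs \<subseteq> homs A \<Longrightarrow> set cs \<subseteq> homs A \<Longrightarrow> s \<in> LA_rel0"
  unfolding LA_rel0_def by blast+

lemma T_rel0I:
  "s \<in> slot_relations V (\<lambda>x. us @ [x] @ vs) \<Longrightarrow> set us \<subseteq> homs V \<Longrightarrow> set vs \<subseteq> homs V \<Longrightarrow> s \<in> T_rel0 V"
  unfolding T_rel0_def by blast

lemma word_model_LA:
  "word_model fst (\<lambda>y. isl (snd y)) (letter_br bLL bLA bAA) (homog_letters L A UNIV) (letter_comb L A UNIV)
     (LA_words L A) LA_rel0 (label L A) unlabel letter_rel"
proof -
  interpret loday_letters fst "\<lambda>y. isl (snd y)" "letter_br bLL bLA bAA" "homog_letters L A UNIV" "letter_comb L A UNIV"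
    by (rule loday_letters)
  show ?thesis
  proof unfold_locales
    fix w assume "w \<in> LA_words L A"
    then show "set (label L A w) \<subseteq> homog_letters L A UNIV \<and> shape (label L A w) \<and> label L A w \<noteq> []"
      using homog_label(1)[of "fst w" UNIV] homog_label(2)[of "snd w" UNIV] shape_label[of "fst w" "snd w"]
      by (cases w) (simp add: LA_words_def label_def)
  next
    fix v :: "(int \<times> ('l + 'a)) list"
    assume v: "set v \<subseteq> homog_letters L A UNIV" "shape v" "v \<noteq> []"
    have "unlabel v \<noteq> ([], [])"
      using v(3) by (cases v) (auto simp: unlabel_Cons split: sum.splits)
    then show "unlabel v \<in> LA_words L A"
      using unlabel_homs[OF v(1)] by (cases "unlabel v") (auto simp: LA_words_def)
    show "list_all2 letter_rel v (label L A (unlabel v)) \<or>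
       (\<exists>z\<in>set v. letter_comb L A UNIV 0 z 0 z z) \<and>
       (\<exists>z\<in>set (label L A (unlabel v)). letter_comb L A UNIV 0 z 0 z z)"
      using relabel_or_0[OF v(1)] label_unlabel[of v L A] v(2) by (simp add: shape_def)
  next
    fix s assume "s \<in> LA_rel0"
    then consider (L) us vs as where "set us \<subseteq> homs L" "set vs \<subseteq> homs L" "set as \<subseteq> homs A"
        "s \<in> slot_relations L (\<lambda>x. (us @ [x] @ vs, as))"
      | (A) xs bs cs where "set xs \<subseteq> homs L" "set bs \<subseteq> homs A" "set cs \<subseteq> homs A"
        "s \<in> slot_relations A (\<lambda>a. (xs, bs @ [a] @ cs))"
      unfolding LA_rel0_def by blast
    then show "\<exists>us vs a x b y z. set us \<subseteq> homog_letters L A UNIV \<and> set vs \<subseteq> homog_letters L A UNIV \<and>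
        shape (us @ z # vs) \<and> letter_comb L A UNIV a x b y z \<and>
        s = wd (unlabel (us @ z # vs)) - fscl a (wd (unlabel (us @ x # vs))) - fscl b (wd (unlabel (us @ y # vs)))"
    proof cases
      case L
      then obtain a b x y d where *: "x \<in> gr L d" "y \<in> gr L d"
        "s = wd (us @ [scl L a x + scl L b y] @ vs, as) - fscl a (wd (us @ [x] @ vs, as)) - fscl b (wd (us @ [y] @ vs, as))"
        using L(4) unfolding slot_relations_iff by blast
      have "shape (labelL L us @ (d, Inl (scl L a x + scl L b y)) # labelL L vs @ labelA A as)"
        using shape_label[of "us @ x # vs" as] by (auto simp: shape_def sorted_wrt_append labelL_def labelA_def)
      \<comment> \<open>The varying letter is labelled with the common degree d of the relation,
        since \<open>hdeg\<close> may assign different degrees to x, y and their combination; the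
        other letters keep their chosen degrees.\<close>
      then show ?thesis
        using L * homog_label[of _ UNIV]
        by (intro exI[of _ "labelL L us"] exI[of _ "labelL L vs @ labelA A as"] exI[of _ a] exI[of _ b]
            exI[of _ "(d, Inl x)"] exI[of _ "(d, Inl y)"] exI[of _ "(d, Inl (scl L a x + scl L b y))"])
          (auto simp: unlabel_append unlabel_Cons letter_combI)
    next
      case A
      then obtain a b x y d where *: "x \<in> gr A d" "y \<in> gr A d"
        "s = wd (xs, bs @ [scl A a x + scl A b y] @ cs) - fscl a (wd (xs, bs @ [x] @ cs)) - fscl b (wd (xs, bs @ [y] @ cs))"
        using A(4) unfolding slot_relations_iff by blast
      have "shape ((labelL L xs @ labelA A bs) @ (d, Inr (scl A a x + scl A b y)) # labelA A cs)"
        using shape_label[of xs "bs @ x # cs"] by (auto simp: shape_def sorted_wrt_append labelL_def labelA_def)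
      then show ?thesis
        using A * homog_label[of _ UNIV]
        by (intro exI[of _ "labelL L xs @ labelA A bs"] exI[of _ "labelA A cs"] exI[of _ a] exI[of _ b]
            exI[of _ "(d, Inr x)"] exI[of _ "(d, Inr y)"] exI[of _ "(d, Inr (scl A a x + scl A b y))"])
          (auto simp: unlabel_append unlabel_Cons letter_combI)
    qed
  next
    fix us vs a x b y z
    assume v: "set us \<subseteq> homog_letters L A UNIV" "set vs \<subseteq> homog_letters L A UNIV" and "letter_comb L A UNIV a x b y z"
    note h = unlabel_homs[OF v(1)] unlabel_homs[OF v(2)]
    let ?s = "wd (unlabel (us @ z # vs)) - fscl a (wd (unlabel (us @ x # vs))) - fscl b (wd (unlabel (us @ y # vs)))"
    from \<open>letter_comb L A UNIV a x b y z\<close> show "?s \<in> LA_rel0"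
    proof (cases rule: letter_comb_cases)
      case (L d u v)
      then have "?s \<in> slot_relations L (\<lambda>x. (fst (unlabel us) @ [x] @ fst (unlabel vs), snd (unlabel us) @ snd (unlabel vs)))"
        unfolding slot_relations_iff by (intro exI conjI) (auto simp: unlabel_append unlabel_Cons)
      then show ?thesis by (rule LA_rel0I) (use h in auto)
    next
      case (A d u v)
      then have "?s \<in> slot_relations A (\<lambda>x. (fst (unlabel us) @ fst (unlabel vs), snd (unlabel us) @ [x] @ snd (unlabel vs)))"
        unfolding slot_relations_iff by (intro exI conjI) (auto simp: unlabel_append unlabel_Cons)
      then show ?thesis by (rule LA_rel0I(2)) (use h in auto)
    qed
  qed (simp_all add: letter_rel_facts letter_rel_unlabel)
qed

lemma word_model_T_L:
  "word_model fst (\<lambda>y. isl (snd y)) (letter_br bLL bLA bAA) (homog_letters L A {True}) (letter_comb L A {True})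
     (T_words L) (T_rel0 L) (labelL L) (\<lambda>v. fst (unlabel v)) letter_rel"
proof -
  interpret loday_letters fst "\<lambda>y. isl (snd y)" "letter_br bLL bLA bAA" "homog_letters L A {True}" "letter_comb L A {True}"
    by (rule loday_letters)
  \<comment> \<open>Without letters of A the second component of \<open>unlabel\<close> is empty, so
    TL is handled as the part of LA without A.\<close>
  have snd_Nil: "snd (unlabel v) = []" if "set v \<subseteq> homog_letters L A {True}" for v
    using that by (auto simp: unlabel_def homog_letters_def filter_empty_conv)
  show ?thesis
  proof unfold_locales
    fix w assume "w \<in> T_words L"
    then show "set (labelL L w) \<subseteq> homog_letters L A {True} \<and> shape (labelL L w) \<and> labelL L w \<noteq> []"
      using homog_label[of _ "{True}"] shape_label[of w "[]"] by (auto simp: T_words_def)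
  next
    fix v :: "(int \<times> ('l + 'a)) list"
    assume v: "set v \<subseteq> homog_letters L A {True}" "shape v" "v \<noteq> []"
    have "unlabel v \<noteq> ([], [])"
      using v(3) by (cases v) (auto simp: unlabel_Cons split: sum.splits)
    then show "fst (unlabel v) \<in> T_words L"
      using unlabel_homs[OF v(1)] snd_Nil[OF v(1)] by (cases "unlabel v") (auto simp: T_words_def)
    have "labelL L (fst (unlabel v)) = label L A (unlabel v)"
      using snd_Nil[OF v(1)] by (simp add: label_def)
    then show "list_all2 letter_rel v (labelL L (fst (unlabel v))) \<or>
       (\<exists>z\<in>set v. letter_comb L A {True} 0 z 0 z z) \<and>
       (\<exists>z\<in>set (labelL L (fst (unlabel v))). letter_comb L A {True} 0 z 0 z z)"
      using relabel_or_0[OF v(1)] label_unlabel[of v L A] v(2) by (simp add: shape_def)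
  next
    fix s assume "s \<in> T_rel0 L"
    then obtain us vs where h: "set us \<subseteq> homs L" "set vs \<subseteq> homs L" and "s \<in> slot_relations L (\<lambda>x. us @ [x] @ vs)"
      unfolding T_rel0_def by blast
    then obtain a b x y d where *: "x \<in> gr L d" "y \<in> gr L d"
      "s = wd (us @ [scl L a x + scl L b y] @ vs) - fscl a (wd (us @ [x] @ vs)) - fscl b (wd (us @ [y] @ vs))"
      unfolding slot_relations_iff by blast
    have "shape (labelL L us @ (d, Inl (scl L a x + scl L b y)) # labelL L vs)"
      using shape_label[of "us @ x # vs" "[]"] by (auto simp: shape_def sorted_wrt_append labelL_def)
    then show "\<exists>us vs a x b y z. set us \<subseteq> homog_letters L A {True} \<and> set vs \<subseteq> homog_letters L A {True} \<and>
        shape (us @ z # vs) \<and> letter_comb L A {True} a x b y z \<and>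
        s = wd (fst (unlabel (us @ z # vs))) - fscl a (wd (fst (unlabel (us @ x # vs)))) - fscl b (wd (fst (unlabel (us @ y # vs))))"
      using * h homog_label[of _ "{True}"]
      by (intro exI[of _ "labelL L us"] exI[of _ "labelL L vs"] exI[of _ a] exI[of _ b]
          exI[of _ "(d, Inl x)"] exI[of _ "(d, Inl y)"] exI[of _ "(d, Inl (scl L a x + scl L b y))"])
        (auto simp: unlabel_append unlabel_Cons letter_combI)
  next
    fix us vs a x b y z
    assume v: "set us \<subseteq> homog_letters L A {True}" "set vs \<subseteq> homog_letters L A {True}" and "letter_comb L A {True} a x b y z"
    note h = unlabel_homs[OF v(1)] unlabel_homs[OF v(2)]
    let ?s = "wd (fst (unlabel (us @ z # vs))) - fscl a (wd (fst (unlabel (us @ x # vs)))) - fscl b (wd (fst (unlabel (us @ y # vs))))"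
    from \<open>letter_comb L A {True} a x b y z\<close> show "?s \<in> T_rel0 L"
    proof (cases rule: letter_comb_cases)
      case (L d u v)
      then have "?s \<in> slot_relations L (\<lambda>x. fst (unlabel us) @ [x] @ fst (unlabel vs))"
        unfolding slot_relations_iff by (intro exI conjI) (auto simp: unlabel_append unlabel_Cons)
      then show ?thesis by (rule T_rel0I) (use h in auto)
    qed simp
  qed (simp_all add: letter_rel_facts letter_rel_unlabel)
qed

lemma word_model_T_A:
  "word_model fst (\<lambda>y. isl (snd y)) (letter_br bLL bLA bAA) (homog_letters L A {False}) (letter_comb L A {False})
     (T_words A) (T_rel0 A) (labelA A) (\<lambda>v. snd (unlabel v)) letter_rel"
proof -
  interpret loday_letters fst "\<lambda>y. isl (snd y)" "letter_br bLL bLA bAA" "homog_letters L A {False}" "letter_comb L A {False}"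
    by (rule loday_letters)
  have fst_Nil: "fst (unlabel v) = []" if "set v \<subseteq> homog_letters L A {False}" for v
    using that by (auto simp: unlabel_def homog_letters_def filter_empty_conv)
  show ?thesis
  proof unfold_locales
    fix w assume "w \<in> T_words A"
    then show "set (labelA A w) \<subseteq> homog_letters L A {False} \<and> shape (labelA A w) \<and> labelA A w \<noteq> []"
      using homog_label[of _ "{False}"] shape_label[of "[]" w] by (auto simp: T_words_def)
  next
    fix v :: "(int \<times> ('l + 'a)) list"
    assume v: "set v \<subseteq> homog_letters L A {False}" "shape v" "v \<noteq> []"
    have "unlabel v \<noteq> ([], [])"
      using v(3) by (cases v) (auto simp: unlabel_Cons split: sum.splits)
    then show "snd (unlabel v) \<in> T_words A"
      using unlabel_homs[OF v(1)] fst_Nil[OF v(1)] by (cases "unlabel v") (auto simp: T_words_def)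
    have "labelA A (snd (unlabel v)) = label L A (unlabel v)"
      using fst_Nil[OF v(1)] by (simp add: label_def)
    then show "list_all2 letter_rel v (labelA A (snd (unlabel v))) \<or>
       (\<exists>z\<in>set v. letter_comb L A {False} 0 z 0 z z) \<and>
       (\<exists>z\<in>set (labelA A (snd (unlabel v))). letter_comb L A {False} 0 z 0 z z)"
      using relabel_or_0[OF v(1)] label_unlabel[of v L A] v(2) by (simp add: shape_def)
  next
    fix s assume "s \<in> T_rel0 A"
    then obtain us vs where h: "set us \<subseteq> homs A" "set vs \<subseteq> homs A" and "s \<in> slot_relations A (\<lambda>x. us @ [x] @ vs)"
      unfolding T_rel0_def by blast
    then obtain a b x y d where *: "x \<in> gr A d" "y \<in> gr A d"
      "s = wd (us @ [scl A a x + scl A b y] @ vs) - fscl a (wd (us @ [x] @ vs)) - fscl b (wd (us @ [y] @ vs))"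
      unfolding slot_relations_iff by blast
    have "shape (labelA A us @ (d, Inr (scl A a x + scl A b y)) # labelA A vs)"
      using shape_label[of "[]" "us @ x # vs"] by (auto simp: shape_def sorted_wrt_append labelA_def)
    then show "\<exists>us vs a x b y z. set us \<subseteq> homog_letters L A {False} \<and> set vs \<subseteq> homog_letters L A {False} \<and>
        shape (us @ z # vs) \<and> letter_comb L A {False} a x b y z \<and>
        s = wd (snd (unlabel (us @ z # vs))) - fscl a (wd (snd (unlabel (us @ x # vs)))) - fscl b (wd (snd (unlabel (us @ y # vs))))"
      using * h homog_label[of _ "{False}"]
      by (intro exI[of _ "labelA A us"] exI[of _ "labelA A vs"] exI[of _ a] exI[of _ b]
          exI[of _ "(d, Inr x)"] exI[of _ "(d, Inr y)"] exI[of _ "(d, Inr (scl A a x + scl A b y))"])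
        (auto simp: unlabel_append unlabel_Cons letter_combI)
  next
    fix us vs a x b y z
    assume v: "set us \<subseteq> homog_letters L A {False}" "set vs \<subseteq> homog_letters L A {False}" and "letter_comb L A {False} a x b y z"
    note h = unlabel_homs[OF v(1)] unlabel_homs[OF v(2)]
    let ?s = "wd (snd (unlabel (us @ z # vs))) - fscl a (wd (snd (unlabel (us @ x # vs)))) - fscl b (wd (snd (unlabel (us @ y # vs))))"
    from \<open>letter_comb L A {False} a x b y z\<close> show "?s \<in> T_rel0 A"
    proof (cases rule: letter_comb_cases)
      case (A d u v)
      then have "?s \<in> slot_relations A (\<lambda>x. snd (unlabel us) @ [x] @ snd (unlabel vs))"
        unfolding slot_relations_iff by (intro exI conjI) (auto simp: unlabel_append unlabel_Cons)
      then show ?thesis by (rule T_rel0I) (use h in auto)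
    qed simp
  qed (simp_all add: letter_rel_facts letter_rel_unlabel)
qed

end

section \<open>Coderivations of the regularized coalgebra\<close>

context labelled_pair
begin

text \<open>\<open>Dl\<close> differs from the reduced coproduct by the summand with empty left
  factor; it disappears because the function is set to zero at empty factors.\<close>

lemma reg_Delta_word_functional:
  fixes \<chi> :: "(('l list \<times> 'a list) \<times> ('l list \<times> 'a list) \<Rightarrow>\<^sub>0 'k) \<Rightarrow> 'k"
  assumes \<chi>: "functional \<chi>"
  shows "\<chi> (reg_Delta_word L A w) =
    Dl (\<lambda>u v. if u = [] \<or> v = [] then 0 else \<chi> (wd (unlabel u, unlabel v))) (label L A w)"
    (is "_ = Dl ?g _")
proof (cases w)
  case (Pair xs as)
  show ?thesis
  proof (cases "as = []")
    case True
    show ?thesis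
    proof (cases xs rule: rev_cases)
      case Nil
      then show ?thesis
        using Pair True by (simp add: reg_Delta_word_def label_def functional_simps[OF \<chi>])
    next
      case (snoc ys x)
      let ?h = "\<lambda>u v. \<chi> (wd ((u, []), (v @ [x], [])))"
      have "\<chi> (reg_Delta_word L A w) = (\<Sum>i\<in>{1..length ys}. \<Sum>\<sigma>\<in>unshuffles i (length ys - i).
          sg (koszul (map (hdeg L) xs) (length ys) \<sigma>) * ?h (pick xs \<sigma> 0 i) (pick xs \<sigma> i (length ys)))"
        using Pair True snoc by (simp add: reg_Delta_word_def functional_simps[OF \<chi>] Let_def)
      also have "\<dots> = (\<Sum>i\<in>{1..length ys}. deal (hdeg L) (\<lambda>u v. if length u = i then ?h u v else 0) ys)"
      proof (intro sum.cong refl)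
        fix i assume "i \<in> {1..length ys}"
        then show "(\<Sum>\<sigma>\<in>unshuffles i (length ys - i).
            sg (koszul (map (hdeg L) xs) (length ys) \<sigma>) * ?h (pick xs \<sigma> 0 i) (pick xs \<sigma> i (length ys)))
          = deal (hdeg L) (\<lambda>u v. if length u = i then ?h u v else 0) ys"
          using unshuffle_sum_take[of i "length ys - i" xs "hdeg L" ?h] snoc by simp
      qed
      also have "\<dots> = deal (hdeg L) (\<lambda>u v. \<Sum>i\<in>{1..length ys}. if length u = i then ?h u v else 0) ys"
        by (rule deal_sum[symmetric])
      also have "\<dots> = deal (hdeg L) (\<lambda>u v. ?g (labelL L u) (labelL L v @ [(hdeg L x, Inl x)])) ys"
        by (intro deal_cong) (auto simp: sum.delta' unlabel_append unlabel_Cons Suc_le_eq)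
      also have "\<dots> = Dl ?g (label L A w)"
        using Pair True snoc by (simp add: label_def deal_labelL Dl_split_last isl_label)
      finally show ?thesis .
    qed
  next
    case False
    let ?H = "\<lambda>k u v. sg (degsum L v * degsum A (take k as)) * \<chi> (wd ((u, take k as), (v, drop k as)))"
    let ?P = "{(i, k). i \<le> length xs \<and> k \<le> length as - 1 \<and> 1 \<le> i + k}"
    have "\<chi> (reg_Delta_word L A w) = (\<Sum>(i, k)\<in>?P. \<Sum>\<sigma>\<in>unshuffles i (length xs - i).
        sg (koszul (map (hdeg L) xs) (length xs) \<sigma>) * ?H k (pick xs \<sigma> 0 i) (pick xs \<sigma> i (length xs)))"
      using Pair False
      by (simp add: reg_Delta_word_def functional_simps[OF \<chi>] Let_def sg_add case_prod_unfold mult.assoc)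
    also have "\<dots> = (\<Sum>(i, k)\<in>?P. deal (hdeg L) (\<lambda>u v. if length u = i then ?H k u v else 0) xs)"
    proof (intro sum.cong refl, clarify)
      fix i k assume "i \<le> length xs"
      then show "(\<Sum>\<sigma>\<in>unshuffles i (length xs - i).
        sg (koszul (map (hdeg L) xs) (length xs) \<sigma>) * ?H k (pick xs \<sigma> 0 i) (pick xs \<sigma> i (length xs)))
        = deal (hdeg L) (\<lambda>u v. if length u = i then ?H k u v else 0) xs"
        using unshuffle_sum_take[of i "length xs - i" xs "hdeg L" "?H k"] by simp
    qed
    \<comment> \<open>The index set becomes a full rectangle; the only new pair has i + k = 0 and is
      suppressed by the condition inside.\<close>
    also have "\<dots> = (\<Sum>(i, k)\<in>{..length xs} \<times> {..<length as}.
        deal (hdeg L) (\<lambda>u v. if length u = i \<and> 1 \<le> i + k then ?H k u v else 0) xs)"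
    proof (rule sum.mono_neutral_cong_left)
      show "?P \<subseteq> {..length xs} \<times> {..<length as}" using False by (cases as) auto
      show "\<forall>p\<in>{..length xs} \<times> {..<length as} - ?P.
          (case p of (i, k) \<Rightarrow> deal (hdeg L) (\<lambda>u v. if length u = i \<and> 1 \<le> i + k then ?H k u v else 0) xs) = 0"
      proof
        fix p assume p: "p \<in> {..length xs} \<times> {..<length as} - ?P"
        obtain i k where ik: "p = (i, k)" by (cases p)
        have "\<not> 1 \<le> i + k" using p ik by auto
        then show "(case p of (i, k) \<Rightarrow> deal (hdeg L) (\<lambda>u v. if length u = i \<and> 1 \<le> i + k then ?H k u v else 0) xs) = 0"
          using ik by simp
      qed
    qed auto
    also have "\<dots> = deal (hdeg L) (\<lambda>u v. \<Sum>k<length as. \<Sum>i\<le>length xs.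
        if length u = i \<and> 1 \<le> i + k then ?H k u v else 0) xs"
      by (simp only: sum.cartesian_product[symmetric] deal_sum) (rule sum.swap)
    also have "\<dots> = deal (hdeg L) (\<lambda>u v. \<Sum>k<length as. sg (degsum L v * degsum A (take k as)) *
        ?g (labelL L u @ labelA A (take k as)) (labelL L v @ labelA A (drop k as))) xs"
    proof (intro deal_cong sum.cong refl)
      fix u v :: "'l list" and k assume "length u + length v = length xs" "k \<in> {..<length as}"
      then have "(\<Sum>i\<le>length xs. if length u = i \<and> 1 \<le> i + k then ?H k u v else 0)
          = (if 1 \<le> length u + k then ?H k u v else 0)"
        by (subst sum.mono_neutral_right[of _ "{length u}"]) auto
      also have "\<dots> = sg (degsum L v * degsum A (take k as)) *
          ?g (labelL L u @ labelA A (take k as)) (labelL L v @ labelA A (drop k as))"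
        using \<open>k \<in> {..<length as}\<close> False by (cases u) (auto simp: unlabel_append)
      finally show "(\<Sum>i\<le>length xs. if length u = i \<and> 1 \<le> i + k then ?H k u v else 0) = \<dots>" .
    qed
    also have "\<dots> = Dl ?g (label L A w)"
      unfolding Pair label_def fst_conv snd_conv using False
      by (subst Dl_split) (auto simp: deal_labelL dest: isl_label cong: if_cong)
    finally show ?thesis .
  qed
qed

end

text \<open>The number of nonzero terms depends on the vector, so linearity is checked on a range
  large enough for all the vectors involved. Adding up the bounds \<open>n\<close> over the words of
  a vector yields such a range.\<close>

lemma Sum_any_endo:
  fixes G :: "nat \<Rightarrow> ('w \<Rightarrow>\<^sub>0 'k::field) \<Rightarrow> ('z \<Rightarrow>\<^sub>0 'k)"
  assumes G: "\<And>r. endo (G r)" and n: "\<And>w r. n w \<le> r \<Longrightarrow> G r (wd w) = 0"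
  shows "endo (\<lambda>u. Sum_any (\<lambda>r. G r u))" "Sum_any (\<lambda>r. G r (wd w)) = (\<Sum>r<n w. G r (wd w))"
proof -
  define m where "m u = (\<Sum>w\<in>Poly_Mapping.keys u. n w)" for u :: "'w \<Rightarrow>\<^sub>0 'k"
  have 0: "G r u = 0" if "m u \<le> r" for r u
  proof -
    have "G r (wd w) = 0" if "w \<in> Poly_Mapping.keys u" for w
    proof (rule n)
      have "n w \<le> m u" unfolding m_def using that by (intro member_le_sum) auto
      then show "n w \<le> r" using \<open>m u \<le> r\<close> by simp
    qed
    then show ?thesis
      by (subst endo_lin_ext_eq[OF G]) (simp add: lin_ext_def)
  qed
  have eq: "Sum_any (\<lambda>r. G r u) = (\<Sum>r<k. G r u)" if "m u \<le> k" for u k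
  proof (rule Sum_any.expand_superset)
    show "{r. G r u \<noteq> 0} \<subseteq> {..<k}" using 0[of u] that by (auto simp: not_le[symmetric])
  qed simp
  show "endo (\<lambda>u. Sum_any (\<lambda>r. G r u))"
  proof (rule endoI)
    fix u v and c :: 'k
    let ?k = "m u + m v + m (u + v)"
    show "Sum_any (\<lambda>r. G r (u + v)) = Sum_any (\<lambda>r. G r u) + Sum_any (\<lambda>r. G r v)"
      using eq[of u ?k] eq[of v ?k] eq[of "u + v" ?k] by (simp add: endo_simps[OF G] sum.distrib)
    show "Sum_any (\<lambda>r. G r (fscl c u)) = fscl c (Sum_any (\<lambda>r. G r u))"
      using eq[of u "m u + m (fscl c u)"] eq[of "fscl c u" "m u + m (fscl c u)"]
      by (simp add: endo_simps[OF G] free.scale_sum_right)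
  qed
  show "Sum_any (\<lambda>r. G r (wd w)) = (\<Sum>r<n w. G r (wd w))"
    using eq[of "wd w" "n w"] by (simp add: m_def)
qed

lemma eq_0_if_functionals:
  fixes u :: "'w \<Rightarrow>\<^sub>0 'k::field"
  assumes "\<And>\<phi>. functional \<phi> \<Longrightarrow> \<phi> u = 0"
  shows "u = 0"
proof -
  have "u \<in> fspan {}" by (rule in_span_if_functionals) (rule assms)
  then show ?thesis by simp
qed

section \<open>The operators of a deformation as coderivations\<close>

context deformed_pair
begin

abbreviation "del_k \<equiv> partial_k L A bLL bLA bAA \<delta>L \<delta>A"
abbreviation "del_sum \<equiv> partial L A bLL bLA bAA \<delta>L \<delta>A"

lemma endo_partial_k: "endo (del_k k)"
  unfolding partial_k_def by (rule endo_lin_ext)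

lemma partial_k_model:
  assumes "functional \<phi>" "1 \<le> k"
  shows "\<phi> (del_k k (wd w)) = total {k - 1} D (\<lambda>v. \<phi> (wd (unlabel v))) (label L A w)"
  using partial_k_functional[OF assms(1), of \<delta>L \<delta>A "k - 1" w] assms(2)
  by (simp add: total_def N_eq_0 Int_insert_left)

lemma partial_k_large:
  assumes "length (fst w) + length (snd w) \<le> r"
  shows "del_k (Suc r) (wd w) = 0"
proof (rule eq_0_if_functionals)
  fix \<phi> :: "('l list \<times> 'a list \<Rightarrow>\<^sub>0 'k) \<Rightarrow> 'k" assume "functional \<phi>"
  then show "\<phi> (del_k (Suc r) (wd w)) = 0"
    using assms by (simp add: partial_k_functional N_eq_0 label_def)
qed

lemmas partial_Sum_any = Sum_any_endo[of "\<lambda>r. del_k (Suc r)" "\<lambda>w. length (fst w) + length (snd w)",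
    OF endo_partial_k partial_k_large]

lemma endo_partial: "endo del_sum"
  using partial_Sum_any(1) unfolding partial_def[abs_def] .

lemma partial_model:
  assumes "functional \<phi>"
  shows "\<phi> (del_sum (wd w)) = total UNIV D (\<lambda>v. \<phi> (wd (unlabel v))) (label L A w)"
proof -
  have "del_sum (wd w) = (\<Sum>r<length (label L A w). del_k (Suc r) (wd w))"
    using partial_Sum_any(2)[of w] by (simp add: partial_def label_def)
  then show ?thesis
    by (simp add: functional_simps[OF assms] partial_k_functional[OF assms] total_def)
qed

lemma shape_L_A:
  "\<forall>y\<in>set u. isl (snd y) \<Longrightarrow> \<forall>y\<in>set v. \<not> isl (snd y) \<Longrightarrow> shape (u @ v)"
proof (induction u)
  case Nil
  then show ?case by (induction v) auto
qed auto

lemma LA_rel_eq: "LA_rel L A = fspan LA_rel0"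
  by (simp add: LA_rel_def LA_rel0_def)

context
  fixes I :: "nat set" and F :: "('l list \<times> 'a list \<Rightarrow>\<^sub>0 'k) \<Rightarrow> ('l list \<times> 'a list \<Rightarrow>\<^sub>0 'k)"
  assumes F: "endo F"
    and model: "\<And>\<phi> w. functional \<phi> \<Longrightarrow> \<phi> (F (wd w)) = total I D (\<lambda>v. \<phi> (wd (unlabel v))) (label L A w)"
begin

interpretation word_model fst "\<lambda>y. isl (snd y)" "letter_br bLL bLA bAA" "homog_letters L A UNIV"
  "letter_comb L A UNIV" "LA_words L A" LA_rel0 "label L A" unlabel letter_rel
  by (rule word_model_LA)

text \<open>Homogeneity can be claimed only modulo relations, since the encoding of a word need not
  carry the degrees by which the word was found to lie in a component. The image is therefore placed
  in the span of homogeneous words together with the relations.\<close>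

lemma F_degree:
  assumes "u \<in> LA_comp L A d"
  shows "\<exists>v\<in>LA_comp L A (d + 1). F u - v \<in> LA_rel L A"
proof -
  let ?G = "\<lambda>d. {wd (xs, as) | xs as ds es. (xs \<noteq> [] \<or> as \<noteq> []) \<and>
     of_degs L xs ds \<and> of_degs A as es \<and> sum_list ds + sum_list es = d}"
  have word: "\<exists>ds es. of_degs L (fst (unlabel v)) ds \<and> of_degs A (snd (unlabel v)) es \<and> sum_list ds + sum_list es = degs v"
    if "set v \<subseteq> homog_letters L A UNIV" for v
    using that
  proof (induction v)
    case (Cons y v)
    then obtain ds es where "of_degs L (fst (unlabel v)) ds" "of_degs A (snd (unlabel v)) es"
      "sum_list ds + sum_list es = degs v" by auto
    note h = this
    show ?case
    proof (cases "snd y")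
      case (Inl x)
      then show ?thesis using h Cons.prems
        by (intro exI[of _ "fst y # ds"] exI[of _ es]) (cases y, auto simp: unlabel_Cons of_degs_def)
    next
      case (Inr a)
      then show ?thesis using h Cons.prems
        by (intro exI[of _ ds] exI[of _ "fst y # es"]) (cases y, auto simp: unlabel_Cons of_degs_def)
    qed
  qed (auto simp: of_degs_def)
  have "F u \<in> fspan (?G (d + 1) \<union> LA_rel0)"
  proof (rule in_span_if_functionals)
    fix \<phi> :: "('l list \<times> 'a list \<Rightarrow>\<^sub>0 'k) \<Rightarrow> 'k"
    assume \<phi>: "functional \<phi>" "\<And>s. s \<in> ?G (d + 1) \<union> LA_rel0 \<Longrightarrow> \<phi> s = 0"
    have "\<phi> (F s) = 0" if sG: "s \<in> ?G d" for s
    proof -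
      obtain xs as ds es where s: "s = wd (xs, as)" "xs \<noteq> [] \<or> as \<noteq> []" "of_degs L xs ds" "of_degs A as es"
        "sum_list ds + sum_list es = d" using sG by blast
      \<comment> \<open>The word is labelled with the given degrees and not with
        \<open>hdeg\<close>, so that the words reached have degree exactly d + 1.\<close>
      define vL :: "(int \<times> ('l + 'a)) list" where "vL = map (\<lambda>(d, x). (d, Inl x)) (zip ds xs)"
      define vA :: "(int \<times> ('l + 'a)) list" where "vA = map (\<lambda>(d, a). (d, Inr a)) (zip es as)"
      define v where "v = vL @ vA"
      have "unlabel vL = (xs, []) \<and> degs vL = sum_list ds \<and> set vL \<subseteq> homog_letters L A UNIV"
        using s(3) unfolding of_degs_def vL_def by (induction rule: list_all2_induct) (auto simp: unlabel_Cons)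
      moreover have "unlabel vA = ([], as) \<and> degs vA = sum_list es \<and> set vA \<subseteq> homog_letters L A UNIV"
        using s(4) unfolding of_degs_def vA_def by (induction rule: list_all2_induct) (auto simp: unlabel_Cons)
      ultimately have v: "unlabel v = (xs, as)" "degs v = d" "v \<noteq> []" and "set v \<subseteq> homog_letters L A UNIV"
        using s by (auto simp: v_def unlabel_append)
      have "shape v"
        unfolding v_def by (rule shape_L_A) (auto simp: vL_def vA_def)
      have "\<phi> (F s) = total I D (\<lambda>v. \<phi> (wd (unlabel v))) v"
        using model_word[OF der_letter_map letter_rel_facts(3) F model \<phi>(1), of v] \<phi>(2) v s(1)
          \<open>set v \<subseteq> _\<close> \<open>shape v\<close> by auto
      also have "\<dots> = total I D (\<lambda>v. 0) v"
      proof (rule total_cong)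
        fix w assume w: "reaches (length v) (degs v + 1) (\<forall>x\<in>set v. \<not> isl (snd x)) w"
        then obtain ds es where "of_degs L (fst (unlabel w)) ds" "of_degs A (snd (unlabel w)) es" "sum_list ds + sum_list es = d + 1"
          using word[of w] v(2) by (auto simp: reaches_def)
        moreover have "unlabel w \<in> LA_words L A" using w by (auto simp: reaches_def intro: unl)
        ultimately have "wd (unlabel w) \<in> ?G (d + 1)"
          by (cases "unlabel w") (auto simp: LA_words_def)
        then show "\<phi> (wd (unlabel w)) = 0" using \<phi>(2) by blast
      qed (use der_letter_map \<open>set v \<subseteq> _\<close> \<open>shape v\<close> in auto)
      finally show ?thesis by (simp add: total_def)
    qed
    then show "\<phi> (F u) = 0"
      using functional_span_0[OF functional_comp[OF \<phi>(1) F] _ assms[unfolded LA_comp_def]] by blast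
  qed
  \<comment> \<open>The span of a union splits into a homogeneous part and a part made of
    relations.\<close>
  then obtain v r where "F u = v + r" "v \<in> fspan (?G (d + 1))" "r \<in> fspan LA_rel0"
    unfolding free.span_Un by blast
  then show ?thesis
    by (intro bexI[of _ v]) (simp_all add: LA_rel_eq LA_comp_def)
qed

text \<open>This is \<open>Dl_N\<close> summed over the orders, for a functional extended by zero to
  empty factors. The extension is compatible with the operators, which vanish on the empty word and
  never produce it.\<close>

lemma F_coproduct:
  assumes "u \<in> fspan (wd ` LA_words L A)"
  shows "reg_Delta L A (F u) - LA2_extend L A 1 F (reg_Delta L A u) \<in> LA2_rel L A"
  unfolding LA2_rel_def
proof (rule in_span_if_functionals)
  fix \<phi> :: "(('l list \<times> 'a list) \<times> ('l list \<times> 'a list) \<Rightarrow>\<^sub>0 'k) \<Rightarrow> 'k"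
  assume \<phi>: "functional \<phi>" and \<phi>0: "\<And>s. s \<in> {ftensor r (wd w) | r w. r \<in> LA_rel L A \<and> w \<in> LA_words L A} \<union>
      {ftensor (wd w) r | r w. r \<in> LA_rel L A \<and> w \<in> LA_words L A} \<Longrightarrow> \<phi> s = 0"
  have endo\<Delta>: "endo (reg_Delta L A)" unfolding reg_Delta_def by (rule endo_lin_ext)
  have endoF2: "endo (LA2_extend L A 1 F)" unfolding LA2_extend_def by (rule endo_lin_ext)
  let ?g = "\<lambda>u v. if u = [] \<or> v = [] then 0 else \<phi> (wd (unlabel u, unlabel v))"
  \<comment> \<open>Each splitting puts the zero letter into one of the two factors, and a word with
    a zero letter is itself a relation.\<close>
  have zero: "Dl ?g v = 0" if z: "z \<in> set v" "letter_comb L A UNIV 0 z 0 z z" and v: "set v \<subseteq> homog_letters L A UNIV" "shape v" for z v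
  proof -
    have rel0: "wd (unlabel u) \<in> LA_rel L A" if u: "set u \<subseteq> homog_letters L A UNIV" "z \<in> set u" for u
    proof -
      obtain us vs where "u = us @ z # vs" using split_list[OF u(2)] by blast
      then show ?thesis
        using R0I[of us vs 0 z 0 z z] u z(2) by (simp add: LA_rel_eq free.span_base)
    qed
    have "Dl ?g v = Dl (\<lambda>u v. 0) v"
    proof (rule Dl_cong)
      fix u w :: "(int \<times> ('l + 'a)) list" assume h: "set u \<union> set w = set v" "shape u" "shape w"
      then have ok: "set u \<subseteq> homog_letters L A UNIV" "set w \<subseteq> homog_letters L A UNIV" using v(1) by auto
      show "?g u w = 0"
      proof (cases "u = [] \<or> w = []")
        case False
        then have W: "unlabel u \<in> LA_words L A" "unlabel w \<in> LA_words L A" using ok h unl by auto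
        have "z \<in> set u \<or> z \<in> set w" using h(1) z(1) by blast
        then have "wd (unlabel u, unlabel w) \<in> {ftensor r (wd w) | r w. r \<in> LA_rel L A \<and> w \<in> LA_words L A} \<union>
            {ftensor (wd w) r | r w. r \<in> LA_rel L A \<and> w \<in> LA_words L A}"
          using rel0 ok W ftensor_wd[of "unlabel u" "unlabel w", symmetric] by blast
        then show ?thesis using \<phi>0 False by auto
      qed auto
    qed (use v in auto)
    then show ?thesis using Dl_scale[of 0 "\<lambda>u v. 0" v] by simp
  qed
  \<comment> \<open>As for \<open>model_word\<close>, the formula extends from canonical labels to
    all labels: a discrepancy in parity comes with a zero letter, where both sides vanish.\<close>
  have \<Delta>: "\<phi> (reg_Delta L A (wd (unlabel v))) = Dl ?g v" if v: "set v \<subseteq> homog_letters L A UNIV" "shape v" "v \<noteq> []" for v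
  proof -
    have "\<phi> (reg_Delta L A (wd (unlabel v))) = Dl ?g (label L A (unlabel v))"
      by (simp add: reg_Delta_def reg_Delta_word_functional[OF \<phi>])
    also have "\<dots> = Dl ?g v"
      using rel_or_0[OF v]
    proof
      assume "list_all2 letter_rel v (label L A (unlabel v))"
      then show ?thesis
      proof (rule Dl_rel[symmetric])
        fix u u' w w' :: "(int \<times> ('l + 'a)) list" assume "list_all2 letter_rel u u'" "list_all2 letter_rel w w'"
        then show "?g u w = ?g u' w'" using rel_unl by (auto dest: list_all2_lengthD)
      qed
    next
      assume "(\<exists>z\<in>set v. letter_comb L A UNIV 0 z 0 z z) \<and> (\<exists>z\<in>set (label L A (unlabel v)). letter_comb L A UNIV 0 z 0 z z)"
      then show ?thesis using zero[of _ v] zero[of _ "label L A (unlabel v)"] v enc[OF unl[OF v]] by auto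
    qed
    finally show ?thesis .
  qed
  have words: "\<phi> (reg_Delta L A (F (wd w))) = \<phi> (LA2_extend L A 1 F (reg_Delta L A (wd w)))" if w: "w \<in> LA_words L A" for w
  proof -
    let ?l = "label L A w"
    have l: "set ?l \<subseteq> homog_letters L A UNIV" "shape ?l" using enc[OF w] by auto
    let ?J = "I \<inter> {..<length ?l}"
    let ?T = "\<lambda>u v. \<Sum>r\<in>?J. N r 1 (D r) (\<lambda>u'. ?g u' v) u + sg (1 * degs u) * N r 1 (D r) (?g u) v"
    have "\<phi> (reg_Delta L A (F (wd w))) = total I D (\<lambda>v. \<phi> (reg_Delta L A (wd (unlabel v)))) ?l"
      using model[OF functional_comp[OF \<phi> endo\<Delta>]] .
    also have "\<dots> = total I D (Dl ?g) ?l"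
      by (rule total_cong[OF der_letter_map l]) (auto simp: reaches_def intro!: \<Delta>)
    also have "\<dots> = Dl ?T ?l"
      unfolding total_def Dl_sum using l
      by (intro sum.cong refl Dl_N der_homog[OF der_letter_map]) auto
    also have "\<dots> = Dl (\<lambda>u v. if u = [] \<or> v = [] then 0 else \<phi> (LA2_extend L A 1 F (wd (unlabel u, unlabel v)))) ?l"
    proof (rule Dl_cong[OF l(2)])
      fix u v :: "(int \<times> ('l + 'a)) list" assume h: "set u \<union> set v = set ?l" "length u + length v = length ?l" "shape u" "shape v"
      show "?T u v = (if u = [] \<or> v = [] then 0 else \<phi> (LA2_extend L A 1 F (wd (unlabel u, unlabel v))))"
      proof (cases "u = [] \<or> v = []")
        case True
        then show ?thesis by (elim disjE) (simp_all cong: if_cong)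
      next
        case False
        \<comment> \<open>Both factors consist of letters of an encoded word, so forgetting their
          labels and labelling again changes nothing.\<close>
        have lab: "label L A (unlabel t) = t" if "set t \<subseteq> set ?l" "shape t" for t
        proof -
          have "label L A (unlabel t) = map (relabel L A) t" using that(2) by (intro label_unlabel) (simp add: shape_def)
          also have "\<dots> = t" using that(1) by (intro map_idI relabel_label) auto
          finally show ?thesis .
        qed
        have u: "label L A (unlabel u) = u" and v: "label L A (unlabel v) = v" using h by (auto intro: lab)
        have deg_u: "LA_deg L A (unlabel u) = degs u"
          by (subst (2) u[symmetric]) (simp add: LA_deg_def label_def)
        have 1: "\<phi> (ftensor (F (wd (unlabel u))) (wd (unlabel v))) = (\<Sum>r\<in>?J. N r 1 (D r) (\<lambda>u'. ?g u' v) u)"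
        proof -
          have "\<phi> (ftensor (F (wd (unlabel u))) (wd (unlabel v))) = total I D (\<lambda>u'. \<phi> (ftensor (wd (unlabel u')) (wd (unlabel v)))) u"
            using model[OF functional_comp[OF \<phi> endo_ftensor_left[of "wd (unlabel v)"]], of "unlabel u"] by (simp add: u)
          \<comment> \<open>\<open>total\<close> stops at the length of u; the range is enlarged to
            the length of the whole word so that both factors share one index set.\<close>
          also have "\<dots> = (\<Sum>r\<in>?J. N r 1 (D r) (\<lambda>u'. \<phi> (wd (unlabel u', unlabel v))) u)"
            using h(2) by (subst total_eq[of u "length ?l"]) auto
          also have "\<dots> = (\<Sum>r\<in>?J. N r 1 (D r) (\<lambda>u'. ?g u' v) u)"
            using False by (intro sum.cong refl N_cong_nonempty) auto
          finally show ?thesis .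
        qed
        have 2: "\<phi> (ftensor (wd (unlabel u)) (F (wd (unlabel v)))) = (\<Sum>r\<in>?J. N r 1 (D r) (?g u) v)"
        proof -
          have "\<phi> (ftensor (wd (unlabel u)) (F (wd (unlabel v)))) = total I D (\<lambda>v'. \<phi> (ftensor (wd (unlabel u)) (wd (unlabel v')))) v"
            using model[OF functional_comp[OF \<phi> endo_ftensor_right[of "unlabel u"]], of "unlabel v"] by (simp add: v)
          also have "\<dots> = (\<Sum>r\<in>?J. N r 1 (D r) (\<lambda>v'. \<phi> (wd (unlabel u, unlabel v'))) v)"
            using h(2) by (subst total_eq[of v "length ?l"]) auto
          also have "\<dots> = (\<Sum>r\<in>?J. N r 1 (D r) (?g u) v)"
            using False by (intro sum.cong refl N_cong_nonempty) auto
          finally show ?thesis .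
        qed
        show ?thesis
          using False by (simp add: LA2_extend_def functional_simps[OF \<phi>] 1 2 deg_u sum.distrib sum_distrib_left)
      qed
    qed
    also have "\<dots> = \<phi> (LA2_extend L A 1 F (reg_Delta L A (wd w)))"
      using reg_Delta_word_functional[OF functional_comp[OF \<phi> endoF2], of w] by (simp add: reg_Delta_def)
    finally show ?thesis .
  qed
  have "functional (\<lambda>u. \<phi> (reg_Delta L A (F u) - LA2_extend L A 1 F (reg_Delta L A u)))"
    by (rule functionalI) (simp_all add: functional_simps[OF \<phi>] endo_simps[OF F] endo_simps[OF endo\<Delta>]
        endo_simps[OF endoF2] algebra_simps)
  then show "\<phi> (reg_Delta L A (F u) - LA2_extend L A 1 F (reg_Delta L A u)) = 0"
    by (rule functional_span_0[OF _ _ assms]) (clarify, simp add: functional_simps(2)[OF \<phi>] words)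
qed

lemma F_coderivation: "coderivation L A 1 F"
  unfolding coderivation_def LA_rel_eq[symmetric]
  using endomorphism[OF der_letter_map letter_rel_facts(3) F model] F_degree F_coproduct
  by (auto simp: LA_rel_eq)

lemma F_square_zero: "I = UNIV \<Longrightarrow> square_zero (LA_words L A) (LA_rel L A) F"
  unfolding LA_rel_eq
  by (rule square_zero[OF der_letter_map letter_rel_facts(3) F model, where S = S]) (auto simp: S_comb)

end

lemma coderivation_partial_k: "1 \<le> k \<Longrightarrow> coderivation L A 1 (del_k k)"
  by (rule F_coderivation[OF endo_partial_k partial_k_model])

lemma sh_loday_pair_partial: "sh_loday_pair M L A del_sum"
  using F_coderivation[OF endo_partial partial_model] F_square_zero[OF endo_partial partial_model] graded
  by (simp add: sh_loday_pair_def codifferential_def)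

end

section \<open>Brackets on the suspension\<close>

text \<open>A new first entry shifts every place by one and changes the parity of the length, so the
  places counted before are still counted. The new place 1 counts iff the new length is
  even.\<close>

lemma bracket_exp_simps [simp]:
  "bracket_exp [] = 0"
  "bracket_exp (d # ds) = (if odd (length ds) then d else 0) + bracket_exp ds"
proof -
  show "bracket_exp [] = 0" by (simp add: bracket_exp_def)
  let ?P = "\<lambda>ds r. r \<in> {1..length (ds :: int list)} \<and> (odd r \<longleftrightarrow> even (length ds))"
  have "{r. ?P (d # ds) r} = (if odd (length ds) then {1} else {}) \<union> Suc ` {r. ?P ds r}"
  proof (intro equalityI subsetI)
    fix r assume "r \<in> {r. ?P (d # ds) r}"
    then show "r \<in> (if odd (length ds) then {1} else {}) \<union> Suc ` {r. ?P ds r}"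
      by (cases r; cases "r = 1") (auto simp: image_iff)
  qed (auto split: if_splits)
  moreover have "(if odd (length ds) then {1} else {}) \<inter> Suc ` {r. ?P ds r} = {}" by auto
  moreover have "finite {r. ?P ds r}" by (rule finite_subset[of _ "{1..length ds}"]) auto
  ultimately have "bracket_exp (d # ds) = (\<Sum>r\<in>(if odd (length ds) then {1} else {}). (d # ds) ! (r - 1))
      + (\<Sum>r\<in>Suc ` {r. ?P ds r}. (d # ds) ! (r - 1))"
    unfolding bracket_exp_def by (simp add: sum.union_disjoint)
  also have "(\<Sum>r\<in>Suc ` {r. ?P ds r}. (d # ds) ! (r - 1)) = bracket_exp ds"
    unfolding bracket_exp_def by (subst sum.reindex) (auto intro!: sum.cong simp: nth_Cons split: nat.splits)
  finally show "bracket_exp (d # ds) = (if odd (length ds) then d else 0) + bracket_exp ds" by simp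
qed

text \<open>The i-th of k degrees enters the suspension sign with weight k - i, so modulo 2 the
  places with k - i odd remain: odd places for even k, even places for odd k. This is the origin of
  the sign in the higher brackets.\<close>

lemma even_susp_bracket_exp: "even (susp_exp ds) \<longleftrightarrow> even (bracket_exp ds)"
  by (induction ds) auto

lemma even_bracket_exp_cong:
  "list_all2 (\<lambda>d e. even d \<longleftrightarrow> even e) ds es \<Longrightarrow> even (bracket_exp ds) \<longleftrightarrow> even (bracket_exp es)"
  by (induction rule: list_all2_induct) (auto dest: list_all2_lengthD)

lemma psign_psign: "(even m \<longleftrightarrow> even n) \<Longrightarrow> psign m (psign n v) = v"
  by (simp add: psign_def)

lemma unsusp_psign [simp]: "unsusp (psign n v) = psign n (unsusp v)"
  by (simp add: psign_def uminus_susp_def)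

lemma desusp1_n_L: "desusp1 V (n_L V b f) xs = N_L b f xs"
  by (simp add: desusp1_def n_L_def Let_def comp_def psign_psign even_susp_bracket_exp)

lemma desusp2_n_A: "desusp2 L A (n_A L A bLL bLA bAA DL DA) xs as = N_A bLL bLA bAA DL DA xs as"
  by (simp add: desusp2_def n_A_def Let_def comp_def psign_psign even_susp_bracket_exp)

text \<open>With no entries from L the bracket is the iterated product of one space, so
  multilinearity and degrees on sL and sA are settled by the same lemma.\<close>

lemma n_A_Nil: "n_A L A bLL bLA bAA DL DA [] = n_L A bAA DA"
  by (rule ext) (simp add: n_A_def n_L_def N_A_def N_L_def)

lemma N_A_Nil: "N_A bLL bLA bAA DL DA [] as = N_L bAA DA as"
  by (simp add: N_A_def N_L_def)

lemma multilinear_n_L: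
  assumes V: "graded_space M V" and M: "M = 0 \<or> M = 2" and b: "bilinear_deg0 V V V b"
    and f: "linear_deg V 1 f" and "1 \<le> n"
  shows "multilinear_deg (suspension V) n (2 - int n) (n_L V b f)"
proof -
  interpret vector_space "scl V" using graded_spaceD(1)[OF V] .
  have lin: "b (scl V a x + scl V c y) z = scl V a (b x z) + scl V c (b y z)"
    "b z (scl V a x + scl V c y) = scl V a (b z x) + scl V c (b z y)"
    "f (scl V a x + scl V c y) = scl V a (f x) + scl V c (f y)" for a c x y z
    using b[unfolded bilinear_deg0_def, THEN conjunct1, THEN spec, of z, THEN linear_comb]
      b[unfolded bilinear_deg0_def, THEN conjunct2, THEN conjunct1, THEN spec, of z, THEN linear_comb]
      f[unfolded linear_deg_def, THEN conjunct1, THEN linear_comb] by blast+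
  have b_gr: "b x y \<in> gr V (p + q)" if "x \<in> gr V p" "y \<in> gr V q" for x y p q
    using b that unfolding bilinear_deg0_def by blast
  have f_gr: "f x \<in> gr V (p + 1)" if "x \<in> gr V p" for x p
    using f that unfolding linear_deg_def by blast
  have foldl: "foldl b (scl V a x + scl V c y) v = scl V a (foldl b x v) + scl V c (foldl b y v)" for a c x y v
    by (induction v arbitrary: x y) (auto simp: lin)
  have N: "N_L b f (us @ (scl V a x + scl V c y) # vs) = scl V a (N_L b f (us @ x # vs)) + scl V c (N_L b f (us @ y # vs))"
    for a c x y us vs
    by (cases us) (auto simp: N_L_def lin foldl)
  have N0: "N_L b f (us @ 0 # vs) = 0" for us vs
    using N[of us 0 0 0 0 vs] by simp
  have N_gr: "N_L b f xs \<in> gr V (sum_list ds + 1)" if h: "of_degs V xs ds" "xs \<noteq> []" for xs ds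
  proof -
    have foldl_gr: "foldl b z xs \<in> gr V (d + sum_list ds)" if "z \<in> gr V d" "list_all2 (\<lambda>x d. x \<in> gr V d) xs ds" for z d xs ds
      using that(2,1)
    proof (induction arbitrary: z d rule: list_all2_induct)
      case (Cons x xs d' ds)
      then show ?case using Cons.IH[OF b_gr[OF Cons.prems Cons.hyps(1)]] by (simp add: add.assoc)
    qed simp
    obtain x xs' where xs: "xs = x # xs'" using h(2) by (cases xs) auto
    then obtain d ds' where ds: "ds = d # ds'" using h(1) by (cases ds) (auto simp: of_degs_def)
    have x: "x \<in> gr V d" "list_all2 (\<lambda>x d. x \<in> gr V d) xs' ds'"
      using h(1) by (auto simp: of_degs_def xs ds)
    have "foldl b (f x) xs' \<in> gr V (d + 1 + sum_list ds')"
      by (rule foldl_gr[OF f_gr[OF x(1)] x(2)])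
    then show ?thesis by (simp add: N_L_def xs ds add_ac)
  qed
  \<comment> \<open>The sign is defined through \<open>hdeg\<close> and is linear only after
    \<open>hdeg\<close> of the varying entry is replaced by its given degree. The parities agree
    unless the entry is 0, where the bracket vanishes.\<close>
  have sign: "psign (bracket_exp (map (hdeg V) us @ hdeg V x # map (hdeg V) vs)) (N_L b f (us @ x # vs))
      = psign (bracket_exp (map (hdeg V) us @ d # map (hdeg V) vs)) (N_L b f (us @ x # vs))"
    if "x \<in> gr V d" for us x vs d
  proof (cases "x = 0")
    case True
    then show ?thesis by (simp add: N0 psign_def)
  next
    case False
    then have "even (hdeg V x) \<longleftrightarrow> even d" using even_hdeg[OF V M that] by simp
    then have "even (bracket_exp (map (hdeg V) us @ hdeg V x # map (hdeg V) vs)) \<longleftrightarrow>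
        even (bracket_exp (map (hdeg V) us @ d # map (hdeg V) vs))"
      by (intro even_bracket_exp_cong list_all2_appendI) (auto simp: list_all2_same)
    then show ?thesis by (simp add: psign_def)
  qed
  have n_L: "n_L V b f (us @ Susp x # vs) = Susp (psign (bracket_exp (map (hdeg V \<circ> unsusp) us @ d # map (hdeg V \<circ> unsusp) vs))
      (N_L b f (map unsusp us @ x # map unsusp vs)))" if "x \<in> gr V d" for us x vs d
    using sign[OF that, of "map unsusp us" "map unsusp vs"]
    by (auto simp: n_L_def Let_def intro!: susp.expand)
  show ?thesis
    unfolding multilinear_deg_def
  proof (intro conjI allI ballI impI)
    fix us vs d a c x y
    assume "x \<in> gr (suspension V) d" "y \<in> gr (suspension V) d"
    then obtain x' y' where xy: "x = Susp x'" "y = Susp y'" "x' \<in> gr V (d - 1)" "y' \<in> gr V (d - 1)"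
      by (auto simp: suspension_def)
    then have "scl V a x' + scl V c y' \<in> gr V (d - 1)" using graded_spaceD[OF V] by blast
    with xy show "n_L V b f (us @ [scl (suspension V) a x + scl (suspension V) c y] @ vs) =
       scl (suspension V) a (n_L V b f (us @ [x] @ vs)) + scl (suspension V) c (n_L V b f (us @ [y] @ vs))"
      by (simp add: suspension_def plus_susp_def n_L[where d = "d - 1"] N psign_scl[OF graded_spaceD(1)[OF V]]
          scale_right_distrib mult.commute)
  next
    fix xs ds assume "of_degs (suspension V) xs ds \<and> length xs = n"
    then have h: "of_degs (suspension V) xs ds" "length xs = n" by auto
    then have ds: "of_degs V (map unsusp xs) (map (\<lambda>d. d - 1) ds)" "length ds = n"
      by (auto simp: of_degs_def suspension_def list_all2_conv_all_nth)
    have "sum_list (map (\<lambda>d. d - 1) ds) = sum_list ds - int (length ds)" by (induction ds) auto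
    then have "N_L b f (map unsusp xs) \<in> gr V (sum_list ds - int n + 1)"
      using N_gr[OF ds(1)] h(2) ds(2) \<open>1 \<le> n\<close> by (cases xs) auto
    then have "psign (bracket_exp (map (hdeg V) (map unsusp xs))) (N_L b f (map unsusp xs)) \<in> gr V (sum_list ds - int n + 1)"
      unfolding psign_scl[OF graded_spaceD(1)[OF V]] by (rule graded_spaceD(4)[OF V])
    moreover have "n_L V b f xs = Susp (psign (bracket_exp (map (hdeg V) (map unsusp xs))) (N_L b f (map unsusp xs)))"
      by (auto simp: n_L_def Let_def intro!: susp.expand)
    ultimately have "n_L V b f xs \<in> Susp ` gr V (sum_list ds - int n + 1)" by simp
    \<comment> \<open>Desuspending n entries lowers the degree by n, the derivation raises it by 1,
      and suspending the value raises it by 1 again: 2 - n in all.\<close>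
    moreover have "sum_list ds - int n + 1 = sum_list ds + (2 - int n) - 1" by simp
    ultimately have "n_L V b f xs \<in> Susp ` gr V (sum_list ds + (2 - int n) - 1)" by (simp only:)
    then show "n_L V b f xs \<in> gr (suspension V) (sum_list ds + (2 - int n))"
      by (simp only: suspension_def gspace.select_convs)
  qed
qed

section \<open>The sh Loday and sh associative structures on the two restrictions\<close>

context deformed_pair
begin

lemma linear_deg_der: "linear_deg L 1 (\<delta>L i)" "linear_deg A 1 (\<delta>A i)"
  using derivation[of i] unfolding pair_derivation_def by blast+

text \<open>Desuspending the brackets gives back \<open>N_L\<close>, so the coderivation on TL is
  modelled by the same operators on labelled words, now over L alone.\<close>

lemma sh_loday_algebra_n_L: "sh_loday_algebra L (\<lambda>k. n_L L bLL (\<delta>L (k - 1)))"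
proof -
  define F where "F = lin_ext (\<lambda>xs. Sum_any (\<lambda>i. coder_L_word L 1 (Suc i) (N_L bLL (\<delta>L i)) xs))"
  have F: "endo F" unfolding F_def by (rule endo_lin_ext)
  have model: "\<phi> (F (wd xs)) = total UNIV D (\<lambda>v. \<phi> (wd (fst (unlabel v)))) (labelL L xs)"
    if \<phi>: "functional \<phi>" for \<phi> xs
  proof -
    have "F (wd xs) = (\<Sum>i<length xs. coder_L_word L 1 (Suc i) (N_L bLL (\<delta>L i)) xs)"
      unfolding F_def lin_ext_wd
      by (rule Sum_any.expand_superset) (auto simp: coder_L_word_def not_less[symmetric] intro: ccontr)
    moreover have "\<phi> (coder_L_word L 1 (Suc i) (N_L bLL (\<delta>L i)) xs) =
        N i 1 (D i) (\<lambda>v. \<phi> (wd (fst (unlabel v)))) (labelL L xs)" for i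
      by (rule coder_L_functional[OF \<phi>])
    ultimately show ?thesis
      by (simp add: functional_simps[OF \<phi>] total_def)
  qed
  interpret word_model fst "\<lambda>y. isl (snd y)" "letter_br bLL bLA bAA" "homog_letters L A {True}"
    "letter_comb L A {True}" "T_words L" "T_rel0 L" "labelL L" "\<lambda>v. fst (unlabel v)" letter_rel
    by (rule word_model_T_L)
  have T: "T_rel L = fspan (T_rel0 L)" by (simp add: T_rel_def T_rel0_def)
  have "endomorphism (T_words L) (T_rel L) F"
    unfolding T by (rule endomorphism[OF der_letter_map letter_rel_facts(3) F model])
  moreover have "square_zero (T_words L) (T_rel L) F"
    unfolding T by (rule square_zero[OF der_letter_map letter_rel_facts(3) F model, where S = S]) (auto simp: S_comb)
  ultimately show ?thesis
    unfolding sh_loday_algebra_def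
    using multilinear_n_L[OF graded(1) M bilinear_deg0(1) linear_deg_der(1)]
    by (simp add: desusp1_n_L[abs_def] F_def)
qed

lemma sh_assoc_algebra_n_A:
  "sh_assoc_algebra A (\<lambda>k. n_A L A bLL bLA bAA (\<delta>L (k - 1)) (\<delta>A (k - 1)) [])"
proof -
  define F where "F = lin_ext (\<lambda>as. Sum_any (\<lambda>i. coder_A_word A 1 (Suc i) (N_L bAA (\<delta>A i)) as))"
  have F: "endo F" unfolding F_def by (rule endo_lin_ext)
  have model: "\<phi> (F (wd as)) = total UNIV D (\<lambda>v. \<phi> (wd (snd (unlabel v)))) (labelA A as)"
    if \<phi>: "functional \<phi>" for \<phi> as
  proof -
    have "F (wd as) = (\<Sum>i<length as. coder_A_word A 1 (Suc i) (N_L bAA (\<delta>A i)) as)"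
      unfolding F_def lin_ext_wd
      by (rule Sum_any.expand_superset) (auto simp: coder_A_word_def split: if_splits)
    moreover have "N_L bAA (\<delta>A i) = N_A bLL bLA bAA (\<delta>L i) (\<delta>A i) []" for i
      by (rule ext) (simp add: N_A_Nil)
    ultimately show ?thesis
      by (simp add: functional_simps[OF \<phi>] coder_A_functional[OF \<phi>] total_def)
  qed
  interpret word_model fst "\<lambda>y. isl (snd y)" "letter_br bLL bLA bAA" "homog_letters L A {False}"
    "letter_comb L A {False}" "T_words A" "T_rel0 A" "labelA A" "\<lambda>v. snd (unlabel v)" letter_rel
    by (rule word_model_T_A)
  have T: "T_rel A = fspan (T_rel0 A)" by (simp add: T_rel_def T_rel0_def)
  have "endomorphism (T_words A) (T_rel A) F"
    unfolding T by (rule endomorphism[OF der_letter_map letter_rel_facts(3) F model])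
  moreover have "square_zero (T_words A) (T_rel A) F"
    unfolding T by (rule square_zero[OF der_letter_map letter_rel_facts(3) F model, where S = S]) (auto simp: S_comb)
  ultimately show ?thesis
    unfolding sh_assoc_algebra_def n_A_Nil
    using multilinear_n_L[OF graded(2) M bilinear_deg0(3) linear_deg_der(2)]
    by (simp add: desusp1_n_L[abs_def] F_def)
qed

end

theorem proposition4p12:
  fixes M :: int
    and L :: "('k::field_char_0, 'l::ab_group_add) gspace"
    and A :: "('k, 'a::ab_group_add) gspace"
    and bLL :: "'l \<Rightarrow> 'l \<Rightarrow> 'l" and bLA :: "'l \<Rightarrow> 'a \<Rightarrow> 'a" and bAA :: "'a \<Rightarrow> 'a \<Rightarrow> 'a"
    and \<delta>L :: "nat \<Rightarrow> 'l \<Rightarrow> 'l" and \<delta>A :: "nat \<Rightarrow> 'a \<Rightarrow> 'a"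
  assumes "M = 0 \<or> M = 2"
    and "dg_loday_pair M L A bLL bLA bAA (\<delta>L 0) (\<delta>A 0)"
    and "deformation L A bLL bLA bAA \<delta>L \<delta>A"
  shows "(\<forall>k\<ge>1. coderivation L A 1 (partial_k L A bLL bLA bAA \<delta>L \<delta>A k)) \<and>
    sh_loday_pair M L A (partial L A bLL bLA bAA \<delta>L \<delta>A) \<and>
    (\<forall>k\<ge>1. \<forall>xs. set xs \<subseteq> homs L \<and> length xs = k \<longrightarrow>
       N_L bLL (\<delta>L (k - 1)) xs = desusp1 L (n_L L bLL (\<delta>L (k - 1))) xs) \<and>
    (\<forall>k\<ge>1. \<forall>xs as. set xs \<subseteq> homs L \<and> set as \<subseteq> homs A \<and> length xs + length as = k \<and> as \<noteq> [] \<longrightarrow>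
       N_A bLL bLA bAA (\<delta>L (k - 1)) (\<delta>A (k - 1)) xs as
         = desusp2 L A (n_A L A bLL bLA bAA (\<delta>L (k - 1)) (\<delta>A (k - 1))) xs as) \<and>
    sh_loday_algebra L (\<lambda>k. n_L L bLL (\<delta>L (k - 1))) \<and>
    sh_assoc_algebra A (\<lambda>k. n_A L A bLL bLA bAA (\<delta>L (k - 1)) (\<delta>A (k - 1)) [])"
proof -
  interpret deformed_pair L A bLL bLA bAA M \<delta>L \<delta>A
    using assms(1,3) assms(2)[unfolded dg_loday_pair_def, THEN conjunct1] by unfold_locales
  show ?thesis
    using coderivation_partial_k sh_loday_pair_partial sh_loday_algebra_n_L sh_assoc_algebra_n_A
    by (simp add: desusp1_n_L desusp2_n_A)
qed

end
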